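(* Consider the closed-loop system, for $x\in[0,1]$ and $t\ge 0$, consisting of the PDE $$z_t(x,t)=[\theta(x)z_x(x,t)]_x+\lambda(x)z(x,t),$$ the Robin boundary conditions $$-b_0z_x(0,t)+a_0z(0,t)=u_0(t)+\psi_0(t),\qquad b_1z_x(1,t)+a_1z(1,t)=u_1(t)+\psi_1(t),$$ the initial condition $z(x,0)=z_0(x)\in L_2(0,1)$, and the adaptive boundary control laws, for $i\in\{0,1\}$ with $x_0=0$, $x_1=1$, $$u_i(t)=-k_iz(x_i,t)-M_i(t)\,\mathrm{sign}(z(x_i,t)),\qquad \dot M_i(t)=-\alpha_iM_i(t)+\gamma_i|z(x_i,t)|,\qquad M_i(0)=M_{0,i}.$$ Assume: (A1) $\theta\in C^1$, and there are constants $\theta_{\mathrm m},\theta_{\mathrm M},\lambda_{\mathrm m},\lambda_{\mathrm M}$ such that for all $x\in[0,1]$: $0<\theta_{\mathrm m}\le\theta(x)\le\theta_{\mathrm M}$, $\lambda_{\mathrm m}\le\lambda(x)\le\lambda_{\mathrm M}$, and $\lambda_{\mathrm M}<\frac{\pi^2}{4}\theta_{\mathrm m}$. (A2) There are constants $a_{\mathrm m,i},a_{\mathrm M,i},b_{\mathrm M,i}$ such that $a_{\mathrm m,i}\le a_i\le a_{\mathrm M,i}$ and $0<b_i\le b_{\mathrm M,i}$ for $i\in\{0,1\}$. (A3) There are constants $\Phi_0,\Phi_1$ such that $|\psi_i(t)|\le\Phi_i$ for all $t\ge0$, $i\in\{0,1\}$. Let $M_{0,i}\ge0$ and $\gamma_i>0$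 for $i\in\{0,1\}$, and put $\overline{\lambda_{\mathrm M}}:=\max\{0,\lambda_{\mathrm M}\}$. Then the following statements hold. (i) (Bidirectional adaptation.) Let $\alpha_0,\alpha_1>0$ and $$k_0>\frac{\overline{\lambda_{\mathrm M}}\,\pi^2}{\theta_{\mathrm m}\pi^2-4\overline{\lambda_{\mathrm M}}}\,b_{\mathrm M,0}-a_{\mathrm m,0},\qquad k_1\ge-a_{\mathrm m,1}.$$ Then there exist constants $T$ and $\mathcal B$ such that $$\|z(\cdot,t)\|_{L_2}\le\mathcal B\qquad\forall t\ge T,\ \forall z_0(x).$$ (ii) (Monodirectional adaptation.) Let $\alpha_0=\alpha_1=0$, assume in addition that there are constants $\Phi_{\mathrm d,0},\Phi_{\mathrm d,1}$ such that $\left|\frac{d}{dt}\psi_i(t)\right|\le\Phi_{\mathrm d,i}$ for all $t\ge0$, $i\in\{0,1\}$, and let $$k_0\ge\frac{\overline{\lambda_{\mathrm M}}\,\pi^2}{\theta_{\mathrm m}\pi^2-4\overline{\lambda_{\mathrm M}}}\,b_{\mathrm M,0}-a_{\mathrm m,0}+\gamma_0,\qquad k_1\ge-a_{\mathrm m,1}+\gamma_1.$$ Then the zero solution $z^*(x,t)=0$ is globally asymptotically stable in the $L_2(0,1)$-sense, that is, $$\lim_{t\to\infty}\|z(\cdot,t)-z^*(\cdot,t)\|_{L_2}=0\qquad\forall z_0(x).$$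
   Context: Subscripts $x$, $t$ on $z$ denote partial derivatives, and $\|f\|_{L_2}=\left(\int_0^1 f(x)^2\,dx\right)^{1/2}$. The state $z(x,t)$ is a real scalar field evolving in $L_2(0,1)$; $\theta,\lambda$ are real functions on $[0,1]$ (diffusion and reaction coefficients); $a_i,b_i,k_i,\alpha_i,\gamma_i,M_{0,i}$ are real constants; $u_i$ are the boundary control inputs, $M_i$ the adaptive gains, and $\psi_i$ real-valued disturbance signals on $[0,\infty)$. Solution concept: the control is discontinuous on the manifolds $z(0,t)=0$ and $z(1,t)=0$. Away from these discontinuity manifolds, solutions of the closed-loop system are understood in the weak sense; on them, solutions are understood in the Filippov (sliding-mode) sense. If a sliding mode occurs on $z(x_i,t)=0$, it is governed by the same PDE with the boundary condition at $x_i$ replaced by $z(x_i,t)=0$, while the Robin boundary condition at the other end remains in force (and similarly for sliding on $z(0,t)=z(1,t)=0$). The solutions $z(\cdot,t)$ are considered to lie in the Sobolev space $H^1(0,1)$.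
   Formalization: In (i), the bound B is uniform over all initial states, but the time T may depend on z_0: a T common to all z_0 is impossible, since for zero disturbance and zero initial gains the closed loop is positively homogeneous and solutions scale with z_0. *)

theory Defs
  imports "HOL-Analysis.Analysis"
begin

definition C1_on :: "real set \<Rightarrow> (real \<Rightarrow> real) \<Rightarrow> bool" where
  "C1_on S f \<longleftrightarrow>
     (\<exists>f'. continuous_on S f' \<and> (\<forall>x\<in>S. (f has_real_derivative f' x) (at x within S)))"

definition L2 :: "(real \<Rightarrow> real) \<Rightarrow> bool" where
  "L2 f \<longleftrightarrow> f \<in> borel_measurable (lebesgue_on {0..1}) \<and>
             integrable (lebesgue_on {0..1}) (\<lambda>x. (f x)\<^sup>2)"

definition L2_norm :: "(real \<Rightarrow> real) \<Rightarrow> real" where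
  "L2_norm f = sqrt (\<integral>x. (f x)\<^sup>2 \<partial>lebesgue_on {0..1})"

definition L2_inner :: "(real \<Rightarrow> real) \<Rightarrow> (real \<Rightarrow> real) \<Rightarrow> real" where
  "L2_inner f g = (\<integral>x. f x * g x \<partial>lebesgue_on {0..1})"

(* f is in the Sobolev space H^1(0,1) with derivative g.  Elements of H^1(0,1) are taken in their
   absolutely continuous representative on [0,1], so that f 0 and f 1 are the boundary traces. *)
definition H1 :: "(real \<Rightarrow> real) \<Rightarrow> (real \<Rightarrow> real) \<Rightarrow> bool" where
  "H1 f g \<longleftrightarrow> L2 g \<and> (\<forall>x\<in>{0..1}. f x = f 0 + (\<integral>y. g y \<partial>lebesgue_on {0..x}))"

(* Filippov convexification of the sign function. *)
definition Sign :: "real \<Rightarrow> real set" where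
  "Sign y = (if y = 0 then {-1..1} else {sgn y})"

(* The right-hand side of the weak form.  Integrating [theta z_x]_x phi by parts over [0,1] leaves
   the boundary term theta(1) z_x(1) phi(1) - theta(0) z_x(0) phi(0), in which the Robin conditions
   give z_x(1) = (u_1 + psi_1 - a_1 z(1)) / b_1 and -z_x(0) = (u_0 + psi_0 - a_0 z(0)) / b_0.
   Here w = z(.,t), w' = z_x(.,t), and v i = u_i(t) + psi_i(t). *)
definition weak_rhs ::
  "(real \<Rightarrow> real) \<Rightarrow> (real \<Rightarrow> real) \<Rightarrow> (nat \<Rightarrow> real) \<Rightarrow> (nat \<Rightarrow> real) \<Rightarrow>
   (real \<Rightarrow> real) \<Rightarrow> (real \<Rightarrow> real) \<Rightarrow> (nat \<Rightarrow> real) \<Rightarrow>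
   (real \<Rightarrow> real) \<Rightarrow> (real \<Rightarrow> real) \<Rightarrow> real" where
  "weak_rhs \<theta> lam a b w w' v \<phi> \<phi>' =
     - L2_inner (\<lambda>x. \<theta> x * w' x) \<phi>' + L2_inner (\<lambda>x. lam x * w x) \<phi>
     + (\<Sum>i\<in>{0,1}. \<theta> (real i) * \<phi> (real i) * ((v i - a i * w (real i)) / b i))"

(* (z, M) solves the closed loop with initial state z0, gains M starting at M0, and boundary points
   x_i = real i for i = 0, 1; z x t is the state at position x and time t.
   The solution is weak, of class C([0,oo); L2) and locally in L2(0,oo; H1), with z(.,t) in H1 for
   t > 0; the gain equations are in Caratheodory (integral) form.  The discontinuous inputs are in
   the sense of Filippov: u_i is a measurable selection of -k_i z(x_i,t) - M_i(t) Sign (z(x_i,t)).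
   When z(x_i,t) vanishes on a time interval (a sliding mode), the Dirichlet condition thus replaces
   the Robin condition at x_i and u_i is the equivalent control, with values in [-M_i, M_i].
   Measurability of lam makes the reaction term meaningful; that of psi_i is implied by the weak
   form, whose time integrand has to be integrable. *)
definition closed_loop_solution ::
  "(real \<Rightarrow> real) \<Rightarrow> (real \<Rightarrow> real) \<Rightarrow> (nat \<Rightarrow> real) \<Rightarrow> (nat \<Rightarrow> real) \<Rightarrow>
   (nat \<Rightarrow> real) \<Rightarrow> (nat \<Rightarrow> real) \<Rightarrow> (nat \<Rightarrow> real) \<Rightarrow> (nat \<Rightarrow> real) \<Rightarrow>
   (nat \<Rightarrow> real \<Rightarrow> real) \<Rightarrow> (real \<Rightarrow> real) \<Rightarrow>
   (real \<Rightarrow> real \<Rightarrow> real) \<Rightarrow> (nat \<Rightarrow> real \<Rightarrow> real) \<Rightarrow> bool" where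
  "closed_loop_solution \<theta> lam a b k \<alpha> \<gamma> M0 \<psi> z0 z M \<longleftrightarrow>
     lam \<in> borel_measurable (lebesgue_on {0..1}) \<and>
     (\<forall>x\<in>{0..1}. z x 0 = z0 x) \<and>
     (\<forall>t\<ge>0. L2 (\<lambda>x. z x t) \<and>
        ((\<lambda>s. L2_norm (\<lambda>x. z x s - z x t)) \<longlongrightarrow> 0) (at t within {0..})) \<and>
     (\<forall>i\<in>{0,1}. \<forall>t\<ge>0.
        ((\<lambda>s. - \<alpha> i * M i s + \<gamma> i * \<bar>z (real i) s\<bar>) has_integral (M i t - M0 i)) {0..t}) \<and>
     (\<exists>zx u.
        (\<forall>t>0. H1 (\<lambda>x. z x t) (\<lambda>x. zx x t)) \<and>
        set_borel_measurable lborel ({0..1} \<times> {0<..}) (\<lambda>(x, t). z x t) \<and>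
        set_borel_measurable lborel ({0..1} \<times> {0<..}) (\<lambda>(x, t). zx x t) \<and>
        (\<forall>T>0. set_integrable lborel ({0..1} \<times> {0<..T}) (\<lambda>(x, t). (z x t)\<^sup>2 + (zx x t)\<^sup>2)) \<and>
        (\<forall>i\<in>{0,1}. set_borel_measurable lebesgue {0..} (u i) \<and>
           (AE t in lebesgue. t > 0 \<longrightarrow>
              u i t \<in> {- k i * z (real i) t - M i t * s | s. s \<in> Sign (z (real i) t)})) \<and>
        (\<forall>\<phi> \<phi>'. H1 \<phi> \<phi>' \<longrightarrow>
           (\<forall>t\<ge>0. ((\<lambda>s. weak_rhs \<theta> lam a b (\<lambda>x. z x s) (\<lambda>x. zx x s) (\<lambda>i. u i s + \<psi> i s) \<phi> \<phi>')
              has_integral (L2_inner (\<lambda>x. z x t) \<phi> - L2_inner z0 \<phi>)) {0..t})))"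

end

theory Submission
  imports Defs
begin

text \<open>
  The Lyapunov function is \<open>V = \<parallel>z\<parallel>\<^sup>2 / 2 + (\<Sum>i. \<theta> i / (2 * b i * \<gamma> i) * (M i - \<Phi> i)\<^sup>2)\<close>: the gain terms are weighted so that
  along solutions they cancel the excess \<open>(\<Phi> i - M i) * \<bar>z i\<bar>\<close> left by the disturbance. Wirtinger's inequality
  makes the remaining quadratic form coercive, so \<open>V\<close> satisfies \<open>V' \<le> D - d * V\<close> in case (i) and
  \<open>V' \<le> - c * \<parallel>z\<parallel>\<^sup>2\<close> in case (ii). In case (ii) the energy \<open>\<parallel>z\<parallel>\<^sup>2\<close> is therefore integrable up to infinity and,
  growing at most at a bounded rate, tends to zero.

  Weak solutions are not differentiable in time, so the energy balance for \<open>\<parallel>z\<parallel>\<^sup>2\<close> is obtained from the cosine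
  coefficients of \<open>z\<close>, which are indefinite integrals in time. Differentiating the cosine series in \<open>x\<close> gives
  the sine series of \<open>z\<^sub>x\<close>, whose completeness allows the passage to the limit.
\<close>

subsection \<open>Square-integrable functions on the unit interval\<close>

text \<open>The weak form admits only test functions that do not depend on time, so the solution
  itself cannot be inserted. Cosines are suitable probes: the sines that arise from them vanish at
  both ends, so the coefficients of an arbitrary H1 function and of its derivative correspond
  without boundary terms, whatever the Robin data are. The boundary inputs act through traces, which
  are not L2 pairings with the state; writing a trace as an integral of \<open>w\<close> and
  \<open>w'\<close> turns them into ordinary L2 coefficients. The state at time zero is merely in
  L2, so every balance is taken on \<open>{s..t}\<close> with \<open>0 < s\<close>; continuity at
  zero makes the entry time in (i) depend on the initial data and not on the solution. The threshold
  for \<open>k 0\<close> comes from Wirtinger's inequality for \<open>w - w 0\<close> followed by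
  Young's inequality with an optimised parameter. It has to be exceeded strictly, which in (ii)
  follows from \<open>\<gamma> 0 > 0\<close>. Sliding modes need no separate treatment: a Filippov
  value \<open>r\<close> of the sign at \<open>y\<close> always satisfies
  \<open>r * y = \<bar>y\<bar>\<close>, so the power of the input does not depend on the
  selection.\<close>

abbreviation "I01 \<equiv> lebesgue_on {0..1::real}"

lemma finite_measure_I01: "finite_measure I01"
  by (simp add: finite_measure_lebesgue_on)

lemma measure_I01 [simp]: "measure I01 {0..1} = 1"
  by (simp add: measure_restrict_space)

lemma L2D: "L2 f \<Longrightarrow> f \<in> borel_measurable I01" "L2 f \<Longrightarrow> integrable I01 (\<lambda>x. (f x)\<^sup>2)"
  by (auto simp: L2_def)

lemma two_mult_le_squares: "2 * \<bar>x * y\<bar> \<le> x\<^sup>2 + y\<^sup>2" for x y :: real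
  using sum_squares_bound[of "\<bar>x\<bar>" "\<bar>y\<bar>"] by (simp add: abs_mult)

lemma abs_mult_le_squares: "\<bar>x * y\<bar> \<le> x\<^sup>2 + y\<^sup>2" for x y :: real
  using two_mult_le_squares[of x y] by (smt (verit) abs_ge_zero)

lemma L2_mult_integrable:
  assumes "L2 f" "L2 g"
  shows "integrable I01 (\<lambda>x. f x * g x)"
proof (rule Bochner_Integration.integrable_bound)
  show "integrable I01 (\<lambda>x. (f x)\<^sup>2 + (g x)\<^sup>2)" using assms L2D by auto
  show "(\<lambda>x. f x * g x) \<in> borel_measurable I01" using assms L2D by auto
  show "AE x in I01. norm (f x * g x) \<le> norm ((f x)\<^sup>2 + (g x)\<^sup>2)"
    using abs_mult_le_squares by (intro AE_I2) (auto simp del: abs_mult_pos simp: abs_of_nonneg)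
qed

lemma L2_cmult: "L2 f \<Longrightarrow> L2 (\<lambda>x. c * f x)"
  by (auto simp: L2_def power_mult_distrib)

lemma L2_add:
  assumes "L2 f" "L2 g"
  shows "L2 (\<lambda>x. f x + g x)"
  using assms L2_mult_integrable[OF assms]
  by (auto simp: L2_def power2_sum mult.assoc)

lemma L2_minus: "L2 f \<Longrightarrow> L2 (\<lambda>x. - f x)"
  using L2_cmult[of f "-1"] by simp

lemma L2_diff: "L2 f \<Longrightarrow> L2 g \<Longrightarrow> L2 (\<lambda>x. f x - g x)"
  using L2_add[OF _ L2_minus] by simp

lemma L2_bounded:
  assumes "f \<in> borel_measurable I01" "\<And>x. x \<in> {0..1} \<Longrightarrow> \<bar>f x\<bar> \<le> K"
  shows "L2 f"
  unfolding L2_def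
proof
  interpret finite_measure I01 by (rule finite_measure_I01)
  show "integrable I01 (\<lambda>x. (f x)\<^sup>2)"
  proof (rule integrable_const_bound[where B = "K\<^sup>2"])
    show "AE x in I01. norm ((f x)\<^sup>2) \<le> K\<^sup>2"
      using assms(2) by (intro AE_I2) (simp, metis abs_le_square_iff abs_of_nonneg abs_ge_zero order_trans power_mono power2_abs)
  qed (use assms in auto)
qed (use assms in auto)

lemma L2_const [simp]: "L2 (\<lambda>x. c)"
  by (rule L2_bounded[where K = "\<bar>c\<bar>"]) auto

lemma L2_sum: "(\<And>i. i \<in> S \<Longrightarrow> L2 (f i)) \<Longrightarrow> L2 (\<lambda>x. \<Sum>i\<in>S. f i x)"
  by (induction S rule: infinite_finite_induct) (auto intro: L2_add)

lemma L2_bounded_mult: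
  assumes "h \<in> borel_measurable I01" "\<And>x. x \<in> {0..1} \<Longrightarrow> \<bar>h x\<bar> \<le> K" "L2 f"
  shows "L2 (\<lambda>x. h x * f x)"
  unfolding L2_def
proof
  show "integrable I01 (\<lambda>x. (h x * f x)\<^sup>2)"
  proof (rule Bochner_Integration.integrable_bound)
    show "integrable I01 (\<lambda>x. K\<^sup>2 * (f x)\<^sup>2)" using assms L2D by auto
    show "AE x in I01. norm ((h x * f x)\<^sup>2) \<le> norm (K\<^sup>2 * (f x)\<^sup>2)"
    proof (intro AE_I2)
      fix x assume "x \<in> space I01"
      then have "(h x)\<^sup>2 \<le> K\<^sup>2" using assms(2)[of x] abs_le_square_iff[of "h x" K] by simp
      then show "norm ((h x * f x)\<^sup>2) \<le> norm (K\<^sup>2 * (f x)\<^sup>2)"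
        by (simp add: power_mult_distrib mult_right_mono)
    qed
  qed (use assms L2D in auto)
qed (use assms L2D in auto)

lemma continuous_on_I01_measurable: "continuous_on {0..1} f \<Longrightarrow> f \<in> borel_measurable I01"
  for f :: "real \<Rightarrow> real"
  by (intro continuous_imp_measurable_on_sets_lebesgue) auto

lemma L2_continuous:
  assumes "continuous_on {0..1} f"
  shows "L2 f"
proof -
  obtain K where "\<And>x. x \<in> {0..1} \<Longrightarrow> \<bar>f x\<bar> \<le> K"
    using compact_imp_bounded[OF compact_continuous_image[OF assms]]
    by (force simp: bounded_iff)
  then show ?thesis using assms continuous_on_I01_measurable L2_bounded by blast
qed

lemma L2_integrable: "L2 f \<Longrightarrow> integrable I01 f"
  using L2_mult_integrable[of f "\<lambda>x. 1"] by simp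

text \<open>Nonnegativity of a variance: \<open>I01\<close> has total mass one, so the integral of
  \<open>(f x - m)\<^sup>2\<close> with \<open>m\<close> the mean is the second moment minus
  \<open>m\<^sup>2\<close>.\<close>

lemma square_integral_I01_le:
  assumes "L2 f"
  shows "(\<integral>x. f x \<partial>I01)\<^sup>2 \<le> (\<integral>x. (f x)\<^sup>2 \<partial>I01)"
proof -
  define m where "m = (\<integral>x. f x \<partial>I01)"
  note [simp] = L2_integrable[OF assms] L2D(2)[OF assms]
  interpret finite_measure I01 by (rule finite_measure_I01)
  have "0 \<le> (\<integral>x. (f x - m)\<^sup>2 \<partial>I01)" by (intro Bochner_Integration.integral_nonneg) auto
  also have "\<dots> = (\<integral>x. (f x)\<^sup>2 - 2 * m * f x + m\<^sup>2 \<partial>I01)"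
    by (intro Bochner_Integration.integral_cong) (auto simp: power2_diff)
  also have "\<dots> = (\<integral>x. (f x)\<^sup>2 \<partial>I01) - 2 * m * (\<integral>x. f x \<partial>I01) + m\<^sup>2"
    by (subst Bochner_Integration.integral_add, simp, simp,
        subst Bochner_Integration.integral_diff, simp, simp) simp
  finally show ?thesis by (simp add: m_def[symmetric] power2_eq_square)
qed

subsection \<open>Products of indefinite integrals\<close>

text \<open>Indefinite integrals are encoded throughout by this kind of hypothesis, which matches
  the gain equations and the weak form. The integrals are gauge integrals, so absolute integrability
  is a separate fact wherever products are formed.\<close>

lemma has_integral_increment:
  fixes f F :: "real \<Rightarrow> real"
  assumes "\<And>x. x \<in> {a..b} \<Longrightarrow> (f has_integral F x - F a) {a..x}"
    and "a \<le> s" "s \<le> t" "t \<le> b"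
  shows "(f has_integral F t - F s) {s..t}"
proof -
  have i: "f integrable_on {a..t}" using has_integral_integrable[OF assms(1)[of t]] assms(2-) by auto
  then have "f integrable_on {s..t}"
    by (rule integrable_subinterval_real) (use assms in auto)
  moreover have "integral {a..s} f + integral {s..t} f = integral {a..t} f"
    by (rule Henstock_Kurzweil_Integration.integral_combine) (use assms i in auto)
  moreover have "integral {a..s} f = F s - F a" "integral {a..t} f = F t - F a"
    using integral_unique[OF assms(1)[of s]] integral_unique[OF assms(1)[of t]] assms(2-) by auto
  ultimately show ?thesis
    by (simp add: has_integral_integrable_integral)
qed

lemma has_integral_imp_continuous_on:
  fixes f F :: "real \<Rightarrow> real"
  assumes "\<And>x. x \<in> {a..b} \<Longrightarrow> (f has_integral F x - F a) {a..x}"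
  shows "continuous_on {a..b} F"
proof (cases "a \<le> b")
  case True
  then have "f integrable_on {a..b}" using has_integral_integrable[OF assms[of b]] by auto
  then have "continuous_on {a..b} (\<lambda>x. F a + integral {a..x} f)"
    by (intro continuous_intros indefinite_integral_continuous_1)
  moreover have "F a + integral {a..x} f = F x" if "x \<in> {a..b}" for x
    using integral_unique[OF assms[OF that]] by simp
  ultimately show ?thesis by (metis (no_types, lifting) continuous_on_cong)
qed auto

text \<open>The defect of the product formula over a short interval is small relative to
  \<open>\<integral> \<bar>f\<bar> + \<bar>g\<bar>\<close> by continuity of \<open>F\<close> and \<open>G\<close>; the bisection principle makes this global.\<close>

lemma product_of_indefinite_integrals:
  fixes f g F G :: "real \<Rightarrow> real"
  assumes ab: "a \<le> b"
    and f: "f absolutely_integrable_on {a..b}" and g: "g absolutely_integrable_on {a..b}"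
    and F: "\<And>x. x \<in> {a..b} \<Longrightarrow> (f has_integral F x - F a) {a..x}"
    and G: "\<And>x. x \<in> {a..b} \<Longrightarrow> (g has_integral G x - G a) {a..x}"
  shows "(\<lambda>x. F x * g x + f x * G x) absolutely_integrable_on {a..b}"
    and "((\<lambda>x. F x * g x + f x * G x) has_integral (F b * G b - F a * G a)) {a..b}"
proof -
  define h where "h = (\<lambda>x. F x * g x + f x * G x)"
  define k where "k = (\<lambda>x. \<bar>f x\<bar> + \<bar>g x\<bar>)"
  have cF: "continuous_on {a..b} F" and cG: "continuous_on {a..b} G"
    by (rule has_integral_imp_continuous_on[OF F] has_integral_imp_continuous_on[OF G]; assumption)+
  have "(\<lambda>x. F x * g x) absolutely_integrable_on {a..b}" "(\<lambda>x. G x * f x) absolutely_integrable_on {a..b}"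
    using cF cG f g
    by (auto intro!: absolutely_integrable_bounded_measurable_product_real
        continuous_imp_measurable_on_sets_lebesgue compact_imp_bounded compact_continuous_image)
  then show ah: "(\<lambda>x. F x * g x + f x * G x) absolutely_integrable_on {a..b}"
    by (simp add: mult.commute)
  have ih: "h integrable_on {s..t}" "f integrable_on {s..t}" "g integrable_on {s..t}" "k integrable_on {s..t}"
    if "a \<le> s" "t \<le> b" for s t
  proof -
    have "k absolutely_integrable_on {a..b}" unfolding k_def by (intro set_integral_add set_integrable_abs f g)
    with ah f g show "h integrable_on {s..t}" "f integrable_on {s..t}" "g integrable_on {s..t}" "k integrable_on {s..t}"
      unfolding h_def
      by (meson absolutely_integrable_on_def atLeastatMost_subset_iff integrable_subinterval_real that)+
  qed
  define D where "D = (\<lambda>t. F t * G t - integral {a..t} h)"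
  define H where "H = (\<lambda>t. integral {a..t} k)"
  have key: "\<bar>D b - D a\<bar> \<le> e * (H b - H a)" if e: "e > 0" for e
  proof -
    define P where "P = (\<lambda>s t. a \<le> s \<and> t \<le> b \<longrightarrow> \<bar>D t - D s\<bar> \<le> e * (H t - H s))"
    have "P a b"
      using ab
    proof (induction rule: Bolzano)
      case (trans p q r)
      then show ?case by (auto simp: P_def algebra_simps)
    next
      case (local x)
      obtain d1 where d1: "d1 > 0" "\<And>y. y \<in> {a..b} \<Longrightarrow> dist y x < d1 \<Longrightarrow> dist (F y) (F x) < e/2"
        using cF[unfolded continuous_on_iff, rule_format, of x "e/2"] local e by auto
      obtain d2 where d2: "d2 > 0" "\<And>y. y \<in> {a..b} \<Longrightarrow> dist y x < d2 \<Longrightarrow> dist (G y) (G x) < e/2"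
        using cG[unfolded continuous_on_iff, rule_format, of x "e/2"] local e by auto
      show ?case
      proof (intro exI conjI allI impI)
        show "min d1 d2 > 0" using d1 d2 by auto
        fix s t assume st: "s \<le> x \<and> x \<le> t \<and> t - s < min d1 d2"
        show "P s t"
          unfolding P_def
        proof (intro impI)
          assume ast: "a \<le> s \<and> t \<le> b"
          have close: "\<bar>F t - F y\<bar> \<le> e" "\<bar>G s - G y\<bar> \<le> e" if "y \<in> {s..t}" for y
          proof -
            have y: "s \<le> y" "y \<le> t" using that by auto
            then have "\<bar>y - x\<bar> < min d1 d2" "\<bar>s - x\<bar> < min d1 d2" "\<bar>t - x\<bar> < min d1 d2"
              using st by linarith+
            then have "\<bar>F y - F x\<bar> < e/2" "\<bar>F t - F x\<bar> < e/2" "\<bar>G y - G x\<bar> < e/2" "\<bar>G s - G x\<bar> < e/2"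
              using d1(2)[of y] d1(2)[of t] d2(2)[of y] d2(2)[of s] y st ast
              by (auto simp: dist_real_def)
            then show "\<bar>F t - F y\<bar> \<le> e" "\<bar>G s - G y\<bar> \<le> e" by linarith+
          qed
          have i1: "integral {a..t} h = integral {a..s} h + integral {s..t} h"
            "H t = H s + integral {s..t} k"
            unfolding H_def
            by (intro Henstock_Kurzweil_Integration.integral_combine[symmetric] ih; use st ast in auto)+
          have fs: "(f has_integral F t - F s) {s..t}" "(g has_integral G t - G s) {s..t}"
            by (rule has_integral_increment[where a = a and b = b]; use F G st ast in auto)+
          \<comment> \<open>Freezing \<open>F\<close> at the right end and \<open>G\<close> at the
            left end makes \<open>F t * (G t - G s) + G s * (F t - F s)\<close> telescope to the
            increment of the product, with no second-order remainder.\<close>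
          have "((\<lambda>y. F t * g y + G s * f y - h y) has_integral
              (F t * (G t - G s) + G s * (F t - F s) - integral {s..t} h)) {s..t}"
            by (intro has_integral_diff has_integral_add has_integral_mult_right fs)
              (use ih st ast in auto)
          then have r: "((\<lambda>y. F t * g y + G s * f y - h y) has_integral (D t - D s)) {s..t}"
            by (simp add: D_def i1 algebra_simps)
          have "norm (integral {s..t} (\<lambda>y. F t * g y + G s * f y - h y)) \<le> integral {s..t} (\<lambda>y. e * k y)"
          proof (rule integral_norm_bound_integral)
            show "(\<lambda>y. e * k y) integrable_on {s..t}" using ih ast by (intro integrable_on_mult_right) auto
            fix y assume y: "y \<in> {s..t}"
            have "F t * g y + G s * f y - h y = (F t - F y) * g y + (G s - G y) * f y"
              by (simp add: h_def algebra_simps)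
            also have "\<bar>\<dots>\<bar> \<le> \<bar>F t - F y\<bar> * \<bar>g y\<bar> + \<bar>G s - G y\<bar> * \<bar>f y\<bar>"
              by (metis abs_mult abs_triangle_ineq)
            also have "\<dots> \<le> e * \<bar>g y\<bar> + e * \<bar>f y\<bar>"
              using close[OF y] by (intro add_mono mult_right_mono) auto
            finally show "norm (F t * g y + G s * f y - h y) \<le> e * k y"
              by (simp add: k_def algebra_simps)
          qed (use r in auto)
          then show "\<bar>D t - D s\<bar> \<le> e * (H t - H s)"
            using integral_unique[OF r] i1 by simp
        qed
      qed
    qed
    then show ?thesis by (simp add: P_def)
  qed
  have "\<bar>D b - D a\<bar> \<le> 0"
  proof (rule field_le_epsilon)
    fix e :: real assume e: "e > 0"
    have H0: "H b - H a \<ge> 0"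
      unfolding H_def using ih[of a b] by (auto intro!: integral_nonneg simp: k_def)
    \<comment> \<open>The summand 1 keeps the denominator positive when
      \<open>H b = H a\<close>.\<close>
    have "\<bar>D b - D a\<bar> \<le> e / (1 + (H b - H a)) * (H b - H a)"
      by (rule key) (use e H0 in auto)
    also have "\<dots> \<le> e" using e H0 by (simp add: field_simps)
    finally show "\<bar>D b - D a\<bar> \<le> 0 + e" by simp
  qed
  then have "F b * G b - F a * G a = integral {a..b} h" by (simp add: D_def)
  then show "((\<lambda>x. F x * g x + f x * G x) has_integral (F b * G b - F a * G a)) {a..b}"
    using ih[of a b] by (auto simp: h_def has_integral_integrable_integral)
qed

subsection \<open>Completeness of the sine modes\<close>

lemma integral_I01_FTC:
  fixes F f :: "real \<Rightarrow> real"
  assumes "continuous_on {0..1} f"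
    and "\<And>x. x \<in> {0..1} \<Longrightarrow> (F has_real_derivative f x) (at x within {0..1})"
  shows "(\<integral>x. f x \<partial>I01) = F 1 - F 0"
proof -
  have "(f has_integral F 1 - F 0) {0..1}"
    using assms(2) by (intro fundamental_theorem_of_calculus)
      (auto simp: has_real_derivative_iff_has_vector_derivative)
  moreover have "integrable I01 f"
    by (rule L2_integrable[OF L2_continuous[OF assms(1)]])
  ultimately show ?thesis
    by (metis atLeastAtMost_borel has_integral_integral_lebesgue_on has_integral_unique
        sets_completionI_sets sets_lborel)
qed

text \<open>Induction on \<open>S\<close>: by orthogonality the residual after the modes in
  \<open>S\<close> pairs with a new mode \<open>g j\<close> exactly as \<open>f\<close> does, so
  each mode contributes independently. The common squared norm is \<open>h\<close>.\<close>

lemma L2_orthogonal_expansion: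
  assumes "finite S" "L2 f" "\<And>i. L2 (g i)"
    and orth: "\<And>i j. (\<integral>x. g i x * g j x \<partial>I01) = (if i = j then h else 0)"
  shows "(\<integral>x. (f x - (\<Sum>i\<in>S. d i * g i x))\<^sup>2 \<partial>I01)
    = (\<integral>x. (f x)\<^sup>2 \<partial>I01) - 2 * (\<Sum>i\<in>S. d i * (\<integral>x. f x * g i x \<partial>I01)) + h * (\<Sum>i\<in>S. (d i)\<^sup>2)"
  using assms(1)
proof (induction S rule: finite_induct)
  case (insert j S)
  define r where "r = (\<lambda>x. f x - (\<Sum>i\<in>S. d i * g i x))"
  have r: "L2 r" unfolding r_def by (intro L2_diff L2_sum L2_cmult assms)
  have [simp]: "integrable I01 (\<lambda>x. f x * g j x)" "integrable I01 (\<lambda>x. g i x * g j x)"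
    "integrable I01 (\<lambda>x. r x * g j x)" "integrable I01 (\<lambda>x. (r x)\<^sup>2)" "integrable I01 (\<lambda>x. (g j x)\<^sup>2)" for i
    using assms r L2_mult_integrable L2D by auto
  have "(\<integral>x. r x * g j x \<partial>I01) = (\<integral>x. f x * g j x - (\<Sum>i\<in>S. d i * (g i x * g j x)) \<partial>I01)"
    by (intro Bochner_Integration.integral_cong)
      (auto simp: r_def left_diff_distrib sum_distrib_right mult.assoc)
  also have "\<dots> = (\<integral>x. f x * g j x \<partial>I01) - (\<Sum>i\<in>S. d i * (\<integral>x. g i x * g j x \<partial>I01))"
    by (subst Bochner_Integration.integral_diff) auto
  also have "\<dots> = (\<integral>x. f x * g j x \<partial>I01)"
    using insert by (auto simp: orth intro!: sum.neutral)
  finally have rj: "(\<integral>x. r x * g j x \<partial>I01) = (\<integral>x. f x * g j x \<partial>I01)" .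
  have "(\<integral>x. (f x - (\<Sum>i\<in>insert j S. d i * g i x))\<^sup>2 \<partial>I01)
      = (\<integral>x. (r x)\<^sup>2 - 2 * d j * (r x * g j x) + (d j)\<^sup>2 * (g j x)\<^sup>2 \<partial>I01)"
    using insert by (intro Bochner_Integration.integral_cong)
      (auto simp: r_def power2_eq_square algebra_simps)
  also have "\<dots> = (\<integral>x. (r x)\<^sup>2 \<partial>I01) - 2 * d j * (\<integral>x. r x * g j x \<partial>I01) + (d j)\<^sup>2 * h"
    using orth[of j j, folded power2_eq_square]
    by (subst Bochner_Integration.integral_add, simp, simp, subst Bochner_Integration.integral_diff)
      simp_all
  finally show ?case
    using insert by (simp add: rj r_def[symmetric] algebra_simps)
      (simp add: r_def algebra_simps)
qed simp

text \<open>The shift to frequency \<open>Suc n\<close> excludes the zero function, so all modes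
  have squared norm 1/2.\<close>

definition sine_mode :: "nat \<Rightarrow> real \<Rightarrow> real" where
  "sine_mode n x = sin (real (Suc n) * pi * x)"

lemma continuous_on_sine_mode: "continuous_on S (sine_mode n)"
  unfolding sine_mode_def by (intro continuous_intros)

lemma L2_sine_mode: "L2 (sine_mode n)"
  by (rule L2_continuous[OF continuous_on_sine_mode])

text \<open>Integer frequencies, because the product-to-sum formula yields the difference of two
  mode indices, which may be negative.\<close>

lemma integral_I01_cos:
  fixes k :: int
  shows "(\<integral>x. cos (of_int k * pi * x) \<partial>I01) = (if k = 0 then 1 else 0)"
proof (cases "k = 0")
  case False
  have "(\<integral>x. cos (of_int k * pi * x) \<partial>I01)
    = sin (of_int k * pi * 1) / (of_int k * pi) - sin (of_int k * pi * 0) / (of_int k * pi)"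
    using False by (intro integral_I01_FTC) (auto intro!: continuous_intros derivative_eq_intros)
  then show ?thesis using False by (simp add: sin_zero_iff_int2)
qed auto

lemma sine_mode_orthogonal:
  "(\<integral>x. sine_mode n x * sine_mode m x \<partial>I01) = (if n = m then 1/2 else 0)"
proof -
  have "(\<integral>x. sine_mode n x * sine_mode m x \<partial>I01)
    = (\<integral>x. (cos (of_int (int n - int m) * pi * x) - cos (of_int (int n + int m + 2) * pi * x)) / 2 \<partial>I01)"
  proof (intro Bochner_Integration.integral_cong refl)
    fix x
    have "real (Suc n) * pi * x - real (Suc m) * pi * x = of_int (int n - int m) * pi * x"
      "real (Suc n) * pi * x + real (Suc m) * pi * x = of_int (int n + int m + 2) * pi * x"
      by (simp_all add: algebra_simps)
    then show "sine_mode n x * sine_mode m x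
        = (cos (of_int (int n - int m) * pi * x) - cos (of_int (int n + int m + 2) * pi * x)) / 2"
      unfolding sine_mode_def sin_times_sin by simp
  qed
  also have "\<dots> = ((if n = m then 1 else 0) - 0) / 2"
  proof -
    have c: "integrable I01 (\<lambda>x. cos (of_int k * pi * x))" for k
      by (intro L2_integrable L2_continuous continuous_intros)
    show ?thesis
      by (subst integral_divide_zero, subst Bochner_Integration.integral_diff[OF c c],
          subst (1 2) integral_I01_cos) auto
  qed
  finally show ?thesis by (auto split: if_splits)
qed

definition sine_span :: "(real \<Rightarrow> real) \<Rightarrow> bool" where
  "sine_span f \<longleftrightarrow> (\<exists>N d. \<forall>x. f x = (\<Sum>n<N. d n * sine_mode n x))"

lemma sine_span_add:
  assumes "sine_span f" "sine_span g"
  shows "sine_span (\<lambda>x. f x + g x)"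
proof -
  obtain N d M e where f: "\<And>x. f x = (\<Sum>n<N. d n * sine_mode n x)"
    and g: "\<And>x. g x = (\<Sum>n<M. e n * sine_mode n x)"
    using assms unfolding sine_span_def by metis
  have "f x + g x = (\<Sum>n<max N M. ((if n < N then d n else 0) + (if n < M then e n else 0)) * sine_mode n x)" for x
  proof -
    have "f x = (\<Sum>n<max N M. (if n < N then d n else 0) * sine_mode n x)"
      unfolding f by (rule sum.mono_neutral_cong_left) auto
    moreover have "g x = (\<Sum>n<max N M. (if n < M then e n else 0) * sine_mode n x)"
      unfolding g by (rule sum.mono_neutral_cong_left) auto
    ultimately show ?thesis by (simp add: sum.distrib distrib_right)
  qed
  then show ?thesis
    unfolding sine_span_def by (intro exI allI)
qed

lemma sine_span_cmult: "sine_span f \<Longrightarrow> sine_span (\<lambda>x. c * f x)"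
  unfolding sine_span_def
  by (elim exE, rule_tac x = N in exI, rule_tac x = "\<lambda>n. c * d n" in exI)
    (simp add: sum_distrib_left mult.assoc)

lemma sine_span_zero: "sine_span (\<lambda>x. 0)"
  unfolding sine_span_def by (rule exI[of _ 0]) simp

lemma sine_span_mode: "sine_span (sine_mode n)"
  unfolding sine_span_def
  by (rule exI[of _ "Suc n"], rule exI[of _ "\<lambda>k. if k = n then 1 else 0"]) (simp add: sum.neutral)

lemma sine_span_sum: "(\<And>i. i \<in> S \<Longrightarrow> sine_span (f i)) \<Longrightarrow> sine_span (\<lambda>x. \<Sum>i\<in>S. f i x)"
  by (induction S rule: infinite_finite_induct) (auto intro: sine_span_add sine_span_zero)

text \<open>The functions that multiply the sine modes into their span form an algebra containing
  \<open>cos (pi * x)\<close>, hence are dense in the continuous functions.\<close>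

lemma sine_mode_multiplier_dense:
  assumes "continuous_on {0..1} c" "0 < e"
  shows "\<exists>g. (\<forall>n. sine_span (\<lambda>x. sine_mode n x * g x)) \<and> (\<forall>x\<in>{0..1}. \<bar>c x - g x\<bar> < e)"
proof -
  define P where "P g \<longleftrightarrow> continuous_on {0..1} g \<and> (\<forall>n. sine_span (\<lambda>x. sine_mode n x * g x))" for g
  have "\<exists>g. P g \<and> (\<forall>x\<in>{0..1}. \<bar>c x - g x\<bar> < e)"
  proof (rule Stone_Weierstrass_HOL)
    fix f g assume fg: "P f \<and> P g"
    show "P (\<lambda>x. f x + g x)"
      using fg by (auto simp: P_def distrib_left intro: continuous_on_add sine_span_add)
    have "sine_span (\<lambda>x. sine_mode n x * (f x * g x))" for n
    proof -
      \<comment> \<open>Multiplication by \<open>f\<close> returns to the span; the factor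
        \<open>g\<close> then acts on each mode separately.\<close>
      obtain N d where N: "\<And>x. sine_mode n x * f x = (\<Sum>n<N. d n * sine_mode n x)"
        using fg unfolding P_def sine_span_def by metis
      have "sine_span (\<lambda>x. \<Sum>n<N. d n * (sine_mode n x * g x))"
        by (intro sine_span_sum sine_span_cmult) (use fg in \<open>auto simp: P_def\<close>)
      moreover have "(\<Sum>n<N. d n * (sine_mode n x * g x)) = sine_mode n x * (f x * g x)" for x
        unfolding mult.assoc[symmetric] N sum_distrib_right by (simp add: mult.assoc)
      ultimately show ?thesis by simp
    qed
    then show "P (\<lambda>x. f x * g x)"
      using fg by (auto simp: P_def intro: continuous_on_mult)
  next
    fix x y :: real assume xy: "x \<in> {0..1} \<and> y \<in> {0..1} \<and> x \<noteq> y"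
    have "sine_span (\<lambda>x. sine_mode n x * cos (pi * x))" for n
    proof (cases n)
      \<comment> \<open>For the lowest mode the lower neighbour in the product-to-sum formula is
        \<open>sin 0\<close>, so a single term remains.\<close>
      case 0
      have "sine_span (\<lambda>x. 1/2 * sine_mode 1 x)"
        by (intro sine_span_cmult sine_span_mode)
      moreover have "1/2 * sine_mode 1 x = sine_mode n x * cos (pi * x)" for x
        using sin_double[of "pi * x"] by (simp add: sine_mode_def 0 mult_ac)
      ultimately show ?thesis by simp
    next
      case (Suc m)
      have "sine_span (\<lambda>x. 1/2 * (sine_mode (Suc n) x + sine_mode m x))"
        by (intro sine_span_cmult sine_span_add sine_span_mode)
      moreover have "1/2 * (sine_mode (Suc n) x + sine_mode m x) = sine_mode n x * cos (pi * x)" for x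
      proof -
        have "real (Suc n) * pi * x + pi * x = real (Suc (Suc n)) * pi * x"
          "real (Suc n) * pi * x - pi * x = real (Suc m) * pi * x"
          by (simp_all add: Suc algebra_simps)
        then show ?thesis
          unfolding sine_mode_def sin_times_cos by simp
      qed
      ultimately show ?thesis by simp
    qed
    then have "P (\<lambda>x. cos (pi * x))"
      by (auto simp: P_def intro!: continuous_intros)
    moreover have "cos (pi * x) \<noteq> cos (pi * y)"
      using xy cos_inj_pi[of "pi * x" "pi * y"] by auto
    ultimately show "\<exists>f. P f \<and> f x \<noteq> f y" by blast
  next
    show "P (\<lambda>x. r)" for r
      using sine_span_cmult[OF sine_span_mode, where c = r] by (simp add: P_def mult.commute)
  qed (use assms in \<open>auto simp: P_def\<close>)
  then show ?thesis by (auto simp: P_def)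
qed

lemma AE_I01I:
  assumes "negligible N" "\<And>x. x \<in> {0..1} \<Longrightarrow> x \<notin> N \<Longrightarrow> P x"
  shows "AE x in I01. P x"
proof -
  have "AE x in lebesgue. x \<notin> N"
    using assms(1) by (simp add: negligible_iff_null_sets AE_not_in)
  then show ?thesis using assms(2) by (subst AE_restrict_space_iff) auto
qed

text \<open>The multiplier lemma reaches functions \<open>S x * c x\<close> with
  \<open>S x = sin (pi * x)\<close> and \<open>c\<close> continuous, so \<open>f\<close> has to be
  divided by \<open>S\<close>, which vanishes at the ends. Truncating \<open>f\<close> to the set
  where \<open>\<bar>f x\<bar> \<le> real n * S x\<close> makes the quotient bounded; the quotient
  is then approximated by continuous functions, and these by multipliers of the sine modes.\<close>

lemma sine_span_L2_dense:
  assumes f: "L2 f" and e: "0 < e"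
  shows "\<exists>p. sine_span p \<and> (\<integral>x. (f x - p x)\<^sup>2 \<partial>I01) < e"
proof -
  define S where "S = (\<lambda>x::real. sin (pi * x))"
  have S: "continuous_on {0..1} S" unfolding S_def by (intro continuous_intros)
  have S01: "0 \<le> S x" "\<bar>S x\<bar> \<le> 1" if "x \<in> {0..1}" for x
    using that by (auto simp: S_def intro!: sin_ge_zero mult_left_le)
  have Spos: "0 < S x" if "x \<in> {0..1}" "x \<notin> {0,1}" for x
    using that by (auto simp: S_def intro!: sin_gt_zero)
  note [measurable] = L2D(1)[OF f] continuous_on_I01_measurable[OF S]
  define F where "F = (\<lambda>(n::nat) x. if \<bar>f x\<bar> \<le> real n * S x then f x else 0)"
  have [measurable]: "F n \<in> borel_measurable I01" for n
    unfolding F_def by measurable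
  have "(\<lambda>n. \<integral>x. (f x - F n x)\<^sup>2 \<partial>I01) \<longlonglongrightarrow> (\<integral>x. 0 \<partial>I01)"
  proof (rule integral_dominated_convergence[where w = "\<lambda>x. (f x)\<^sup>2"])
    show "AE x in I01. (\<lambda>n. (f x - F n x)\<^sup>2) \<longlonglongrightarrow> 0"
    proof (rule AE_I01I[of "{0,1}"])
      fix x :: real assume x: "x \<in> {0..1}" "x \<notin> {0,1}"
      obtain N :: nat where N: "\<bar>f x\<bar> \<le> real N * S x"
        using reals_Archimedean3[OF Spos[OF x]] by (meson less_imp_le)
      have "\<bar>f x\<bar> \<le> real n * S x" if "n \<ge> N" for n
        using N mult_right_mono[of "real N" "real n" "S x"] that S01(1)[OF x(1)] by simp
      then have "\<forall>\<^sub>F n in sequentially. (f x - F n x)\<^sup>2 = 0"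
        unfolding eventually_sequentially F_def by auto
      then show "(\<lambda>n. (f x - F n x)\<^sup>2) \<longlonglongrightarrow> 0" by (rule tendsto_eventually)
    qed auto
  qed (use L2D[OF f] in \<open>auto simp: F_def\<close>)
  \<comment> \<open>Three errors of size e/9, with the factor 3 from the square of a three-term sum,
    add up to \<open>e\<close>.\<close>
  then have "\<forall>\<^sub>F n in sequentially. (\<integral>x. (f x - F n x)\<^sup>2 \<partial>I01) < e/9"
    using e by (intro order_tendstoD) auto
  then obtain n where n: "(\<integral>x. (f x - F n x)\<^sup>2 \<partial>I01) < e/9"
    by (auto simp: eventually_sequentially)
  define h where "h = (\<lambda>x. F n x / S x)"
  have [measurable]: "h \<in> borel_measurable I01" unfolding h_def by measurable
  have hn: "\<bar>h x\<bar> \<le> real n" "F n x = S x * h x" if "x \<in> {0..1}" for x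
    using S01(1)[OF that] by (cases "S x = 0"; auto simp: h_def F_def pos_divide_le_eq)+
  have "h measurable_on {0..1}"
    by (subst measurable_on_iff_borel_measurable) auto
  then obtain N g where N: "negligible N" and g: "\<And>k. continuous_on UNIV (g k)"
    and glim: "\<And>x. x \<notin> N \<Longrightarrow> (\<lambda>k. g k x) \<longlonglongrightarrow> (if x \<in> {0..1} then h x else 0)"
    unfolding measurable_on_def by blast
  \<comment> \<open>Clipping to an interval that contains all values of \<open>h\<close> preserves
    the limit and supplies a constant majorant for dominated convergence.\<close>
  define c where "c = (\<lambda>k x. max (- real n) (min (real n) (g k x)))"
  have cc: "continuous_on {0..1} (c k)" for k
    unfolding c_def by (intro continuous_intros continuous_on_subset[OF g]) auto
  note [measurable] = continuous_on_I01_measurable[OF cc]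
  have cb: "\<bar>c k x\<bar> \<le> real n" for k x by (auto simp: c_def)
  have "(\<lambda>k. \<integral>x. (F n x - S x * c k x)\<^sup>2 \<partial>I01) \<longlonglongrightarrow> (\<integral>x. 0 \<partial>I01)"
  proof (rule integral_dominated_convergence[where w = "\<lambda>x. (2 * real n)\<^sup>2"])
    show "AE x in I01. (\<lambda>k. (F n x - S x * c k x)\<^sup>2) \<longlonglongrightarrow> 0"
    proof (rule AE_I01I[OF N])
      fix x :: real assume x: "x \<in> {0..1}" "x \<notin> N"
      have "(\<lambda>k. c k x) \<longlonglongrightarrow> max (- real n) (min (real n) (h x))"
        unfolding c_def using glim[OF x(2)] x(1) by (intro tendsto_intros) auto
      also have "max (- real n) (min (real n) (h x)) = h x"
        using hn(1)[OF x(1)] by auto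
      finally have "(\<lambda>k. (F n x - S x * c k x)\<^sup>2) \<longlonglongrightarrow> (F n x - S x * h x)\<^sup>2"
        by (intro tendsto_intros)
      then show "(\<lambda>k. (F n x - S x * c k x)\<^sup>2) \<longlonglongrightarrow> 0" by (simp add: hn(2)[OF x(1)])
    qed
    show "AE x in I01. norm ((F n x - S x * c k x)\<^sup>2) \<le> (2 * real n)\<^sup>2" for k
    proof (intro AE_I2)
      fix x assume "x \<in> space I01"
      then have x: "x \<in> {0..1}" by simp
      have "\<bar>F n x - S x * c k x\<bar> = \<bar>S x\<bar> * \<bar>h x - c k x\<bar>"
        by (simp add: hn(2)[OF x] abs_mult[symmetric] right_diff_distrib)
      also have "\<dots> \<le> 1 * (2 * real n)"
        using S01[OF x] hn(1)[OF x] cb[of k x] by (intro mult_mono) auto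
      finally show "norm ((F n x - S x * c k x)\<^sup>2) \<le> (2 * real n)\<^sup>2"
        using power_mono[of "\<bar>F n x - S x * c k x\<bar>" "2 * real n" 2] by simp
    qed
    show "integrable I01 (\<lambda>x. (2 * real n)\<^sup>2)"
      by (rule L2_integrable[OF L2_const])
  qed auto
  then have "\<forall>\<^sub>F k in sequentially. (\<integral>x. (F n x - S x * c k x)\<^sup>2 \<partial>I01) < e/9"
    using e by (intro order_tendstoD) auto
  then obtain k where k: "(\<integral>x. (F n x - S x * c k x)\<^sup>2 \<partial>I01) < e/9"
    by (auto simp: eventually_sequentially)
  have "sqrt (e/9) > 0" using e by simp
  then obtain q where q: "\<And>n. sine_span (\<lambda>x. sine_mode n x * q x)"
    and qc: "\<And>x. x \<in> {0..1} \<Longrightarrow> \<bar>c k x - q x\<bar> < sqrt (e/9)"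
    using sine_mode_multiplier_dense[OF cc \<open>sqrt (e/9) > 0\<close>] by blast
  define p where "p = (\<lambda>x. sine_mode 0 x * q x)"
  have p: "sine_span p" using q p_def by simp
  then obtain N' d where "\<And>x. p x = (\<Sum>n<N'. d n * sine_mode n x)"
    unfolding sine_span_def by blast
  then have "p = (\<lambda>x. \<Sum>n<N'. d n * sine_mode n x)" by blast
  then have L2p: "L2 p"
    by (simp add: L2_sum L2_cmult L2_sine_mode)
  have pS: "p x = S x * q x" for x by (simp add: p_def S_def sine_mode_def)
  have FL2: "L2 (F n)"
  proof -
    have "L2 (\<lambda>x. (if \<bar>f x\<bar> \<le> real n * S x then 1 else 0) * f x)"
      by (rule L2_bounded_mult[where K = 1]) (use f in auto)
    then show ?thesis by (simp add: F_def if_distrib[of "\<lambda>c. c * _"] cong: if_cong)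
  qed
  have ScL2: "L2 (\<lambda>x. S x * c k x)" by (intro L2_continuous continuous_on_mult S cc)
  have bound3: "(\<integral>x. (S x * c k x - p x)\<^sup>2 \<partial>I01) \<le> (\<integral>x. e/9 \<partial>I01)"
  proof (rule integral_mono)
    fix x assume "x \<in> space I01"
    then have x: "x \<in> {0..1}" by simp
    have "\<bar>S x * c k x - p x\<bar> = \<bar>S x\<bar> * \<bar>c k x - q x\<bar>"
      by (simp add: pS abs_mult[symmetric] right_diff_distrib)
    also have "\<dots> \<le> 1 * sqrt (e/9)"
      using S01[OF x] qc[OF x] by (intro mult_mono) auto
    finally have "\<bar>S x * c k x - p x\<bar>\<^sup>2 \<le> (sqrt (e/9))\<^sup>2"
      by (intro power_mono) auto
    then show "(S x * c k x - p x)\<^sup>2 \<le> e/9" using e by simp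
  qed (use L2D(2)[OF L2_diff[OF ScL2 L2p]] L2_integrable[OF L2_const] in auto)
  have [simp]: "integrable I01 (\<lambda>x. (f x - p x)\<^sup>2)" "integrable I01 (\<lambda>x. (f x - F n x)\<^sup>2)"
    "integrable I01 (\<lambda>x. (F n x - S x * c k x)\<^sup>2)" "integrable I01 (\<lambda>x. (S x * c k x - p x)\<^sup>2)"
    by (intro L2D(2) L2_diff f FL2 ScL2 L2p)+
  have "(\<integral>x. (f x - p x)\<^sup>2 \<partial>I01)
      \<le> (\<integral>x. 3 * ((f x - F n x)\<^sup>2 + (F n x - S x * c k x)\<^sup>2 + (S x * c k x - p x)\<^sup>2) \<partial>I01)"
  proof (rule integral_mono)
    fix x
    have *: "(u + v + w)\<^sup>2 \<le> 3 * (u\<^sup>2 + v\<^sup>2 + w\<^sup>2)" for u v w :: real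
      using sum_squares_bound[of u v] sum_squares_bound[of u w] sum_squares_bound[of v w]
      by (simp add: power2_eq_square algebra_simps)
    show "(f x - p x)\<^sup>2 \<le> 3 * ((f x - F n x)\<^sup>2 + (F n x - S x * c k x)\<^sup>2 + (S x * c k x - p x)\<^sup>2)"
      using *[of "f x - F n x" "F n x - S x * c k x" "S x * c k x - p x"] by simp
  qed auto
  also have "\<dots> = 3 * ((\<integral>x. (f x - F n x)\<^sup>2 \<partial>I01) + (\<integral>x. (F n x - S x * c k x)\<^sup>2 \<partial>I01)
      + (\<integral>x. (S x * c k x - p x)\<^sup>2 \<partial>I01))"
    by simp
  also have "\<dots> < e"
    using n k bound3 by simp
  finally show ?thesis using p by blast
qed

text \<open>Since the modes have squared norm 1/2, the optimal coefficients are
  \<open>2 * c n\<close>. Bessel's inequality bounds the partial sums from above, comparison with a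
  good sine polynomial bounds one of them from below, and monotonicity carries this over to all
  later ones.\<close>

lemma sine_parseval:
  assumes f: "L2 f"
  shows "(\<lambda>n. 2 * (\<integral>x. f x * sine_mode n x \<partial>I01)\<^sup>2) sums (\<integral>x. (f x)\<^sup>2 \<partial>I01)"
proof -
  define c where "c = (\<lambda>n. \<integral>x. f x * sine_mode n x \<partial>I01)"
  have c: "(\<integral>x. f x * sine_mode n x \<partial>I01) = c n" for n by (simp add: c_def)
  define Q where "Q = (\<integral>x. (f x)\<^sup>2 \<partial>I01)"
  note expand = L2_orthogonal_expansion[OF _ f L2_sine_mode sine_mode_orthogonal]
  have bessel: "(\<Sum>n<N. 2 * (c n)\<^sup>2) \<le> Q" for N
  proof -
    have "0 \<le> (\<integral>x. (f x - (\<Sum>n<N. 2 * c n * sine_mode n x))\<^sup>2 \<partial>I01)"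
      by (intro Bochner_Integration.integral_nonneg) auto
    also have "\<dots> = Q - (\<Sum>n<N. 2 * (c n)\<^sup>2)"
      using expand[of "{..<N}" "\<lambda>n. 2 * c n"]
      by (simp add: c Q_def power2_eq_square sum_distrib_left)
    finally show ?thesis by simp
  qed
  have best: "Q - (\<Sum>n<N. 2 * (c n)\<^sup>2) \<le> (\<integral>x. (f x - (\<Sum>n<N. d n * sine_mode n x))\<^sup>2 \<partial>I01)" for N d
  proof -
    have "(\<Sum>n<N. 2 * (d n * c n) - 1/2 * (d n)\<^sup>2) \<le> (\<Sum>n<N. 2 * (c n)\<^sup>2)"
    proof (rule sum_mono)
      fix n
      have "0 \<le> 1/2 * (d n - 2 * c n)\<^sup>2" by simp
      then show "2 * (d n * c n) - 1/2 * (d n)\<^sup>2 \<le> 2 * (c n)\<^sup>2"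
        by (simp add: power2_eq_square algebra_simps)
    qed
    then show ?thesis
      by (simp add: expand c Q_def[symmetric] sum_subtractf sum_distrib_left)
  qed
  have "(\<lambda>N. \<Sum>n<N. 2 * (c n)\<^sup>2) \<longlonglongrightarrow> Q"
  proof (rule LIMSEQ_I)
    fix r :: real assume "r > 0"
    then obtain p where p: "sine_span p" "(\<integral>x. (f x - p x)\<^sup>2 \<partial>I01) < r"
      using sine_span_L2_dense[OF f] by blast
    then obtain N d where "\<And>x. p x = (\<Sum>n<N. d n * sine_mode n x)"
      unfolding sine_span_def by blast
    with p have N: "(\<integral>x. (f x - (\<Sum>n<N. d n * sine_mode n x))\<^sup>2 \<partial>I01) < r"
      by simp
    show "\<exists>no. \<forall>n\<ge>no. norm ((\<Sum>n<n. 2 * (c n)\<^sup>2) - Q) < r"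
    proof (intro exI allI impI)
      fix m assume "m \<ge> N"
      then have "(\<Sum>n<N. 2 * (c n)\<^sup>2) \<le> (\<Sum>n<m. 2 * (c n)\<^sup>2)"
        by (intro sum_mono2) auto
      then show "norm ((\<Sum>n<m. 2 * (c n)\<^sup>2) - Q) < r"
        using best[of N d] N bessel[of m] by simp
    qed
  qed
  then show ?thesis by (simp add: sums_def c_def Q_def)
qed

text \<open>Polarisation of \<open>sine_parseval\<close>. The bound on the partial sums is uniform
  in \<open>N\<close>, as dominated convergence in time will require.\<close>

lemma sine_parseval_inner:
  assumes f: "L2 f" and g: "L2 g"
  defines "t \<equiv> \<lambda>n. 2 * (\<integral>x. f x * sine_mode n x \<partial>I01) * (\<integral>x. g x * sine_mode n x \<partial>I01)"
  shows "t sums (\<integral>x. f x * g x \<partial>I01)"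
    and "\<bar>\<Sum>n<N. t n\<bar> \<le> (\<integral>x. (f x)\<^sup>2 \<partial>I01) + (\<integral>x. (g x)\<^sup>2 \<partial>I01)"
proof -
  define a where "a = (\<lambda>n. \<integral>x. f x * sine_mode n x \<partial>I01)"
  define b where "b = (\<lambda>n. \<integral>x. g x * sine_mode n x \<partial>I01)"
  have a: "(\<integral>x. f x * sine_mode n x \<partial>I01) = a n" and b: "(\<integral>x. g x * sine_mode n x \<partial>I01) = b n" for n
    by (simp_all add: a_def b_def)
  note [simp] = L2D(2)[OF f] L2D(2)[OF g] L2_mult_integrable[OF f g]
    L2_mult_integrable[OF f L2_sine_mode] L2_mult_integrable[OF g L2_sine_mode]
  have ab: "(\<integral>x. (f x + g x) * sine_mode n x \<partial>I01) = a n + b n" for n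
    by (simp add: a b distrib_right)
  have "(\<integral>x. (f x + g x)\<^sup>2 \<partial>I01) = (\<integral>x. (f x)\<^sup>2 + (g x)\<^sup>2 + 2 * (f x * g x) \<partial>I01)"
    by (simp add: power2_sum mult.assoc)
  also have "\<dots> = (\<integral>x. (f x)\<^sup>2 \<partial>I01) + (\<integral>x. (g x)\<^sup>2 \<partial>I01) + 2 * (\<integral>x. f x * g x \<partial>I01)"
    by simp
  finally have sq: "(\<integral>x. (f x + g x)\<^sup>2 \<partial>I01) = \<dots>" .
  have "(\<lambda>n. (2 * (a n + b n)\<^sup>2 - 2 * (a n)\<^sup>2 - 2 * (b n)\<^sup>2) / 2) sums
     (((\<integral>x. (f x + g x)\<^sup>2 \<partial>I01) - (\<integral>x. (f x)\<^sup>2 \<partial>I01) - (\<integral>x. (g x)\<^sup>2 \<partial>I01)) / 2)"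
    using sine_parseval[OF L2_add[OF f g]] sine_parseval[OF f] sine_parseval[OF g]
    by (intro sums_divide sums_diff) (simp_all add: ab a b)
  moreover have "((\<integral>x. (f x + g x)\<^sup>2 \<partial>I01) - (\<integral>x. (f x)\<^sup>2 \<partial>I01) - (\<integral>x. (g x)\<^sup>2 \<partial>I01)) / 2
      = (\<integral>x. f x * g x \<partial>I01)"
    using sq by simp
  moreover have "(2 * (a n + b n)\<^sup>2 - 2 * (a n)\<^sup>2 - 2 * (b n)\<^sup>2) / 2 = t n" for n
    by (simp add: t_def a b power2_sum algebra_simps)
  ultimately show "t sums (\<integral>x. f x * g x \<partial>I01)" by simp
  have part: "(\<Sum>n<N. 2 * (\<integral>x. h x * sine_mode n x \<partial>I01)\<^sup>2) \<le> (\<integral>x. (h x)\<^sup>2 \<partial>I01)" if "L2 h" for h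
    using sum_le_suminf[OF sums_summable[OF sine_parseval[OF that]], of "{..<N}"]
      sums_unique[OF sine_parseval[OF that]]
    by simp
  have "\<bar>\<Sum>n<N. t n\<bar> \<le> (\<Sum>n<N. \<bar>t n\<bar>)" by (rule sum_abs)
  also have "\<dots> \<le> (\<Sum>n<N. 2 * (a n)\<^sup>2 + 2 * (b n)\<^sup>2)"
  proof (rule sum_mono)
    fix n
    have "\<bar>t n\<bar> = 2 * \<bar>a n * b n\<bar>" by (simp add: t_def a b abs_mult)
    then show "\<bar>t n\<bar> \<le> 2 * (a n)\<^sup>2 + 2 * (b n)\<^sup>2"
      using abs_mult_le_squares[of "a n" "b n"] by linarith
  qed
  also have "\<dots> \<le> (\<integral>x. (f x)\<^sup>2 \<partial>I01) + (\<integral>x. (g x)\<^sup>2 \<partial>I01)"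
    using part[OF f] part[OF g] by (simp add: sum.distrib a b)
  finally show "\<bar>\<Sum>n<N. t n\<bar> \<le> (\<integral>x. (f x)\<^sup>2 \<partial>I01) + (\<integral>x. (g x)\<^sup>2 \<partial>I01)" .
qed

subsection \<open>Functions in $H^1$: traces, Wirtinger inequality, cosine expansion\<close>

lemma integrable_I01_iff: "integrable I01 f \<longleftrightarrow> f absolutely_integrable_on {0..1}"
  for f :: "real \<Rightarrow> real"
  by (simp add: integrable_restrict_space set_integrable_def)

lemma L2_absolutely_integrable:
  assumes "L2 g" "{a..b} \<subseteq> {0..1}"
  shows "g absolutely_integrable_on {a..b}"
proof (rule set_integrable_subset)
  show "g absolutely_integrable_on {0..1}"
    using L2_integrable[OF assms(1)] unfolding integrable_I01_iff .
qed (use assms in auto)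

lemma integral_I01_eqI:
  fixes f :: "real \<Rightarrow> real"
  assumes "f absolutely_integrable_on {0..1}" "(f has_integral v) {0..1}"
  shows "(\<integral>x. f x \<partial>I01) = v"
  using has_integral_unique[OF has_integral_integral_lebesgue_on assms(2)] assms(1)
  by (simp add: integrable_I01_iff)

text \<open>\<open>H1\<close> is phrased with Lebesgue integrals, whereas the calculus here uses
  gauge integrals; this rule and \<open>H1_has_integral\<close> convert between the two.\<close>

lemma H1_I:
  assumes "L2 g" "\<And>x. x \<in> {0..1} \<Longrightarrow> (g has_integral f x - f 0) {0..x}"
  shows "H1 f g"
  unfolding H1_def
proof (intro conjI ballI)
  fix x :: real assume x: "x \<in> {0..1}"
  have "g absolutely_integrable_on {0..x}"
    by (rule L2_absolutely_integrable[OF assms(1)]) (use x in auto)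
  then have "integrable (lebesgue_on {0..x}) g"
    by (simp add: integrable_restrict_space set_integrable_def)
  then have "(g has_integral (\<integral>y. g y \<partial>lebesgue_on {0..x})) {0..x}"
    by (intro has_integral_integral_lebesgue_on) auto
  then have "(\<integral>y. g y \<partial>lebesgue_on {0..x}) = f x - f 0"
    by (rule has_integral_unique[OF _ assms(2)[OF x]])
  then show "f x = f 0 + (\<integral>y. g y \<partial>lebesgue_on {0..x})" by simp
qed (fact assms)

lemma H1_L2_deriv: "H1 f g \<Longrightarrow> L2 g"
  by (simp add: H1_def)

lemma H1_has_integral:
  assumes "H1 f g" "x \<in> {0..1}"
  shows "(g has_integral f x - f 0) {0..x}"
proof -
  have "g absolutely_integrable_on {0..x}"
    by (rule L2_absolutely_integrable[OF H1_L2_deriv[OF assms(1)]]) (use assms in auto)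
  then have "integrable (lebesgue_on {0..x}) g"
    by (simp add: integrable_restrict_space set_integrable_def)
  then have "(g has_integral (\<integral>y. g y \<partial>lebesgue_on {0..x})) {0..x}"
    by (intro has_integral_integral_lebesgue_on) auto
  moreover have "f x = f 0 + (\<integral>y. g y \<partial>lebesgue_on {0..x})"
    using assms unfolding H1_def by blast
  ultimately show ?thesis by simp
qed

lemma H1_continuous:
  assumes "H1 f g"
  shows "continuous_on {0..1} f"
  using has_integral_imp_continuous_on[of 0 1 g f] H1_has_integral[OF assms] by blast

lemma H1_L2: "H1 f g \<Longrightarrow> L2 f"
  by (rule L2_continuous[OF H1_continuous])

lemma H1_C1:
  assumes "\<And>x. x \<in> {0..1} \<Longrightarrow> (f has_real_derivative g x) (at x within {0..1})"
    and "continuous_on {0..1} g"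
  shows "H1 f g"
proof (rule H1_I)
  fix x :: real assume x: "x \<in> {0..1}"
  show "(g has_integral f x - f 0) {0..x}"
    using x has_field_derivative_subset[OF assms(1), of _ "{0..x}"]
    by (intro fundamental_theorem_of_calculus)
      (auto simp flip: has_real_derivative_iff_has_vector_derivative)
qed (rule L2_continuous[OF assms(2)])

lemma L2_continuous_mult:
  assumes "continuous_on {0..1} h" "L2 f"
  shows "L2 (\<lambda>x. h x * f x)"
proof -
  obtain K where "\<And>x. x \<in> {0..1} \<Longrightarrow> \<bar>h x\<bar> \<le> K"
    using compact_imp_bounded[OF compact_continuous_image[OF assms(1)]]
    by (force simp: bounded_iff)
  then show ?thesis
    using L2_bounded_mult[OF continuous_on_I01_measurable[OF assms(1)] _ assms(2)] by blast
qed

lemma H1_mult: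
  assumes f: "H1 f f'" and g: "H1 g g'"
  shows "H1 (\<lambda>x. f x * g x) (\<lambda>x. f x * g' x + f' x * g x)"
proof (rule H1_I)
  show "L2 (\<lambda>x. f x * g' x + f' x * g x)"
    using L2_add[OF L2_continuous_mult L2_continuous_mult, OF H1_continuous[OF f] H1_L2_deriv[OF g]
        H1_continuous[OF g] H1_L2_deriv[OF f]]
    by (simp add: mult.commute)
  fix x :: real assume x: "x \<in> {0..1}"
  show "((\<lambda>x. f x * g' x + f' x * g x) has_integral f x * g x - f 0 * g 0) {0..x}"
    by (rule product_of_indefinite_integrals)
      (use x in \<open>auto intro!: L2_absolutely_integrable[OF H1_L2_deriv[OF f]]
        L2_absolutely_integrable[OF H1_L2_deriv[OF g]] H1_has_integral[OF f] H1_has_integral[OF g]\<close>)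
qed

lemma H1_integral_deriv:
  assumes "H1 f g"
  shows "(\<integral>x. g x \<partial>I01) = f 1 - f 0"
proof -
  have "f 1 = f 0 + (\<integral>x. g x \<partial>I01)"
    using assms unfolding H1_def by (meson atLeastAtMost_iff order_refl zero_le_one)
  then show ?thesis by simp
qed

lemma H1_add: "H1 f f' \<Longrightarrow> H1 g g' \<Longrightarrow> H1 (\<lambda>x. f x + g x) (\<lambda>x. f' x + g' x)"
  using has_integral_add[OF H1_has_integral H1_has_integral]
  by (intro H1_I L2_add) (auto simp: H1_L2_deriv algebra_simps)

lemma H1_const: "H1 (\<lambda>x. c) (\<lambda>x. 0)"
  by (rule H1_C1) auto

lemma H1_by_parts:
  assumes f: "H1 f f'" and g: "H1 g g'"
  shows "(\<integral>x. f x * g' x \<partial>I01) = f 1 * g 1 - f 0 * g 0 - (\<integral>x. f' x * g x \<partial>I01)"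
  using H1_integral_deriv[OF H1_mult[OF f g]]
    L2_mult_integrable[OF H1_L2[OF f] H1_L2_deriv[OF g]] L2_mult_integrable[OF H1_L2_deriv[OF f] H1_L2[OF g]]
  by simp

lemma H1_indefinite_integral:
  assumes "L2 g"
  shows "H1 (\<lambda>x. integral {0..x} g) g"
proof (rule H1_I[OF assms])
  fix x :: real assume x: "x \<in> {0..1}"
  have "g absolutely_integrable_on {0..x}"
    by (rule L2_absolutely_integrable[OF assms(1)]) (use x in auto)
  then show "(g has_integral integral {0..x} g - integral {0..0} g) {0..x}"
    by (auto simp: absolutely_integrable_on_def intro: integrable_integral)
qed

text \<open>Integration by parts against \<open>1 - x\<close> and \<open>x\<close>, each vanishing
  at the opposite end. The traces become L2 functionals of \<open>w\<close> and \<open>w'\<close>,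
  so that boundary terms can later be merged with interior ones.\<close>

lemma H1_boundary_values:
  assumes "H1 w w'"
  shows "w 0 = (\<integral>x. w x \<partial>I01) - (\<integral>x. (1 - x) * w' x \<partial>I01)"
    and "w 1 = (\<integral>x. w x \<partial>I01) + (\<integral>x. x * w' x \<partial>I01)"
proof -
  have "H1 (\<lambda>x. 1 - x) (\<lambda>x. -1)" "H1 (\<lambda>x. x) (\<lambda>x. 1)"
    by (rule H1_C1; auto intro!: derivative_eq_intros)+
  from this[THEN H1_by_parts[OF _ assms]]
  show "w 0 = (\<integral>x. w x \<partial>I01) - (\<integral>x. (1 - x) * w' x \<partial>I01)"
    and "w 1 = (\<integral>x. w x \<partial>I01) + (\<integral>x. x * w' x \<partial>I01)" by simp_all
qed

text \<open>By \<open>H1_boundary_values\<close> a trace is the mean of \<open>w\<close> plus or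
  minus an integral of \<open>w'\<close> against a weight of modulus at most one; the constant 2
  comes from squaring a two-term sum.\<close>

lemma H1_trace:
  assumes w: "H1 w w'" and x: "x \<in> {0, 1}"
  shows "(w x)\<^sup>2 \<le> 2 * ((\<integral>x. (w x)\<^sup>2 \<partial>I01) + (\<integral>x. (w' x)\<^sup>2 \<partial>I01))"
proof -
  have weight: "(\<integral>x. h x * w' x \<partial>I01)\<^sup>2 \<le> (\<integral>x. (w' x)\<^sup>2 \<partial>I01)"
    if h: "continuous_on {0..1} h" "\<And>x. x \<in> {0..1} \<Longrightarrow> \<bar>h x\<bar> \<le> 1" for h
  proof -
    have L: "L2 (\<lambda>x. h x * w' x)" by (rule L2_continuous_mult[OF h(1) H1_L2_deriv[OF w]])
    have "(\<integral>x. h x * w' x \<partial>I01)\<^sup>2 \<le> (\<integral>x. (h x * w' x)\<^sup>2 \<partial>I01)" by (rule square_integral_I01_le[OF L])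
    also have "\<dots> \<le> (\<integral>x. (w' x)\<^sup>2 \<partial>I01)"
    proof (rule integral_mono)
      fix x assume "x \<in> space I01"
      then have "(h x)\<^sup>2 \<le> 1" using h(2)[of x] by (simp add: abs_square_le_1)
      then show "(h x * w' x)\<^sup>2 \<le> (w' x)\<^sup>2"
        by (simp add: power_mult_distrib mult_left_le_one_le)
    qed (use L2D(2)[OF L] L2D(2)[OF H1_L2_deriv[OF w]] in auto)
    finally show ?thesis .
  qed
  have two: "(u + v)\<^sup>2 \<le> 2 * (u\<^sup>2 + v\<^sup>2)" "(u - v)\<^sup>2 \<le> 2 * (u\<^sup>2 + v\<^sup>2)" for u v :: real
    using two_mult_le_squares[of u v] by (auto simp: power2_sum power2_diff abs_if split: if_splits)
  have sq: "(\<integral>x. w x \<partial>I01)\<^sup>2 \<le> (\<integral>x. (w x)\<^sup>2 \<partial>I01)"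
    by (rule square_integral_I01_le[OF H1_L2[OF w]])
  have "(w 0)\<^sup>2 \<le> 2 * ((\<integral>x. (w x)\<^sup>2 \<partial>I01) + (\<integral>x. (w' x)\<^sup>2 \<partial>I01))"
    using two(2)[of "\<integral>x. w x \<partial>I01" "\<integral>x. (1 - x) * w' x \<partial>I01"] sq weight[of "\<lambda>x. 1 - x"]
    unfolding H1_boundary_values(1)[OF w] by (simp add: continuous_on_diff)
  moreover have "(w 1)\<^sup>2 \<le> 2 * ((\<integral>x. (w x)\<^sup>2 \<partial>I01) + (\<integral>x. (w' x)\<^sup>2 \<partial>I01))"
    using two(1)[of "\<integral>x. w x \<partial>I01" "\<integral>x. x * w' x \<partial>I01"] sq weight[of "\<lambda>x. x"]
    unfolding H1_boundary_values(2)[OF w] by simp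
  ultimately show ?thesis using x by auto
qed

text \<open>The weight \<open>p x = c * tan (c * (1 - x))\<close> solves the Riccati equation \<open>p' = - c\<^sup>2 - p\<^sup>2\<close>, so that
  \<open>w'\<^sup>2 - c\<^sup>2 * w\<^sup>2 - (p * w\<^sup>2)' = (w' - p * w)\<^sup>2\<close>.\<close>

lemma wirtinger_weighted:
  assumes w: "H1 w w'" and "w 0 = 0" and c: "0 \<le> c" "c < pi / 2"
  shows "c\<^sup>2 * (\<integral>x. (w x)\<^sup>2 \<partial>I01) \<le> (\<integral>x. (w' x)\<^sup>2 \<partial>I01)"
proof -
  define p where "p = (\<lambda>x. c * tan (c * (1 - x)))"
  define p' where "p' = (\<lambda>x. - c\<^sup>2 - (p x)\<^sup>2)"
  have cos: "cos (c * (1 - x)) \<noteq> 0" if "x \<in> {0..1}" for x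
  proof -
    have "0 \<le> c * (1 - x)" "c * (1 - x) \<le> c" using that c by (auto intro: mult_left_le)
    then show ?thesis using c cos_gt_zero_pi[of "c * (1 - x)"] by (auto simp: )
  qed
  have p: "H1 p p'"
  proof (rule H1_C1)
    show "continuous_on {0..1} p'" unfolding p'_def p_def using cos by (intro continuous_intros) auto
    fix x :: real assume x: "x \<in> {0..1}"
    have "(p has_real_derivative c * (- c * (inverse (cos (c * (1 - x))))\<^sup>2)) (at x)"
      unfolding p_def using cos[OF x] by (auto intro!: derivative_eq_intros simp: power_inverse)
    also have "c * (- c * (inverse (cos (c * (1 - x))))\<^sup>2) = p' x"
      unfolding tan_sec[OF cos[OF x], symmetric]
      by (simp add: p'_def p_def power2_eq_square algebra_simps)
    finally show "(p has_real_derivative p' x) (at x within {0..1})"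
      by (rule has_field_derivative_at_within)
  qed
  have ww: "H1 (\<lambda>x. w x * w x) (\<lambda>x. w x * w' x + w' x * w x)" by (rule H1_mult[OF w w])
  have pww: "H1 (\<lambda>x. p x * (w x * w x)) (\<lambda>x. p x * (w x * w' x + w' x * w x) + p' x * (w x * w x))"
    by (rule H1_mult[OF p ww])
  \<comment> \<open>No boundary terms survive: \<open>w\<close> vanishes at 0, and the weight
    \<open>p\<close> at 1 because \<open>tan 0 = 0\<close>.\<close>
  have "0 = (\<integral>x. p x * (w x * w' x + w' x * w x) + p' x * (w x * w x) \<partial>I01)"
    using H1_integral_deriv[OF pww] assms(2) by (simp add: p_def[THEN fun_cong, of 1])
  also have "\<dots> \<le> (\<integral>x. (w' x)\<^sup>2 - c\<^sup>2 * (w x)\<^sup>2 \<partial>I01)"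
  proof (rule integral_mono)
    show "integrable I01 (\<lambda>x. p x * (w x * w' x + w' x * w x) + p' x * (w x * w x))"
      by (rule L2_integrable[OF H1_L2_deriv[OF pww]])
    show "integrable I01 (\<lambda>x. (w' x)\<^sup>2 - c\<^sup>2 * (w x)\<^sup>2)"
      using L2D(2)[OF H1_L2[OF w]] L2D(2)[OF H1_L2_deriv[OF w]] by simp
    fix x
    have "0 \<le> (w' x - p x * w x)\<^sup>2" by simp
    then show "p x * (w x * w' x + w' x * w x) + p' x * (w x * w x) \<le> (w' x)\<^sup>2 - c\<^sup>2 * (w x)\<^sup>2"
      by (simp add: p'_def power2_eq_square algebra_simps)
  qed
  also have "\<dots> = (\<integral>x. (w' x)\<^sup>2 \<partial>I01) - c\<^sup>2 * (\<integral>x. (w x)\<^sup>2 \<partial>I01)"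
    using L2D(2)[OF H1_L2[OF w]] L2D(2)[OF H1_L2_deriv[OF w]] by simp
  finally show ?thesis by simp
qed

text \<open>At \<open>c = pi / 2\<close> the weight blows up at 0, so the sharp constant is reached
  as a limit from below.\<close>

lemma wirtinger:
  assumes w: "H1 w w'" and "w 0 = 0"
  shows "pi\<^sup>2 / 4 * (\<integral>x. (w x)\<^sup>2 \<partial>I01) \<le> (\<integral>x. (w' x)\<^sup>2 \<partial>I01)"
proof (rule tendsto_upperbound)
  show "((\<lambda>c. c\<^sup>2 * (\<integral>x. (w x)\<^sup>2 \<partial>I01)) \<longlongrightarrow> pi\<^sup>2 / 4 * (\<integral>x. (w x)\<^sup>2 \<partial>I01)) (at_left (pi / 2))"
    by (auto intro!: tendsto_eq_intros simp: power_divide)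
  have "\<forall>\<^sub>F c in at_left (pi / 2). c \<in> {0<..<pi/2}"
    by (rule eventually_at_left_real) simp
  then show "\<forall>\<^sub>F c in at_left (pi / 2). c\<^sup>2 * (\<integral>x. (w x)\<^sup>2 \<partial>I01) \<le> (\<integral>x. (w' x)\<^sup>2 \<partial>I01)"
    by eventually_elim (use wirtinger_weighted[OF assms] in auto)
qed simp

text \<open>Wirtinger's inequality for \<open>w - w 0\<close>, combined with Young's inequality
  \<open>(a + b)\<^sup>2 \<le> r * a\<^sup>2 + r / (r - 1) * b\<^sup>2\<close>. The parameter
  \<open>r\<close> stays free because its best value depends on the boundary feedback.\<close>

lemma H1_poincare:
  assumes w: "H1 w w'" and r: "1 < r"
  shows "(\<integral>x. (w x)\<^sup>2 \<partial>I01) \<le> r * (4 / pi\<^sup>2) * (\<integral>x. (w' x)\<^sup>2 \<partial>I01) + r / (r - 1) * (w 0)\<^sup>2"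
proof -
  have v: "H1 (\<lambda>x. w x - w 0) w'"
    using H1_add[OF w H1_const[of "- w 0"]] by simp
  note iv = L2D(2)[OF H1_L2[OF v]]
  interpret finite_measure I01 by (rule finite_measure_I01)
  have "(\<integral>x. (w x)\<^sup>2 \<partial>I01) \<le> (\<integral>x. r * (w x - w 0)\<^sup>2 + r / (r - 1) * (w 0)\<^sup>2 \<partial>I01)"
  proof (rule integral_mono)
    fix x
    define a where "a = w x - w 0"
    have "0 \<le> ((r - 1) * a - w 0)\<^sup>2 / (r - 1)" using r by simp
    also have "\<dots> = r * a\<^sup>2 + r / (r - 1) * (w 0)\<^sup>2 - (a + w 0)\<^sup>2"
      using r by (simp add: power2_eq_square field_simps)
    finally show "(w x)\<^sup>2 \<le> r * (w x - w 0)\<^sup>2 + r / (r - 1) * (w 0)\<^sup>2" by (simp add: a_def)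
  qed (use iv L2D(2)[OF H1_L2[OF w]] in auto)
  also have "\<dots> = r * (\<integral>x. (w x - w 0)\<^sup>2 \<partial>I01) + r / (r - 1) * (w 0)\<^sup>2"
    using iv by simp
  also have "(\<integral>x. (w x - w 0)\<^sup>2 \<partial>I01) \<le> 4 / pi\<^sup>2 * (\<integral>x. (w' x)\<^sup>2 \<partial>I01)"
    using wirtinger[OF v] by (simp add: field_simps)
  finally show ?thesis using r by (simp add: mult.assoc)
qed

text \<open>Integration by parts removes the zeroth-order term of a functional on \<open>H\<^sup>1\<close> up to the mean value.\<close>

lemma H1_functional_representation:
  assumes A: "L2 A" and B: "L2 B"
  obtains A' \<beta> where "L2 A'"
    "\<And>w w'. H1 w w' \<Longrightarrow> (\<integral>x. A x * w' x \<partial>I01) + (\<integral>x. B x * w x \<partial>I01)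
      = \<beta> * (\<integral>x. w x \<partial>I01) + (\<integral>x. A' x * w' x \<partial>I01)"
    "(\<integral>x. (A' x)\<^sup>2 \<partial>I01) \<le> 2 * (\<integral>x. (A x)\<^sup>2 \<partial>I01) + 8 * (\<integral>x. (B x)\<^sup>2 \<partial>I01)"
    "\<beta>\<^sup>2 \<le> (\<integral>x. (B x)\<^sup>2 \<partial>I01)"
proof -
  define C where "C = (\<lambda>x. integral {0..x} B)"
  have C: "H1 C B" unfolding C_def by (rule H1_indefinite_integral[OF B])
  have C0: "C 0 = 0" by (simp add: C_def)
  \<comment> \<open>By parts, the pairing of \<open>B\<close> with \<open>w\<close> is
    \<open>C 1 * w 1\<close> minus that of \<open>C\<close> with \<open>w'\<close>; replacing
    \<open>w 1\<close> by the mean plus the integral of \<open>x * w' x\<close> gives this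
    \<open>A'\<close>, with \<open>C 1\<close> as the coefficient of the mean.\<close>
  define A' where "A' = (\<lambda>x. A x + (C 1 * x - C x))"
  have lin: "L2 (\<lambda>x. C 1 * x - C x)"
    by (intro L2_continuous continuous_intros H1_continuous[OF C])
  have A': "L2 A'" unfolding A'_def by (intro L2_add A lin)
  define m where "m = (\<integral>x. \<bar>B x\<bar> \<partial>I01)"
  have absB: "(\<lambda>x. \<bar>B x\<bar>) absolutely_integrable_on {0..1}"
    using L2_integrable[OF B] by (auto simp flip: integrable_I01_iff)
  have m2: "m\<^sup>2 \<le> (\<integral>x. (B x)\<^sup>2 \<partial>I01)"
  proof -
    note [measurable] = L2D(1)[OF B]
    have "L2 (\<lambda>x. \<bar>B x\<bar>)" unfolding L2_def using L2D(2)[OF B] by simp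
    then show ?thesis using square_integral_I01_le[of "\<lambda>x. \<bar>B x\<bar>"] by (simp add: m_def)
  qed
  have Cm: "\<bar>C x\<bar> \<le> m" if "x \<in> {0..1}" for x
  proof -
    have i: "B integrable_on {0..x}" using H1_has_integral[OF C that] by blast
    have j: "(\<lambda>x. \<bar>B x\<bar>) integrable_on {0..1}" using absB by (auto simp: absolutely_integrable_on_def)
    then have k: "(\<lambda>x. \<bar>B x\<bar>) integrable_on {0..x}"
      by (rule integrable_subinterval_real) (use that in auto)
    have "\<bar>C x\<bar> \<le> integral {0..x} (\<lambda>x. \<bar>B x\<bar>)"
      unfolding C_def using integral_norm_bound_integral[OF i k] by simp
    also have "\<dots> \<le> integral {0..1} (\<lambda>x. \<bar>B x\<bar>)"
      by (rule integral_subset_le) (use that j k in auto)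
    also have "\<dots> = m" unfolding m_def
      by (rule integral_I01_eqI[symmetric]) (use absB j in auto)
    finally show ?thesis .
  qed
  show ?thesis
  proof (rule that[OF A'])
    fix w w' assume w: "H1 w w'"
    have xL2: "L2 (\<lambda>x. x)" by (intro L2_continuous continuous_intros)
    note [simp] = L2_mult_integrable[OF A H1_L2_deriv[OF w]] L2_mult_integrable[OF xL2 H1_L2_deriv[OF w]]
      L2_mult_integrable[OF H1_L2[OF C] H1_L2_deriv[OF w]]
    have "(\<integral>x. A' x * w' x \<partial>I01) = (\<integral>x. A x * w' x + (C 1 * (x * w' x) - C x * w' x) \<partial>I01)"
      by (intro Bochner_Integration.integral_cong) (auto simp: A'_def algebra_simps)
    also have "\<dots> = (\<integral>x. A x * w' x \<partial>I01) + (C 1 * (\<integral>x. x * w' x \<partial>I01) - (\<integral>x. C x * w' x \<partial>I01))"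
      by simp
    finally show "(\<integral>x. A x * w' x \<partial>I01) + (\<integral>x. B x * w x \<partial>I01)
      = C 1 * (\<integral>x. w x \<partial>I01) + (\<integral>x. A' x * w' x \<partial>I01)"
      using H1_by_parts[OF C w] H1_boundary_values(2)[OF w] by (simp add: C0 algebra_simps)
  next
    interpret finite_measure I01 by (rule finite_measure_I01)
    \<comment> \<open>The correction \<open>C 1 * x - C x\<close> is at most \<open>2 * m\<close> in
      modulus; its square, doubled, gives the factor 8.\<close>
    have "(\<integral>x. (A' x)\<^sup>2 \<partial>I01) \<le> (\<integral>x. 2 * (A x)\<^sup>2 + 8 * m\<^sup>2 \<partial>I01)"
    proof (rule integral_mono)
      fix x assume "x \<in> space I01"
      then have x: "x \<in> {0..1}" by simp
      have "\<bar>C 1 * x - C x\<bar> \<le> \<bar>C 1\<bar> * \<bar>x\<bar> + \<bar>C x\<bar>" by (metis abs_mult abs_triangle_ineq4)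
      also have "\<dots> \<le> m * 1 + m" using x Cm[OF x] Cm[of 1] by (intro add_mono mult_mono) auto
      finally have "(C 1 * x - C x)\<^sup>2 \<le> (2 * m)\<^sup>2"
        by (metis abs_ge_zero mult.right_neutral mult_2 power2_abs power_mono)
      then show "(A' x)\<^sup>2 \<le> 2 * (A x)\<^sup>2 + 8 * m\<^sup>2"
        using two_mult_le_squares[of "A x" "C 1 * x - C x"]
        by (simp add: A'_def power2_sum power_mult_distrib abs_le_iff)
    qed (use L2D(2)[OF A] L2D(2)[OF A'] in auto)
    also have "\<dots> = 2 * (\<integral>x. (A x)\<^sup>2 \<partial>I01) + 8 * m\<^sup>2"
      using L2D(2)[OF A] by simp
    finally show "(\<integral>x. (A' x)\<^sup>2 \<partial>I01) \<le> 2 * (\<integral>x. (A x)\<^sup>2 \<partial>I01) + 8 * (\<integral>x. (B x)\<^sup>2 \<partial>I01)"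
      using m2 by simp
  next
    have "(C 1)\<^sup>2 \<le> m\<^sup>2" using power_mono[OF Cm[of 1], of 2] by simp
    then show "(C 1)\<^sup>2 \<le> (\<integral>x. (B x)\<^sup>2 \<partial>I01)" using m2 by simp
  qed
qed

section \<open>Cosine coefficients and the sine series of the derivative\<close>

definition cos_mode :: "nat \<Rightarrow> real \<Rightarrow> real" where
  "cos_mode n x = cos (real n * pi * x)"

definition cos_mode' :: "nat \<Rightarrow> real \<Rightarrow> real" where
  "cos_mode' n x = - (real n * pi * sin (real n * pi * x))"

text \<open>The reciprocal of the squared L2 norm of \<open>cos_mode n\<close>, the constant mode
  being the exception.\<close>

definition cos_weight :: "nat \<Rightarrow> real" where
  "cos_weight n = (if n = 0 then 1 else 2)"

lemma H1_cos_mode: "H1 (cos_mode n) (cos_mode' n)"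
  unfolding cos_mode_def[abs_def] cos_mode'_def[abs_def]
  by (rule H1_C1) (auto intro!: derivative_eq_intros continuous_intros)

text \<open>The antiderivative of a cosine mode is a sine mode, which vanishes at both ends; hence
  no boundary condition on \<open>w\<close> is needed.\<close>

lemma integral_mult_cos_mode:
  assumes w: "H1 w w'"
  shows "(\<integral>x. w x * cos_mode (Suc n) x \<partial>I01)
    = - (\<integral>x. w' x * sine_mode n x \<partial>I01) / (real (Suc n) * pi)"
proof -
  have nz: "real (Suc n) * pi \<noteq> 0" by simp
  have s: "H1 (\<lambda>x. sine_mode n x / (real (Suc n) * pi)) (cos_mode (Suc n))"
    unfolding sine_mode_def[abs_def] cos_mode_def[abs_def]
    by (rule H1_C1) (use nz in \<open>auto intro!: derivative_eq_intros continuous_intros\<close>)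
  have "sine_mode n 0 = 0" "sine_mode n 1 = 0"
    using sin_npi[of "Suc n"] by (auto simp: sine_mode_def)
  then show ?thesis
    using H1_by_parts[OF w s] by simp
qed

text \<open>The functional given by \<open>A\<close> and \<open>B\<close> may be applied to the
  cosine series of \<open>w\<close> term by term. After its zeroth-order part has been reduced to
  the mean value, the constant mode carries the mean and the other terms are the Parseval terms of
  \<open>w'\<close> and \<open>A'\<close>. Summing up to \<open>Suc N\<close> always includes the
  constant mode.\<close>

lemma cosine_expansion:
  assumes A: "L2 A" and B: "L2 B" and w: "H1 w w'"
  defines "T \<equiv> \<lambda>n. cos_weight n * (\<integral>x. w x * cos_mode n x \<partial>I01)
      * ((\<integral>x. A x * cos_mode' n x \<partial>I01) + (\<integral>x. B x * cos_mode n x \<partial>I01))"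
  shows "(\<lambda>N. \<Sum>n<Suc N. T n) \<longlonglongrightarrow> (\<integral>x. A x * w' x \<partial>I01) + (\<integral>x. B x * w x \<partial>I01)"
    and "\<bar>\<Sum>n<Suc N. T n\<bar> \<le> 9 * ((\<integral>x. (A x)\<^sup>2 \<partial>I01) + (\<integral>x. (B x)\<^sup>2 \<partial>I01)
      + (\<integral>x. (w x)\<^sup>2 \<partial>I01) + (\<integral>x. (w' x)\<^sup>2 \<partial>I01))"
proof -
  obtain A' \<beta> where A': "L2 A'" and rep: "\<And>w w'. H1 w w' \<Longrightarrow>
      (\<integral>x. A x * w' x \<partial>I01) + (\<integral>x. B x * w x \<partial>I01) = \<beta> * (\<integral>x. w x \<partial>I01) + (\<integral>x. A' x * w' x \<partial>I01)"
    and bA: "(\<integral>x. (A' x)\<^sup>2 \<partial>I01) \<le> 2 * (\<integral>x. (A x)\<^sup>2 \<partial>I01) + 8 * (\<integral>x. (B x)\<^sup>2 \<partial>I01)"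
    and b\<beta>: "\<beta>\<^sup>2 \<le> (\<integral>x. (B x)\<^sup>2 \<partial>I01)"
    by (rule H1_functional_representation[OF A B]) blast
  define t where "t = (\<lambda>n. 2 * (\<integral>x. w' x * sine_mode n x \<partial>I01) * (\<integral>x. A' x * sine_mode n x \<partial>I01))"
  note pars = sine_parseval_inner[OF H1_L2_deriv[OF w] A', folded t_def]
  have T0: "T 0 = \<beta> * (\<integral>x. w x \<partial>I01)"
    unfolding T_def rep[OF H1_cos_mode]
    by (simp add: cos_weight_def cos_mode_def[abs_def] cos_mode'_def[abs_def])
  \<comment> \<open>The frequency factor produced by differentiating the cosine cancels the one in
    \<open>integral_mult_cos_mode\<close>.\<close>
  have TS: "T (Suc n) = t n" for n
  proof -
    have "(\<integral>x. cos_mode (Suc n) x \<partial>I01) = 0"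
      using integral_I01_cos[of "int (Suc n)"] by (simp add: cos_mode_def)
    moreover have "(\<integral>x. A' x * cos_mode' (Suc n) x \<partial>I01) = (\<integral>x. - (real (Suc n) * pi) * (A' x * sine_mode n x) \<partial>I01)"
      by (intro Bochner_Integration.integral_cong) (auto simp: cos_mode'_def sine_mode_def)
    ultimately show ?thesis
      unfolding T_def rep[OF H1_cos_mode] integral_mult_cos_mode[OF w]
      by (simp add: cos_weight_def t_def divide_simps)
  qed
  have sumT: "(\<Sum>n<Suc N. T n) = \<beta> * (\<integral>x. w x \<partial>I01) + (\<Sum>n<N. t n)" for N
    by (subst sum.lessThan_Suc_shift) (simp add: T0 TS)
  show "(\<lambda>N. \<Sum>n<Suc N. T n) \<longlonglongrightarrow> (\<integral>x. A x * w' x \<partial>I01) + (\<integral>x. B x * w x \<partial>I01)"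
    unfolding sumT rep[OF w]
    using pars(1) by (intro tendsto_intros) (simp add: sums_def mult.commute)
  have "(\<integral>x. w x \<partial>I01)\<^sup>2 \<le> (\<integral>x. (w x)\<^sup>2 \<partial>I01)"
    by (rule square_integral_I01_le[OF H1_L2[OF w]])
  then have "\<bar>\<beta> * (\<integral>x. w x \<partial>I01)\<bar> \<le> (\<integral>x. (B x)\<^sup>2 \<partial>I01) + (\<integral>x. (w x)\<^sup>2 \<partial>I01)"
    using abs_mult_le_squares[of \<beta> "\<integral>x. w x \<partial>I01"] b\<beta> by linarith
  moreover have "0 \<le> (\<integral>x. (A x)\<^sup>2 \<partial>I01)" "0 \<le> (\<integral>x. (w x)\<^sup>2 \<partial>I01)" "0 \<le> (\<integral>x. (w' x)\<^sup>2 \<partial>I01)"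
    by (auto intro!: Bochner_Integration.integral_nonneg)
  \<comment> \<open>The 9 is 8 from the bound on \<open>A'\<close> plus 1 from the bound on
    \<open>\<beta>\<^sup>2\<close>, both multiplying the integral of
    \<open>(B x)\<^sup>2\<close>.\<close>
  ultimately show "\<bar>\<Sum>n<Suc N. T n\<bar> \<le> 9 * ((\<integral>x. (A x)\<^sup>2 \<partial>I01) + (\<integral>x. (B x)\<^sup>2 \<partial>I01)
      + (\<integral>x. (w x)\<^sup>2 \<partial>I01) + (\<integral>x. (w' x)\<^sup>2 \<partial>I01))"
    unfolding sumT
    using abs_triangle_ineq[of "\<beta> * (\<integral>x. w x \<partial>I01)" "\<Sum>n<N. t n"] pars(2)[of N] bA
    by argo
qed

subsection \<open>Energy identity and scalar inequalities\<close>

lemma abs_integral_mult_le: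
  assumes "L2 f" "L2 g"
  shows "\<bar>\<integral>x. f x * g x \<partial>I01\<bar> \<le> (\<integral>x. (f x)\<^sup>2 \<partial>I01) + (\<integral>x. (g x)\<^sup>2 \<partial>I01)"
proof -
  have "\<bar>\<integral>x. f x * g x \<partial>I01\<bar> \<le> (\<integral>x. \<bar>f x * g x\<bar> \<partial>I01)"
    using integral_norm_bound[of I01 "\<lambda>x. f x * g x"] by simp
  also have "\<dots> \<le> (\<integral>x. (f x)\<^sup>2 + (g x)\<^sup>2 \<partial>I01)"
    using L2_mult_integrable[OF assms] L2D(2)[OF assms(1)] L2D(2)[OF assms(2)]
    by (intro integral_mono) (auto intro: abs_mult_le_squares)
  also have "\<dots> = (\<integral>x. (f x)\<^sup>2 \<partial>I01) + (\<integral>x. (g x)\<^sup>2 \<partial>I01)"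
    using L2D(2)[OF assms(1)] L2D(2)[OF assms(2)] by simp
  finally show ?thesis .
qed

text \<open>Testing the weak form with \<open>cos (n * pi * x)\<close> turns it into scalar integral equations, for which the
  product rule holds; the cosine expansion then recovers the energy of \<open>w\<close> by dominated convergence.\<close>

lemma energy_identity:
  fixes w w' A B :: "real \<Rightarrow> real \<Rightarrow> real" and N :: "real \<Rightarrow> real"
  assumes st: "s \<le> t"
    and w: "\<And>\<tau>. \<tau> \<in> {s..t} \<Longrightarrow> H1 (w \<tau>) (w' \<tau>)"
    and A: "\<And>\<tau>. \<tau> \<in> {s..t} \<Longrightarrow> L2 (A \<tau>)"
    and B: "\<And>\<tau>. \<tau> \<in> {s..t} \<Longrightarrow> L2 (B \<tau>)"
    and N: "N integrable_on {s..t}"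
    and bound: "\<And>\<tau>. \<tau> \<in> {s..t} \<Longrightarrow> (\<integral>x. (A \<tau> x)\<^sup>2 \<partial>I01) + (\<integral>x. (B \<tau> x)\<^sup>2 \<partial>I01)
      + (\<integral>x. (w \<tau> x)\<^sup>2 \<partial>I01) + (\<integral>x. (w' \<tau> x)\<^sup>2 \<partial>I01) \<le> N \<tau>"
    and weak: "\<And>\<phi> \<phi>' \<tau>. H1 \<phi> \<phi>' \<Longrightarrow> \<tau> \<in> {s..t} \<Longrightarrow>
      ((\<lambda>\<sigma>. (\<integral>x. A \<sigma> x * \<phi>' x \<partial>I01) + (\<integral>x. B \<sigma> x * \<phi> x \<partial>I01)) has_integral
        ((\<integral>x. w \<tau> x * \<phi> x \<partial>I01) - (\<integral>x. w s x * \<phi> x \<partial>I01))) {s..\<tau>}"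
  shows "((\<lambda>\<sigma>. (\<integral>x. A \<sigma> x * w' \<sigma> x \<partial>I01) + (\<integral>x. B \<sigma> x * w \<sigma> x \<partial>I01)) has_integral
      ((\<integral>x. (w t x)\<^sup>2 \<partial>I01) - (\<integral>x. (w s x)\<^sup>2 \<partial>I01)) / 2) {s..t}"
proof -
  define c where "c = (\<lambda>n \<tau>. \<integral>x. w \<tau> x * cos_mode n x \<partial>I01)"
  define f where "f = (\<lambda>n \<sigma>. (\<integral>x. A \<sigma> x * cos_mode' n x \<partial>I01) + (\<integral>x. B \<sigma> x * cos_mode n x \<partial>I01))"
  have fc: "(f n has_integral c n \<tau> - c n s) {s..\<tau>}" if "\<tau> \<in> {s..t}" for n \<tau>
    using weak[OF H1_cos_mode that] by (simp add: f_def c_def)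
  have sq0: "0 \<le> (\<integral>x. (h x)\<^sup>2 \<partial>I01)" for h :: "real \<Rightarrow> real"
    by (intro Bochner_Integration.integral_nonneg) auto
  \<comment> \<open>The weak form only provides gauge integrability in time; the majorant
    \<open>N\<close> upgrades it to the absolute integrability required by the product rule.\<close>
  have fi: "f n absolutely_integrable_on {s..t}" for n
  proof (rule absolutely_integrable_integrable_bound)
    show "f n integrable_on {s..t}" using fc[of t n] st by auto
    define K where "K = (\<integral>x. (cos_mode' n x)\<^sup>2 \<partial>I01) + (\<integral>x. (cos_mode n x)\<^sup>2 \<partial>I01)"
    show "(\<lambda>\<sigma>. N \<sigma> + K) integrable_on {s..t}"
      using N by (intro integrable_add) auto
    fix \<sigma> assume \<sigma>: "\<sigma> \<in> {s..t}"
    have "\<bar>f n \<sigma>\<bar> \<le> \<bar>\<integral>x. A \<sigma> x * cos_mode' n x \<partial>I01\<bar> + \<bar>\<integral>x. B \<sigma> x * cos_mode n x \<partial>I01\<bar>"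
      unfolding f_def by (rule abs_triangle_ineq)
    also have "\<dots> \<le> N \<sigma> + K"
      unfolding K_def
      using abs_integral_mult_le[OF A[OF \<sigma>] H1_L2_deriv[OF H1_cos_mode[of n]]]
        abs_integral_mult_le[OF B[OF \<sigma>] H1_L2[OF H1_cos_mode[of n]]] bound[OF \<sigma>]
        sq0[of "w \<sigma>"] sq0[of "w' \<sigma>"] by linarith
    finally show "norm (f n \<sigma>) \<le> N \<sigma> + K" by simp
  qed
  have cf: "((\<lambda>\<sigma>. c n \<sigma> * f n \<sigma>) has_integral ((c n t)\<^sup>2 - (c n s)\<^sup>2) / 2) {s..t}" for n
    using has_integral_divide[OF product_of_indefinite_integrals(2)[OF st fi fi fc fc], of n n 2]
    by (simp add: power2_eq_square mult.commute)
  \<comment> \<open>The choice \<open>A = 0\<close>, \<open>B = w\<close> in the cosine expansion is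
    Parseval's identity for \<open>w\<close>.\<close>
  have energy: "(\<lambda>k. \<Sum>n<Suc k. cos_weight n * (c n \<tau>)\<^sup>2) \<longlonglongrightarrow> (\<integral>x. (w \<tau> x)\<^sup>2 \<partial>I01)" if "\<tau> \<in> {s..t}" for \<tau>
    using cosine_expansion(1)[OF L2_const[of 0] H1_L2[OF w[OF that]] w[OF that]]
    by (simp add: c_def power2_eq_square mult.assoc)
  show ?thesis
  proof (rule has_integral_dominated_convergence)
    show "((\<lambda>\<sigma>. \<Sum>n<Suc k. cos_weight n * (c n \<sigma> * f n \<sigma>)) has_integral
        (\<Sum>n<Suc k. cos_weight n * (((c n t)\<^sup>2 - (c n s)\<^sup>2) / 2))) {s..t}" for k
      by (intro has_integral_sum has_integral_mult_right cf) auto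
    show "(\<lambda>\<sigma>. 9 * N \<sigma>) integrable_on {s..t}" using N by (rule integrable_on_mult_right)
    show "\<forall>\<sigma>\<in>{s..t}. norm (\<Sum>n<Suc k. cos_weight n * (c n \<sigma> * f n \<sigma>)) \<le> 9 * N \<sigma>" for k
    proof
      fix \<sigma> assume \<sigma>: "\<sigma> \<in> {s..t}"
      show "norm (\<Sum>n<Suc k. cos_weight n * (c n \<sigma> * f n \<sigma>)) \<le> 9 * N \<sigma>"
        using order.trans[OF cosine_expansion(2)[OF A[OF \<sigma>] B[OF \<sigma>] w[OF \<sigma>], of k]
            mult_left_mono[OF bound[OF \<sigma>], of 9]]
        unfolding c_def f_def real_norm_def mult.assoc by simp
    qed
    show "\<forall>\<sigma>\<in>{s..t}. (\<lambda>k. \<Sum>n<Suc k. cos_weight n * (c n \<sigma> * f n \<sigma>)) \<longlonglongrightarrow>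
        (\<integral>x. A \<sigma> x * w' \<sigma> x \<partial>I01) + (\<integral>x. B \<sigma> x * w \<sigma> x \<partial>I01)"
      using cosine_expansion(1)[OF A B w] unfolding c_def f_def mult.assoc by blast
    have "(\<lambda>k. ((\<Sum>n<Suc k. cos_weight n * (c n t)\<^sup>2) - (\<Sum>n<Suc k. cos_weight n * (c n s)\<^sup>2)) / 2)
        \<longlonglongrightarrow> ((\<integral>x. (w t x)\<^sup>2 \<partial>I01) - (\<integral>x. (w s x)\<^sup>2 \<partial>I01)) / 2"
      using st by (intro tendsto_intros energy) auto
    then show "(\<lambda>k. \<Sum>n<Suc k. cos_weight n * (((c n t)\<^sup>2 - (c n s)\<^sup>2) / 2))
        \<longlonglongrightarrow> ((\<integral>x. (w t x)\<^sup>2 \<partial>I01) - (\<integral>x. (w s x)\<^sup>2 \<partial>I01)) / 2"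
      by (simp only: sum_subtractf[symmetric] sum_divide_distrib right_diff_distrib[symmetric] times_divide_eq_right)
  qed
qed

text \<open>Fubini's theorem on the plane; the work lies in passing from \<open>lborel\<close>
  slices to Lebesgue integrals over the unit interval. Positivity of \<open>s\<close> keeps the
  times inside \<open>{0<..T}\<close>.\<close>

lemma time_slices_integrable:
  fixes g :: "real \<Rightarrow> real \<Rightarrow> real"
  assumes int: "set_integrable lborel ({0..1} \<times> {0<..T}) (\<lambda>(x, t). g x t)"
    and s: "0 < s"
  shows "(\<lambda>t. \<integral>x. g x t \<partial>I01) integrable_on {s..T}"
proof -
  define h where "h = (\<lambda>x t. indicator ({0..1} \<times> {0<..T}) (x, t) * g x t)"
  have h: "integrable (lborel \<Otimes>\<^sub>M lborel) (case_prod h)"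
    using int by (simp add: set_integrable_def lborel_prod h_def case_prod_beta' cong: if_cong)
  have "integrable lborel (\<lambda>t. \<integral>x. h x t \<partial>lborel)"
    by (rule lborel_pair.integrable_snd[OF h])
  then have "(\<lambda>t. \<integral>x. h x t \<partial>lborel) integrable_on {s..T}"
    by (meson integrable_on_lborel integrable_on_subinterval subset_UNIV)
  moreover have "(\<integral>x. h x t \<partial>lborel) = (\<integral>x. g x t \<partial>I01)" if t: "t \<in> {s..T}" for t
  proof -
    have [measurable]: "case_prod h \<in> borel_measurable (lborel \<Otimes>\<^sub>M lborel)"
      using h by (rule borel_measurable_integrable)
    have hm: "(\<lambda>x. h x t) \<in> borel_measurable lborel" by measurable
    have "(\<integral>x. g x t \<partial>I01) = (\<integral>x. indicator {0..1} x *\<^sub>R g x t \<partial>lebesgue)"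
      by (subst integral_restrict_space) auto
    also have "\<dots> = (\<integral>x. h x t \<partial>lebesgue)"
      using t s by (intro Bochner_Integration.integral_cong) (auto simp: h_def indicator_def)
    also have "\<dots> = (\<integral>x. h x t \<partial>lborel)"
      by (rule integral_completion[OF hm])
    finally show ?thesis by simp
  qed
  ultimately show ?thesis by (rule integrable_eq)
qed

text \<open>Here \<open>X\<close>, \<open>Y\<close> and \<open>q\<close> stand for the squared norms
  of \<open>w'\<close> and \<open>w\<close> and for the square of \<open>w 0\<close>. The last
  premise is the Poincare inequality with free parameter; the lemma optimises over it, and the
  condition on \<open>\<kappa>\<close> is exactly \<open>\<Lambda> < L\<close> for the
  \<open>L\<close> of the proof.\<close>

lemma coercivity_constant:
  fixes \<theta>m \<Lambda> \<kappa> :: real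
  assumes "0 < \<theta>m" "0 \<le> \<Lambda>" "\<Lambda> < pi\<^sup>2 / 4 * \<theta>m" and \<kappa>: "\<Lambda> * pi\<^sup>2 / (\<theta>m * pi\<^sup>2 - 4 * \<Lambda>) < \<kappa>"
  obtains c where "0 < c"
    "\<And>X Y q. 0 \<le> X \<Longrightarrow> 0 \<le> Y \<Longrightarrow> 0 \<le> q \<Longrightarrow> (\<And>r. 1 < r \<Longrightarrow> Y \<le> r * (4 / pi\<^sup>2) * X + r / (r - 1) * q)
      \<Longrightarrow> - \<theta>m * X + \<Lambda> * Y - \<theta>m * \<kappa> * q \<le> - c * (X + Y)"
proof -
  have d: "0 < \<theta>m * pi\<^sup>2 - 4 * \<Lambda>" using assms by (simp add: field_simps)
  have k0: "0 < \<kappa>" using \<kappa> d assms(2) by (smt (verit) divide_nonneg_pos mult_nonneg_nonneg zero_le_power2)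
  \<comment> \<open>The largest coefficient \<open>\<mu>\<close> for which the choice of
    \<open>r\<close> below gives
    \<open>\<mu> * Y \<le> \<theta>m * X + \<theta>m * \<kappa> * q\<close>.\<close>
  define L where "L = \<kappa> * \<theta>m * pi\<^sup>2 / (pi\<^sup>2 + 4 * \<kappa>)"
  have pk: "0 < pi\<^sup>2 + 4 * \<kappa>" using k0 by (simp add: add_pos_pos)
  have "\<Lambda> * pi\<^sup>2 < \<kappa> * (\<theta>m * pi\<^sup>2 - 4 * \<Lambda>)"
    using \<kappa> d by (simp add: divide_less_eq)
  then have "\<Lambda> < L" using pk by (simp add: L_def pos_less_divide_eq algebra_simps)
  then obtain \<mu> where \<mu>: "\<Lambda> < \<mu>" "\<mu> < L" using dense by blast
  have m0: "0 < \<mu>" using \<mu> assms by simp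
  have "\<mu> * (pi\<^sup>2 + 4 * \<kappa>) < \<kappa> * \<theta>m * pi\<^sup>2"
    using \<mu>(2) pk by (simp add: L_def pos_less_divide_eq)
  then have m1: "\<mu> * pi\<^sup>2 < \<kappa> * (\<theta>m * pi\<^sup>2 - 4 * \<mu>)" by (simp add: algebra_simps)
  then have "0 < \<kappa> * (\<theta>m * pi\<^sup>2 - 4 * \<mu>)"
    using m0 by (smt (verit) mult_pos_pos pi_gt_zero zero_less_power)
  then have m2: "0 < \<theta>m * pi\<^sup>2 - 4 * \<mu>" using k0 by (simp add: zero_less_mult_iff)
  \<comment> \<open>Chosen so that the coefficient of \<open>X\<close> in \<open>\<mu>\<close> times
    the Poincare bound is exactly \<open>\<theta>m\<close>; the coefficient of \<open>q\<close> is
    then admissible because \<open>\<mu> < L\<close>.\<close>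
  define r where "r = \<theta>m * pi\<^sup>2 / (4 * \<mu>)"
  have r1: "1 < r" using m2 m0 by (simp add: r_def)
  have rr: "\<mu> * (r * (4 / pi\<^sup>2)) = \<theta>m" "r / (r - 1) = \<theta>m * pi\<^sup>2 / (\<theta>m * pi\<^sup>2 - 4 * \<mu>)"
    using m0 m2 by (simp_all add: r_def field_simps)
  have rk: "\<mu> * (r / (r - 1)) \<le> \<theta>m * \<kappa>"
  proof -
    have "\<theta>m * (\<mu> * pi\<^sup>2) \<le> \<theta>m * (\<kappa> * (\<theta>m * pi\<^sup>2 - 4 * \<mu>))"
      using m1 assms(1) by (intro mult_left_mono) auto
    then show ?thesis unfolding rr(2) using m2 by (simp add: pos_divide_le_eq mult_ac)
  qed
  \<comment> \<open>The fraction of the dissipation left after the reaction term has consumed its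
    share; it is positive because of the gap between \<open>\<Lambda>\<close> and
    \<open>\<mu>\<close>.\<close>
  define \<eta> where "\<eta> = 1 - \<Lambda> / \<mu>"
  have \<eta>: "0 < \<eta>" using \<mu> m0 by (simp add: \<eta>_def)
  show ?thesis
  proof (rule that)
    show "0 < \<eta> * min \<theta>m \<mu> / 2" using \<eta> m0 assms by simp
    fix X Y q :: real
    assume *: "0 \<le> X" "0 \<le> Y" "0 \<le> q" "\<And>r. 1 < r \<Longrightarrow> Y \<le> r * (4 / pi\<^sup>2) * X + r / (r - 1) * q"
    define S where "S = \<theta>m * X + \<theta>m * \<kappa> * q"
    have "\<mu> * Y \<le> \<mu> * (r * (4 / pi\<^sup>2) * X + r / (r - 1) * q)"
      using *(4)[OF r1] m0 by (intro mult_left_mono) auto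
    also have "\<dots> = (\<mu> * (r * (4 / pi\<^sup>2))) * X + \<mu> * (r / (r - 1)) * q" by (simp add: distrib_left mult_ac)
    also have "\<dots> \<le> \<theta>m * X + \<theta>m * \<kappa> * q"
      unfolding rr(1) using mult_right_mono[OF rk *(3)] by simp
    finally have S1: "\<mu> * Y \<le> S" by (simp add: S_def)
    have S2: "\<theta>m * X \<le> S" using * k0 assms by (simp add: S_def)
    have "\<Lambda> * Y = \<Lambda> / \<mu> * (\<mu> * Y)" using m0 by simp
    also have "\<dots> \<le> \<Lambda> / \<mu> * S" using S1 m0 assms by (intro mult_left_mono) auto
    finally have "- \<theta>m * X + \<Lambda> * Y - \<theta>m * \<kappa> * q \<le> - (\<eta> * S)"
      by (simp add: S_def \<eta>_def algebra_simps)
    also have "\<dots> \<le> - (\<eta> * ((min \<theta>m \<mu> * X + min \<theta>m \<mu> * Y) / 2))"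
    proof -
      have "min \<theta>m \<mu> * X \<le> S" "min \<theta>m \<mu> * Y \<le> S"
        using S1 S2 mult_right_mono[OF min.cobounded1 *(1), of \<theta>m \<mu>] mult_right_mono[OF min.cobounded2 *(2), of \<theta>m \<mu>]
        by linarith+
      then show ?thesis using \<eta> by (simp add: mult_left_mono)
    qed
    also have "\<dots> = - (\<eta> * min \<theta>m \<mu> / 2) * (X + Y)" by (simp add: algebra_simps)
    finally show "- \<theta>m * X + \<Lambda> * Y - \<theta>m * \<kappa> * q \<le> - (\<eta> * min \<theta>m \<mu> / 2) * (X + Y)" .
  qed
qed

section \<open>Scalar differential inequalities in integral form\<close>

lemma has_integral_le_const:
  fixes Q :: "real \<Rightarrow> real"
  assumes "(Q has_integral v) {s..t}" "s \<le> t" "\<And>\<sigma>. \<sigma> \<in> {s..t} \<Longrightarrow> Q \<sigma> \<le> K"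
  shows "v \<le> K * (t - s)"
  using has_integral_le[OF assms(1) has_integral_const_real[of K s t]] assms by (simp add: mult.commute)

text \<open>Above the level \<open>L = D / c + 1\<close> the function \<open>V\<close> falls at rate
  at least \<open>c\<close>, so starting from at most \<open>R\<close> it reaches \<open>L\<close>
  within time \<open>R / c\<close>, and it cannot climb above \<open>L\<close> again. Only
  increments of \<open>V\<close> are available, so this is argued on intervals instead of with
  derivatives.\<close>

lemma ultimate_bound:
  fixes V Q :: "real \<Rightarrow> real"
  assumes c: "0 < c" and D: "0 \<le> D" and R: "0 \<le> R"
    and V0: "\<And>t. 0 < t \<Longrightarrow> 0 \<le> V t"
    and Q: "\<And>s t. 0 < s \<Longrightarrow> s \<le> t \<Longrightarrow> (Q has_integral V t - V s) {s..t}"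
    and le: "\<And>t. 0 < t \<Longrightarrow> Q t \<le> D - c * V t"
    and \<tau>: "0 < \<tau>" "\<tau> \<le> 1" "V \<tau> \<le> R"
    and t: "1 + R / c \<le> t"
  shows "V t \<le> D / c + 1"
proof -
  \<comment> \<open>The additional 1 above the equilibrium level \<open>D / c\<close> turns decay
    into decrease at a uniform rate, hence a finite entry time.\<close>
  define L where "L = D / c + 1"
  have L0: "1 \<le> L" using c D by (simp add: L_def)
  have cL: "D - c * L = - c" using c by (simp add: L_def field_simps)
  have dec: "V y - V x \<le> - c * (y - x)" if "0 < x" "x \<le> y" "\<And>\<sigma>. \<sigma> \<in> {x..y} \<Longrightarrow> L \<le> V \<sigma>" for x y
  proof (rule has_integral_le_const[OF Q])
    fix \<sigma> assume \<sigma>: "\<sigma> \<in> {x..y}"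
    have "Q \<sigma> \<le> D - c * V \<sigma>" using that \<sigma> by (intro le) auto
    also have "\<dots> \<le> D - c * L" using that(3)[OF \<sigma>] c by simp
    finally show "Q \<sigma> \<le> - c" using cL by simp
  qed (use that in auto)
  have cont: "continuous_on {x..y} V" if "0 < x" for x y
    by (rule has_integral_imp_continuous_on[of x y Q]) (use that Q in auto)
  have "\<exists>x\<in>{\<tau>..\<tau> + R / c}. V x \<le> L"
  proof (rule ccontr)
    assume "\<not> ?thesis"
    then have n: "\<And>\<sigma>. \<sigma> \<in> {\<tau>..\<tau> + R / c} \<Longrightarrow> L < V \<sigma>" by (meson not_le)
    then have "V (\<tau> + R / c) - V \<tau> \<le> - c * (\<tau> + R / c - \<tau>)"
      using c R \<tau> by (intro dec) (auto intro: less_imp_le)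
    then have "V (\<tau> + R / c) \<le> 0" using \<tau> c by simp
    then show False using n[of "\<tau> + R / c"] L0 c R by simp
  qed
  then obtain x where x: "\<tau> \<le> x" "x \<le> t" "V x \<le> L" using t \<tau>(2) by force
  show ?thesis
  proof (rule ccontr)
    assume "\<not> ?thesis"
    then have Vt: "L < V t" by (simp add: L_def)
    have x0: "0 < x" using x \<tau> by simp
    \<comment> \<open>The supremum of \<open>S\<close> is the last time before \<open>t\<close> at
      which \<open>V\<close> is at most \<open>L\<close>.\<close>
    define S where "S = {y \<in> {x..t}. V y \<le> L}"
    have "closed S" unfolding S_def
      using continuous_closed_preimage[OF cont[OF x0] closed_atLeastAtMost closed_atMost[of L], of t]
      by (simp add: vimage_def Int_def)
    moreover have S: "x \<in> S" "bdd_above S" using x by (auto simp: S_def)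
    ultimately have m: "Sup S \<in> S" by (intro closed_contains_Sup) auto
    define m where "m = Sup S"
    have ms: "m \<in> {x..t}" "V m \<le> L" using m by (auto simp: m_def S_def)
    have after: "L < V y" if "m < y" "y \<le> t" for y
    proof (rule ccontr)
      assume "\<not> L < V y"
      then have "y \<in> S" using that ms by (auto simp: S_def)
      then show False using cSup_upper[OF _ S(2)] that by (fastforce simp: m_def)
    qed
    \<comment> \<open>A value strictly between \<open>L\<close> and \<open>V t\<close> puts
      \<open>y\<close> strictly after that last time, so \<open>V\<close> exceeds \<open>L\<close>
      on all of \<open>{y..t}\<close>.\<close>
    obtain y where y: "m \<le> y" "y \<le> t" "V y = (L + V t) / 2"
      using IVT'[of V m "(L + V t) / 2" t] cont[of m t] ms Vt x0 by auto
    have "m < y" using y ms Vt by (cases "m = y") auto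
    then have "V t - V y \<le> - c * (t - y)"
      using y ms x0 after by (intro dec) (auto intro: less_imp_le)
    also have "\<dots> \<le> 0" using c y by simp
    finally show False using y Vt by simp
  qed
qed

text \<open>A one-sided Barbalat argument. Only the growth of \<open>W\<close> is limited, so one
  looks backwards: a large value at \<open>t\<close> forces large values shortly before
  \<open>t\<close>, which costs \<open>V\<close> a fixed amount. That is impossible once
  \<open>V\<close> is close to its infimum.\<close>

lemma tendsto_zero_of_finite_energy:
  fixes V W :: "real \<Rightarrow> real"
  assumes c: "0 < c" and C: "0 < C"
    and W0: "\<And>t. 0 < t \<Longrightarrow> 0 \<le> W t" and V0: "\<And>t. 0 < t \<Longrightarrow> 0 \<le> V t"
    and W: "\<And>s t. 0 < s \<Longrightarrow> s \<le> t \<Longrightarrow> W t - W s \<le> C * (t - s)"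
    and Wi: "\<And>s t. 0 < s \<Longrightarrow> W integrable_on {s..t}"
    and V: "\<And>s t. 0 < s \<Longrightarrow> s \<le> t \<Longrightarrow> c * integral {s..t} W \<le> V s - V t"
  shows "(W \<longlongrightarrow> 0) at_top"
proof (rule tendstoI)
  fix e :: real assume e: "0 < e"
  \<comment> \<open>Within time \<open>h\<close> the growth of \<open>W\<close> is at most
    \<open>e / 2\<close>. A value of at least \<open>e\<close> therefore costs \<open>V\<close> at
    least \<open>c * h * e / 2\<close>, and \<open>d\<close> is half of that.\<close>
  define h where "h = e / (2 * C)"
  have h: "0 < h" using e C by (simp add: h_def)
  define d where "d = c * h * e / 4"
  have d: "0 < d" using c h e by (simp add: d_def)
  define L where "L = Inf (V ` {0<..})"
  have bb: "bdd_below (V ` {0<..})" using V0 by (auto intro!: bdd_belowI[of _ 0])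
  have ne: "V ` {0<..} \<noteq> {}" by (metis empty_is_image greaterThan_non_empty)
  have L: "L \<le> V t" if "0 < t" for t unfolding L_def using that by (intro cInf_lower bb) auto
  obtain T where T: "0 < T" "V T < L + d"
    using cInf_lessD[OF ne, of "L + d"] d by (auto simp: L_def)
  have "\<forall>t\<ge>T + h. dist (W t) 0 < e"
  proof (intro allI impI)
    fix t assume t: "T + h \<le> t"
    show "dist (W t) 0 < e"
    proof (rule ccontr)
      assume "\<not> ?thesis"
      then have We: "e \<le> W t" using W0[of t] t T h by (simp add: dist_real_def)
      have s: "0 < t - h" "T \<le> t - h" using t T by auto
      have "e / 2 \<le> W \<sigma>" if "\<sigma> \<in> {t - h..t}" for \<sigma>
      proof -
        have "W t - W \<sigma> \<le> C * (t - \<sigma>)" using that s by (intro W) auto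
        also have "\<dots> \<le> C * h" using that C by (intro mult_left_mono) auto
        finally show ?thesis using We C by (simp add: h_def)
      qed
      then have "integral {t - h..t} (\<lambda>_. e / 2) \<le> integral {t - h..t} W"
        using Wi[OF s(1)] by (intro integral_le) auto
      then have "c * (h * e / 2) \<le> c * integral {t - h..t} W" using c h by (intro mult_left_mono) auto
      also have "\<dots> \<le> V (t - h) - V t" using s h by (intro V) auto
      also have "\<dots> \<le> V T - L"
      proof -
        have "0 \<le> c * integral {T..t - h} W"
          using c Wi[OF T(1)] W0 T by (intro mult_nonneg_nonneg integral_nonneg) auto
        also have "\<dots> \<le> V T - V (t - h)" using T s by (intro V) auto
        finally show ?thesis using L[of t] s h by simp
      qed
      also have "\<dots> < d" using T by simp
      finally show False using c h e by (simp add: d_def)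
    qed
  qed
  then show "\<forall>\<^sub>F t in at_top. dist (W t) 0 < e" by (auto simp: eventually_at_top_linorder)
qed

subsection \<open>The closed loop\<close>

text \<open>The boundary fluxes \<open>g 0\<close> and \<open>g 1\<close> multiply traces of the
  test function. \<open>H1_boundary_values\<close> distributes them over the coefficients of
  \<open>\<phi>'\<close> and \<open>\<phi>\<close>, giving the shape that
  \<open>energy_identity\<close> expects.\<close>

lemma weak_rhs_eq_functional:
  fixes a b v :: "nat \<Rightarrow> real"
  assumes \<theta>: "continuous_on {0..1} \<theta>"
    and lam: "lam \<in> borel_measurable I01" "\<And>x. x \<in> {0..1} \<Longrightarrow> \<bar>lam x\<bar> \<le> \<Lambda>"
    and w: "H1 w w'" and \<phi>: "H1 \<phi> \<phi>'"
  defines "g \<equiv> \<lambda>i. \<theta> (real i) * ((v i - a i * w (real i)) / b i)"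
  shows "weak_rhs \<theta> lam a b w w' v \<phi> \<phi>'
    = (\<integral>x. (- \<theta> x * w' x + (g 1 * x - g 0 * (1 - x))) * \<phi>' x \<partial>I01)
      + (\<integral>x. (lam x * w x + (g 0 + g 1)) * \<phi> x \<partial>I01)"
proof -
  have x: "L2 (\<lambda>x. x)" "L2 (\<lambda>x. 1 - x)" by (intro L2_continuous continuous_intros)+
  note [simp] = L2_mult_integrable[OF L2_continuous_mult[OF \<theta> H1_L2_deriv[OF w]] H1_L2_deriv[OF \<phi>]]
    L2_mult_integrable[OF L2_bounded_mult[OF lam H1_L2[OF w]] H1_L2[OF \<phi>]]
    L2_mult_integrable[OF x(1) H1_L2_deriv[OF \<phi>]] L2_mult_integrable[OF x(2) H1_L2_deriv[OF \<phi>]]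
    L2_integrable[OF H1_L2[OF \<phi>]]
  have "(\<integral>x. (- \<theta> x * w' x + (g 1 * x - g 0 * (1 - x))) * \<phi>' x \<partial>I01)
    = (\<integral>x. (g 1 * (x * \<phi>' x) - g 0 * ((1 - x) * \<phi>' x)) - \<theta> x * w' x * \<phi>' x \<partial>I01)"
    by (intro Bochner_Integration.integral_cong) (auto simp: algebra_simps)
  also have "\<dots> = g 1 * (\<integral>x. x * \<phi>' x \<partial>I01) - g 0 * (\<integral>x. (1 - x) * \<phi>' x \<partial>I01)
      - (\<integral>x. \<theta> x * w' x * \<phi>' x \<partial>I01)"
    by simp
  moreover have "(\<integral>x. (lam x * w x + (g 0 + g 1)) * \<phi> x \<partial>I01)
    = (\<integral>x. lam x * w x * \<phi> x + (g 0 + g 1) * \<phi> x \<partial>I01)"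
    by (intro Bochner_Integration.integral_cong) (auto simp: algebra_simps)
  moreover have "(\<integral>x. lam x * w x * \<phi> x + (g 0 + g 1) * \<phi> x \<partial>I01)
    = (\<integral>x. lam x * w x * \<phi> x \<partial>I01) + (g 0 + g 1) * (\<integral>x. \<phi> x \<partial>I01)"
    using L2_mult_integrable[OF L2_bounded_mult[OF lam H1_L2[OF w]] H1_L2[OF \<phi>]]
      L2_integrable[OF L2_cmult[OF H1_L2[OF \<phi>], of "g 0 + g 1"]]
    by (subst Bochner_Integration.integral_add) simp_all
  moreover have "(\<Sum>i\<in>{0,1}. \<theta> (real i) * \<phi> (real i) * ((v i - a i * w (real i)) / b i))
      = g 0 * \<phi> 0 + g 1 * \<phi> 1"
    by (simp add: g_def mult_ac)
  ultimately show ?thesis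
    unfolding weak_rhs_def L2_inner_def H1_boundary_values[OF \<phi>] by (simp add: algebra_simps)
qed

lemma square_sum3_le:
  fixes p q r :: real
  assumes "p\<^sup>2 \<le> P" "q\<^sup>2 \<le> Q" "r\<^sup>2 \<le> R"
  shows "(p + (q - r))\<^sup>2 \<le> 3 * (P + Q + R)"
proof -
  have "0 \<le> (p - q)\<^sup>2 + (p + r)\<^sup>2 + (q + r)\<^sup>2" by simp
  then have "(p + (q - r))\<^sup>2 \<le> 3 * (p\<^sup>2 + q\<^sup>2 + r\<^sup>2)" by (simp add: power2_eq_square algebra_simps)
  also have "\<dots> \<le> 3 * (P + Q + R)" using assms by simp
  finally show ?thesis .
qed

text \<open>Supplies the integrable majorant in \<open>energy_identity\<close>; \<open>p\<close> and
  \<open>q\<close> are the boundary fluxes at 1 and 0.\<close>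

lemma weak_rhs_coefficient_bounds:
  assumes \<theta>: "continuous_on {0..1} \<theta>" "\<And>x. x \<in> {0..1} \<Longrightarrow> \<bar>\<theta> x\<bar> \<le> \<Theta>"
    and lam: "lam \<in> borel_measurable I01" "\<And>x. x \<in> {0..1} \<Longrightarrow> \<bar>lam x\<bar> \<le> \<Lambda>"
    and w: "H1 w w'"
  shows "L2 (\<lambda>x. - \<theta> x * w' x + (p * x - q * (1 - x)))" (is "L2 ?A")
    and "L2 (\<lambda>x. lam x * w x + (q + p))" (is "L2 ?B")
    and "(\<integral>x. (- \<theta> x * w' x + (p * x - q * (1 - x)))\<^sup>2 \<partial>I01) \<le> 3 * (\<Theta>\<^sup>2 * (\<integral>x. (w' x)\<^sup>2 \<partial>I01) + p\<^sup>2 + q\<^sup>2)"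
    and "(\<integral>x. (lam x * w x + (q + p))\<^sup>2 \<partial>I01) \<le> 3 * (\<Lambda>\<^sup>2 * (\<integral>x. (w x)\<^sup>2 \<partial>I01) + p\<^sup>2 + q\<^sup>2)"
proof -
  interpret finite_measure I01 by (rule finite_measure_I01)
  have "L2 (\<lambda>x. - (\<theta> x * w' x))" by (intro L2_minus L2_continuous_mult \<theta> H1_L2_deriv[OF w])
  moreover have "L2 (\<lambda>x. p * x - q * (1 - x))" by (intro L2_continuous continuous_intros)
  ultimately show A: "L2 ?A" using L2_add by fastforce
  show B: "L2 ?B" by (intro L2_add L2_const L2_bounded_mult[OF lam] H1_L2[OF w])
  have "(\<integral>x. (?A x)\<^sup>2 \<partial>I01) \<le> (\<integral>x. 3 * (\<Theta>\<^sup>2 * (w' x)\<^sup>2 + p\<^sup>2 + q\<^sup>2) \<partial>I01)"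
  proof (rule integral_mono)
    fix x assume "x \<in> space I01"
    then have x: "x \<in> {0..1}" by simp
    have "(\<theta> x)\<^sup>2 \<le> \<Theta>\<^sup>2" using power_mono[OF \<theta>(2)[OF x], of 2] by simp
    then have "(- \<theta> x * w' x)\<^sup>2 \<le> \<Theta>\<^sup>2 * (w' x)\<^sup>2" by (simp add: power_mult_distrib mult_right_mono)
    moreover have "(p * x)\<^sup>2 \<le> p\<^sup>2" "(q * (1 - x))\<^sup>2 \<le> q\<^sup>2"
      using x by (auto simp: power_mult_distrib abs_square_le_1 intro!: mult_left_le)
    ultimately show "(?A x)\<^sup>2 \<le> 3 * (\<Theta>\<^sup>2 * (w' x)\<^sup>2 + p\<^sup>2 + q\<^sup>2)"
      by (rule square_sum3_le)
  qed (use L2D(2)[OF A] L2D(2)[OF H1_L2_deriv[OF w]] in auto)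
  also have "\<dots> = 3 * (\<Theta>\<^sup>2 * (\<integral>x. (w' x)\<^sup>2 \<partial>I01) + p\<^sup>2 + q\<^sup>2)"
    using L2D(2)[OF H1_L2_deriv[OF w]] by simp
  finally show "(\<integral>x. (?A x)\<^sup>2 \<partial>I01) \<le> 3 * (\<Theta>\<^sup>2 * (\<integral>x. (w' x)\<^sup>2 \<partial>I01) + p\<^sup>2 + q\<^sup>2)" .
  have "(\<integral>x. (?B x)\<^sup>2 \<partial>I01) \<le> (\<integral>x. 3 * (\<Lambda>\<^sup>2 * (w x)\<^sup>2 + p\<^sup>2 + q\<^sup>2) \<partial>I01)"
  proof (rule integral_mono)
    fix x assume "x \<in> space I01"
    then have x: "x \<in> {0..1}" by simp
    have "(lam x)\<^sup>2 \<le> \<Lambda>\<^sup>2" using power_mono[OF lam(2)[OF x], of 2] by simp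
    then have "(lam x * w x)\<^sup>2 \<le> \<Lambda>\<^sup>2 * (w x)\<^sup>2" by (simp add: power_mult_distrib mult_right_mono)
    then show "(?B x)\<^sup>2 \<le> 3 * (\<Lambda>\<^sup>2 * (w x)\<^sup>2 + p\<^sup>2 + q\<^sup>2)"
      using square_sum3_le[of "lam x * w x" "\<Lambda>\<^sup>2 * (w x)\<^sup>2" p "p\<^sup>2" "-q" "q\<^sup>2"] by (simp add: add.commute)
  qed (use L2D(2)[OF B] L2D(2)[OF H1_L2[OF w]] in auto)
  also have "\<dots> = 3 * (\<Lambda>\<^sup>2 * (\<integral>x. (w x)\<^sup>2 \<partial>I01) + p\<^sup>2 + q\<^sup>2)"
    using L2D(2)[OF H1_L2[OF w]] by simp
  finally show "(\<integral>x. (?B x)\<^sup>2 \<partial>I01) \<le> 3 * (\<Lambda>\<^sup>2 * (\<integral>x. (w x)\<^sup>2 \<partial>I01) + p\<^sup>2 + q\<^sup>2)" .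
qed

text \<open>The condition on \<open>k 0\<close> and the lower bound on \<open>\<theta>\<close> enter
  through \<open>coercive\<close>, with a constant \<open>c\<close> that can be fixed before any
  solution is chosen. At the other end the feedback only has to avoid injecting energy, hence
  \<open>k1\<close>.\<close>

locale closed_loop =
  fixes \<theta> lam :: "real \<Rightarrow> real" and a b k \<alpha> \<gamma> M0 \<Phi> :: "nat \<Rightarrow> real" and \<psi> :: "nat \<Rightarrow> real \<Rightarrow> real"
    and z0 :: "real \<Rightarrow> real" and z :: "real \<Rightarrow> real \<Rightarrow> real" and M :: "nat \<Rightarrow> real \<Rightarrow> real"
    and \<Theta> \<Lambda> c :: real
  assumes \<theta>: "continuous_on {0..1} \<theta>" "\<And>x. x \<in> {0..1} \<Longrightarrow> 0 < \<theta> x \<and> \<theta> x \<le> \<Theta>"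
    and lam_bound: "\<And>x. x \<in> {0..1} \<Longrightarrow> \<bar>lam x\<bar> \<le> \<Lambda>"
    and b_pos: "0 < b 0" "0 < b 1"
    and \<gamma>_pos: "0 < \<gamma> 0" "0 < \<gamma> 1"
    and \<psi>_bound: "\<And>i t. i \<in> {0,1} \<Longrightarrow> t \<ge> 0 \<Longrightarrow> \<bar>\<psi> i t\<bar> \<le> \<Phi> i"
    and c_pos: "0 < c"
    and coercive: "\<And>w w'. H1 w w' \<Longrightarrow>
      - L2_inner (\<lambda>x. \<theta> x * w' x) w' + L2_inner (\<lambda>x. lam x * w x) w - \<theta> 0 / b 0 * (k 0 + a 0) * (w 0)\<^sup>2
        \<le> - c * ((\<integral>x. (w x)\<^sup>2 \<partial>I01) + (\<integral>x. (w' x)\<^sup>2 \<partial>I01))"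
    and k1: "0 \<le> k 1 + a 1"
    and sol: "closed_loop_solution \<theta> lam a b k \<alpha> \<gamma> M0 \<psi> z0 z M"
begin

section \<open>Gains, initial data and energy balance of one solution\<close>

abbreviation Y :: "real \<Rightarrow> real" where "Y t \<equiv> \<integral>x. (z x t)\<^sup>2 \<partial>I01"

text \<open>The factor with which the boundary input at \<open>real i\<close> enters the energy
  balance.\<close>

definition \<omega> :: "nat \<Rightarrow> real" where "\<omega> i = \<theta> (real i) / b i"

lemma \<omega>_pos: "0 < \<omega> 0" "0 < \<omega> 1"
  using \<theta>(2)[of 0] \<theta>(2)[of 1] b_pos by (auto simp: \<omega>_def)

lemma lam_measurable: "lam \<in> borel_measurable I01"
  using sol unfolding closed_loop_solution_def by blast

definition M' :: "nat \<Rightarrow> real \<Rightarrow> real" where "M' i s = - \<alpha> i * M i s + \<gamma> i * \<bar>z (real i) s\<bar>"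

text \<open>The gain equation at time zero integrates over a single point, which forces the initial
  value.\<close>

lemma gain_0:
  assumes "i \<in> {0,1}"
  shows "M i 0 = M0 i"
proof -
  have "(M' i has_integral M i 0 - M0 i) {0..0}"
    using sol assms unfolding closed_loop_solution_def M'_def[abs_def] by blast
  from has_integral_unique[OF this[unfolded atLeastAtMost_singleton] has_integral_refl(2)] show ?thesis by simp
qed

lemma gain_has_integral:
  assumes "i \<in> {0,1}" "t \<ge> 0"
  shows "(M' i has_integral M i t - M i 0) {0..t}"
  using sol assms unfolding closed_loop_solution_def M'_def[abs_def] gain_0[OF assms(1)] by blast

lemma gain_continuous: "i \<in> {0,1} \<Longrightarrow> continuous_on {0..t} (M i)"
  by (rule has_integral_imp_continuous_on[of 0 t "M' i"]) (use gain_has_integral in auto)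

lemma gain_increment:
  assumes "i \<in> {0,1}" "0 \<le> s" "s \<le> t"
  shows "(M' i has_integral M i t - M i s) {s..t}"
  by (rule has_integral_increment[of 0 t]) (use assms gain_has_integral[OF assms(1)] in auto)

text \<open>\<open>M' i\<close> is a continuous function plus a nonnegative one, and a nonnegative
  gauge integrable function is absolutely integrable.\<close>

lemma gain_deriv_absolutely_integrable:
  assumes i: "i \<in> {0,1}" and s: "0 \<le> s"
  shows "M' i absolutely_integrable_on {s..t}"
proof (cases "s \<le> t")
  case True
  have "continuous_on {s..t} (\<lambda>\<sigma>. - \<alpha> i * M i \<sigma>)"
    using continuous_on_subset[OF gain_continuous[OF i, of t], of "{s..t}"] s
    by (intro continuous_intros) auto
  then have 1: "(\<lambda>\<sigma>. - \<alpha> i * M i \<sigma>) absolutely_integrable_on {s..t}"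
    by (rule absolutely_integrable_continuous_real)
  have "M' i integrable_on {s..t}" using gain_increment[OF i s True] by blast
  then have "(\<lambda>\<sigma>. M' i \<sigma> - (- \<alpha> i * M i \<sigma>)) integrable_on {s..t}"
    using 1 by (intro integrable_diff) (auto simp: absolutely_integrable_on_def)
  then have "(\<lambda>\<sigma>. \<gamma> i * \<bar>z (real i) \<sigma>\<bar>) absolutely_integrable_on {s..t}"
    using \<gamma>_pos i by (intro nonnegative_absolutely_integrable_1) (auto simp: M'_def)
  with 1 show ?thesis unfolding M'_def[abs_def] by (rule set_integral_add)
qed auto

lemma initial_state: "x \<in> {0..1} \<Longrightarrow> z x 0 = z0 x"
  using sol unfolding closed_loop_solution_def by blast

lemma initial_energy: "Y 0 = (\<integral>x. (z0 x)\<^sup>2 \<partial>I01)"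
  by (intro Bochner_Integration.integral_cong) (auto simp: initial_state)

lemma L2_state: "t \<ge> 0 \<Longrightarrow> L2 (\<lambda>x. z x t)"
  using sol unfolding closed_loop_solution_def by blast

text \<open>Continuity at time zero bounds the Lyapunov function shortly after the start by initial data.\<close>

lemma bounded_start:
  obtains \<tau> where "0 < \<tau>" "\<tau> \<le> 1" "Y \<tau> \<le> 2 * Y 0 + 2" "\<bar>M 0 \<tau> - M0 0\<bar> \<le> 1" "\<bar>M 1 \<tau> - M0 1\<bar> \<le> 1"
proof -
  have near: "\<forall>\<^sub>F s in at 0 within {0..}. \<bar>M i s - M0 i\<bar> \<le> 1" if i: "i \<in> {0,1}" for i
  proof -
    have "(M i \<longlongrightarrow> M i 0) (at 0 within {0..1})"
      using gain_continuous[OF i, of 1] by (auto simp: continuous_on_def)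
    moreover have "at 0 within {0..1} = at (0::real) within {0..}"
      by (rule at_within_nhd[of _ "{..<1}"]) auto
    ultimately have "\<forall>\<^sub>F s in at 0 within {0..}. dist (M i s) (M i 0) < 1"
      by (metis tendstoD zero_less_one)
    then show ?thesis by eventually_elim (simp add: gain_0[OF i] dist_real_def)
  qed
  have "((\<lambda>s. L2_norm (\<lambda>x. z x s - z x 0)) \<longlongrightarrow> 0) (at 0 within {0..})"
    using sol unfolding closed_loop_solution_def by auto
  then have n: "\<forall>\<^sub>F s in at 0 within {0..}. dist (L2_norm (\<lambda>x. z x s - z x 0)) 0 < 1"
    by (rule tendstoD) simp
  have p: "\<forall>\<^sub>F s in at (0::real) within {0..}. 0 < s \<and> s \<le> 1"
    by (auto simp: eventually_at dist_real_def intro!: exI[of _ 1])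
  then have "\<forall>\<^sub>F s in at 0 within {0..}. (0 < s \<and> s \<le> 1)
      \<and> dist (L2_norm (\<lambda>x. z x s - z x 0)) 0 < 1 \<and> \<bar>M 0 s - M0 0\<bar> \<le> 1 \<and> \<bar>M 1 s - M0 1\<bar> \<le> 1"
    by (intro eventually_conj[OF p] eventually_conj[OF n] eventually_conj near) auto
  moreover have "at (0::real) within {0..} \<noteq> bot"
    by (simp add: at_within_Ici_at_right)
  ultimately have "\<exists>\<tau>. (0 < \<tau> \<and> \<tau> \<le> 1)
      \<and> dist (L2_norm (\<lambda>x. z x \<tau> - z x 0)) 0 < 1 \<and> \<bar>M 0 \<tau> - M0 0\<bar> \<le> 1 \<and> \<bar>M 1 \<tau> - M0 1\<bar> \<le> 1"
    by (rule eventually_happens'[rotated])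
  then obtain \<tau> where \<tau>: "0 < \<tau>" "\<tau> \<le> 1" "dist (L2_norm (\<lambda>x. z x \<tau> - z x 0)) 0 < 1"
    "\<bar>M 0 \<tau> - M0 0\<bar> \<le> 1" "\<bar>M 1 \<tau> - M0 1\<bar> \<le> 1"
    by blast
  have d: "L2 (\<lambda>x. z x \<tau> - z x 0)" using \<tau> by (intro L2_diff L2_state) auto
  have d1: "(\<integral>x. (z x \<tau> - z x 0)\<^sup>2 \<partial>I01) \<le> 1"
    using \<tau>(3) by (simp add: dist_real_def L2_norm_def)
  have "Y \<tau> \<le> (\<integral>x. 2 * (z x 0)\<^sup>2 + 2 * (z x \<tau> - z x 0)\<^sup>2 \<partial>I01)"
  proof (rule integral_mono)
    fix x
    have "0 \<le> (z x \<tau> - 2 * z x 0)\<^sup>2" by simp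
    then show "(z x \<tau>)\<^sup>2 \<le> 2 * (z x 0)\<^sup>2 + 2 * (z x \<tau> - z x 0)\<^sup>2"
      by (simp add: power2_eq_square algebra_simps)
  qed (use \<tau> L2D(2)[OF L2_state] L2D(2)[OF d] in auto)
  also have "\<dots> = 2 * Y 0 + 2 * (\<integral>x. (z x \<tau> - z x 0)\<^sup>2 \<partial>I01)"
    using \<tau> L2D(2)[OF L2_state[of 0]] L2D(2)[OF d] by simp
  finally show ?thesis using \<tau> d1 that by simp
qed

text \<open>Changing the input on a null set of times makes the Filippov inclusion hold for all positive times.\<close>

lemma weak_solution:
  obtains zx u where
    "\<And>t. 0 < t \<Longrightarrow> H1 (\<lambda>x. z x t) (\<lambda>x. zx x t)"
    "\<And>s t. 0 < s \<Longrightarrow> (\<lambda>t. Y t + (\<integral>x. (zx x t)\<^sup>2 \<partial>I01)) integrable_on {s..t}"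
    "\<And>i t. i \<in> {0,1} \<Longrightarrow> 0 < t \<Longrightarrow> \<exists>s\<in>Sign (z (real i) t). u i t = - k i * z (real i) t - M i t * s"
    "\<And>\<phi> \<phi>' s t. H1 \<phi> \<phi>' \<Longrightarrow> 0 < s \<Longrightarrow> s \<le> t \<Longrightarrow>
      ((\<lambda>\<sigma>. weak_rhs \<theta> lam a b (\<lambda>x. z x \<sigma>) (\<lambda>x. zx x \<sigma>) (\<lambda>i. u i \<sigma> + \<psi> i \<sigma>) \<phi> \<phi>') has_integral
        (\<integral>x. z x t * \<phi> x \<partial>I01) - (\<integral>x. z x s * \<phi> x \<partial>I01)) {s..t}"
proof -
  obtain zx u where
    "(\<forall>t>0. H1 (\<lambda>x. z x t) (\<lambda>x. zx x t)) \<and>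
      set_borel_measurable lborel ({0..1} \<times> {0<..}) (\<lambda>(x, t). z x t) \<and>
      set_borel_measurable lborel ({0..1} \<times> {0<..}) (\<lambda>(x, t). zx x t) \<and>
      (\<forall>T>0. set_integrable lborel ({0..1} \<times> {0<..T}) (\<lambda>(x, t). (z x t)\<^sup>2 + (zx x t)\<^sup>2)) \<and>
      (\<forall>i\<in>{0,1}. set_borel_measurable lebesgue {0..} (u i) \<and>
        (AE t in lebesgue. t > 0 \<longrightarrow>
          u i t \<in> {- k i * z (real i) t - M i t * s | s. s \<in> Sign (z (real i) t)})) \<and>
      (\<forall>\<phi> \<phi>'. H1 \<phi> \<phi>' \<longrightarrow>
        (\<forall>t\<ge>0. ((\<lambda>s. weak_rhs \<theta> lam a b (\<lambda>x. z x s) (\<lambda>x. zx x s) (\<lambda>i. u i s + \<psi> i s) \<phi> \<phi>')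
          has_integral (L2_inner (\<lambda>x. z x t) \<phi> - L2_inner z0 \<phi>)) {0..t}))"
    using sol unfolding closed_loop_solution_def by (elim conjE exE) (rule that, intro conjI)
  note zxu = this
  have H: "H1 (\<lambda>x. z x t) (\<lambda>x. zx x t)" if "0 < t" for t
    using zxu that by blast
  have int: "set_integrable lborel ({0..1} \<times> {0<..T}) (\<lambda>(x, t). (z x t)\<^sup>2 + (zx x t)\<^sup>2)" if "0 < T" for T
    using zxu that by blast
  have u: "AE t in lebesgue. t > 0 \<longrightarrow>
      u i t \<in> {- k i * z (real i) t - M i t * s | s. s \<in> Sign (z (real i) t)}" if "i \<in> {0,1}" for i
    using zxu that by blast
  have weak: "((\<lambda>s. weak_rhs \<theta> lam a b (\<lambda>x. z x s) (\<lambda>x. zx x s) (\<lambda>i. u i s + \<psi> i s) \<phi> \<phi>')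
      has_integral (L2_inner (\<lambda>x. z x t) \<phi> - L2_inner z0 \<phi>)) {0..t}" if "H1 \<phi> \<phi>'" "0 \<le> t" for \<phi> \<phi>' t
    using zxu that by blast
  have "\<exists>N. negligible N \<and> (\<forall>t. t \<notin> N \<longrightarrow> t > 0 \<longrightarrow>
      (\<exists>s\<in>Sign (z (real i) t). u i t = - k i * z (real i) t - M i t * s))" if "i \<in> {0,1}" for i
    using u[OF that] unfolding eventually_ae_filter_negligible by blast
  then obtain N0 N1 where N: "negligible N0" "negligible N1"
    and N0: "\<And>t. t \<notin> N0 \<Longrightarrow> t > 0 \<Longrightarrow> \<exists>s\<in>Sign (z (real 0) t). u 0 t = - k 0 * z (real 0) t - M 0 t * s"
    and N1: "\<And>t. t \<notin> N1 \<Longrightarrow> t > 0 \<Longrightarrow> \<exists>s\<in>Sign (z (real 1) t). u 1 t = - k 1 * z (real 1) t - M 1 t * s"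
    by (metis insertCI)
  define v where "v = (\<lambda>i t. if t \<in> N0 \<union> N1 then - k i * z (real i) t - M i t * sgn (z (real i) t) else u i t)"
  \<comment> \<open>Also on the sliding set, since \<open>sgn 0 = 0\<close> belongs to
    \<open>{-1..1}\<close>.\<close>
  have sgn: "sgn y \<in> Sign y" for y by (simp add: Sign_def)
  show ?thesis
  proof (rule that[of zx v])
    fix s t :: real assume s: "0 < s"
    show "(\<lambda>t. Y t + (\<integral>x. (zx x t)\<^sup>2 \<partial>I01)) integrable_on {s..t}"
    proof (cases "0 < t")
      case True
      have "Y \<sigma> + (\<integral>x. (zx x \<sigma>)\<^sup>2 \<partial>I01) = (\<integral>x. (z x \<sigma>)\<^sup>2 + (zx x \<sigma>)\<^sup>2 \<partial>I01)" if "\<sigma> \<in> {s..t}" for \<sigma>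
        using that s L2D(2)[OF H1_L2[OF H]] L2D(2)[OF H1_L2_deriv[OF H]] by simp
      then show ?thesis
        using integrable_eq[OF time_slices_integrable[OF int[OF True] s]] by simp
    qed (use s in auto)
  next
    fix i :: nat and t :: real assume "i \<in> {0,1}" "0 < t"
    then show "\<exists>s\<in>Sign (z (real i) t). v i t = - k i * z (real i) t - M i t * s"
      using N0[of t] N1[of t] sgn by (auto simp: v_def)
  next
    fix \<phi> \<phi>' and s t :: real assume \<phi>: "H1 \<phi> \<phi>'" and st: "0 < s" "s \<le> t"
    define F where "F = (\<lambda>t. L2_inner (\<lambda>x. z x t) \<phi>)"
    have F0: "F 0 = L2_inner z0 \<phi>"
      unfolding F_def L2_inner_def by (intro Bochner_Integration.integral_cong) (auto simp: initial_state)
    have "((\<lambda>s. weak_rhs \<theta> lam a b (\<lambda>x. z x s) (\<lambda>x. zx x s) (\<lambda>i. u i s + \<psi> i s) \<phi> \<phi>')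
              has_integral F t - F s) {s..t}"
    proof (rule has_integral_increment[of 0 t])
      fix x assume "x \<in> {0..t}"
      then show "((\<lambda>s. weak_rhs \<theta> lam a b (\<lambda>x. z x s) (\<lambda>x. zx x s) (\<lambda>i. u i s + \<psi> i s) \<phi> \<phi>')
              has_integral F x - F 0) {0..x}"
        using weak[OF \<phi>, of x] unfolding F0 unfolding F_def by simp
    qed (use st in auto)
    then show "((\<lambda>\<sigma>. weak_rhs \<theta> lam a b (\<lambda>x. z x \<sigma>) (\<lambda>x. zx x \<sigma>) (\<lambda>i. v i \<sigma> + \<psi> i \<sigma>) \<phi> \<phi>') has_integral
        (\<integral>x. z x t * \<phi> x \<partial>I01) - (\<integral>x. z x s * \<phi> x \<partial>I01)) {s..t}"
      unfolding F_def L2_inner_def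
      by (rule has_integral_spike[OF negligible_Un[OF N], rotated]) (simp add: v_def)
  qed (rule H)
qed

text \<open>\<open>P\<close> is the weak form tested with the state itself and \<open>N\<close> is
  the squared H1 norm. Existential \<open>P\<close> and \<open>N\<close> hide \<open>zx\<close> and
  \<open>u\<close> from the Lyapunov argument.\<close>

lemma dissipation:
  obtains P N where
    "\<And>t. 0 < t \<Longrightarrow> Y t \<le> N t"
    "\<And>i t. i \<in> {0,1} \<Longrightarrow> 0 < t \<Longrightarrow> (z (real i) t)\<^sup>2 \<le> 2 * N t"
    "\<And>s t. 0 < s \<Longrightarrow> s \<le> t \<Longrightarrow> (P has_integral (Y t - Y s) / 2) {s..t}"
    "\<And>t. 0 < t \<Longrightarrow> P t \<le> - c * N t + (\<Sum>i\<in>{0,1}. \<omega> i * (\<Phi> i - M i t) * \<bar>z (real i) t\<bar>)"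
proof -
  obtain zx u where H: "\<And>t. 0 < t \<Longrightarrow> H1 (\<lambda>x. z x t) (\<lambda>x. zx x t)"
    and Nint: "\<And>s t. 0 < s \<Longrightarrow> (\<lambda>t. Y t + (\<integral>x. (zx x t)\<^sup>2 \<partial>I01)) integrable_on {s..t}"
    and u: "\<And>i t. i \<in> {0,1} \<Longrightarrow> 0 < t \<Longrightarrow> \<exists>s\<in>Sign (z (real i) t). u i t = - k i * z (real i) t - M i t * s"
    and weak: "\<And>\<phi> \<phi>' s t. H1 \<phi> \<phi>' \<Longrightarrow> 0 < s \<Longrightarrow> s \<le> t \<Longrightarrow>
      ((\<lambda>\<sigma>. weak_rhs \<theta> lam a b (\<lambda>x. z x \<sigma>) (\<lambda>x. zx x \<sigma>) (\<lambda>i. u i \<sigma> + \<psi> i \<sigma>) \<phi> \<phi>') has_integral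
        (\<integral>x. z x t * \<phi> x \<partial>I01) - (\<integral>x. z x s * \<phi> x \<partial>I01)) {s..t}"
    by (rule weak_solution) blast
  define N where "N = (\<lambda>t. Y t + (\<integral>x. (zx x t)\<^sup>2 \<partial>I01))"
  define P where "P = (\<lambda>\<sigma>. weak_rhs \<theta> lam a b (\<lambda>x. z x \<sigma>) (\<lambda>x. zx x \<sigma>) (\<lambda>i. u i \<sigma> + \<psi> i \<sigma>) (\<lambda>x. z x \<sigma>) (\<lambda>x. zx x \<sigma>))"
  have sq0: "0 \<le> (\<integral>x. (h x)\<^sup>2 \<partial>I01)" for h :: "real \<Rightarrow> real"
    by (intro Bochner_Integration.integral_nonneg) auto
  have N0: "0 \<le> N t" for t using sq0 by (simp add: N_def)
  have trace: "(z (real i) t)\<^sup>2 \<le> 2 * N t" if "i \<in> {0,1}" "0 < t" for i t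
    using H1_trace[OF H[OF that(2)], of "real i"] that by (auto simp: N_def)
  define g where "g = (\<lambda>\<sigma> i. \<theta> (real i) * ((u i \<sigma> + \<psi> i \<sigma> - a i * z (real i) \<sigma>) / b i))"
  \<comment> \<open>The trace bound and the boundedness of the gains on compact time intervals
    control the flux. The constant may depend on the interval because it only serves to establish
    integrability.\<close>
  have g_bound: "\<exists>K\<ge>0. \<forall>\<sigma>\<in>{s..t}. (g \<sigma> i)\<^sup>2 \<le> K * (1 + N \<sigma>)" if i: "i \<in> {0,1}" and s: "0 < s" for i s t
  proof -
    obtain m where m: "\<And>\<sigma>. \<sigma> \<in> {s..t} \<Longrightarrow> \<bar>M i \<sigma>\<bar> \<le> m"
      using compact_imp_bounded[OF compact_continuous_image[OF gain_continuous[OF i, of t] compact_Icc]] s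
      by (force simp: bounded_iff)
    define p where "p = \<bar>k i\<bar> + \<bar>a i\<bar>"
    define K where "K = (\<omega> i)\<^sup>2 * (2 * (2 * p\<^sup>2 + (m + \<Phi> i)\<^sup>2))"
    have "(g \<sigma> i)\<^sup>2 \<le> K * (1 + N \<sigma>)" if \<sigma>: "\<sigma> \<in> {s..t}" for \<sigma>
    proof -
      have \<sigma>0: "0 < \<sigma>" using s \<sigma> by simp
      define y where "y = z (real i) \<sigma>"
      obtain r where r: "r \<in> Sign y" "u i \<sigma> = - k i * y - M i \<sigma> * r"
        using u[OF i \<sigma>0] unfolding y_def by blast
      have r1: "\<bar>r\<bar> \<le> 1" using r(1) by (auto simp: Sign_def sgn_if split: if_splits)
      have "\<bar>u i \<sigma> + \<psi> i \<sigma> - a i * y\<bar> \<le> \<bar>k i\<bar> * \<bar>y\<bar> + \<bar>M i \<sigma>\<bar> * \<bar>r\<bar> + \<bar>\<psi> i \<sigma>\<bar> + \<bar>a i\<bar> * \<bar>y\<bar>"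
        unfolding r(2) abs_mult[symmetric] by linarith
      also have "\<dots> \<le> \<bar>k i\<bar> * \<bar>y\<bar> + m * 1 + \<Phi> i + \<bar>a i\<bar> * \<bar>y\<bar>"
        using m[OF \<sigma>] r1 \<psi>_bound[OF i, of \<sigma>] \<sigma>0 by (intro add_mono mult_mono) auto
      also have "\<dots> = p * \<bar>y\<bar> + (m + \<Phi> i)" by (simp add: p_def algebra_simps)
      finally have "\<bar>u i \<sigma> + \<psi> i \<sigma> - a i * y\<bar>\<^sup>2 \<le> (p * \<bar>y\<bar> + (m + \<Phi> i))\<^sup>2"
        by (intro power_mono) auto
      also have "\<dots> \<le> 2 * (p\<^sup>2 * y\<^sup>2 + (m + \<Phi> i)\<^sup>2)"
        using two_mult_le_squares[of "p * \<bar>y\<bar>" "m + \<Phi> i"]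
        by (simp add: power2_sum power_mult_distrib abs_le_iff)
      also have "\<dots> \<le> 2 * (2 * p\<^sup>2 + (m + \<Phi> i)\<^sup>2) * (1 + N \<sigma>)"
      proof -
        have "p\<^sup>2 * y\<^sup>2 \<le> p\<^sup>2 * (2 * N \<sigma>)" unfolding y_def by (intro mult_left_mono trace i \<sigma>0) auto
        then have "p\<^sup>2 * y\<^sup>2 \<le> 2 * (p\<^sup>2 * N \<sigma>)" by simp
        moreover have "0 \<le> (m + \<Phi> i)\<^sup>2 * N \<sigma>" "0 \<le> p\<^sup>2" using N0 by auto
        moreover have "2 * (2 * p\<^sup>2 + (m + \<Phi> i)\<^sup>2) * (1 + N \<sigma>)
            = 4 * p\<^sup>2 + 4 * (p\<^sup>2 * N \<sigma>) + 2 * (m + \<Phi> i)\<^sup>2 + 2 * ((m + \<Phi> i)\<^sup>2 * N \<sigma>)"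
          by (simp add: distrib_left distrib_right mult.assoc)
        ultimately show ?thesis by argo
      qed
      finally have "(u i \<sigma> + \<psi> i \<sigma> - a i * y)\<^sup>2 \<le> 2 * (2 * p\<^sup>2 + (m + \<Phi> i)\<^sup>2) * (1 + N \<sigma>)" by simp
      then have "(\<omega> i)\<^sup>2 * (u i \<sigma> + \<psi> i \<sigma> - a i * y)\<^sup>2 \<le> (\<omega> i)\<^sup>2 * (2 * (2 * p\<^sup>2 + (m + \<Phi> i)\<^sup>2) * (1 + N \<sigma>))"
        by (rule mult_left_mono) simp
      moreover have "g \<sigma> i = \<omega> i * (u i \<sigma> + \<psi> i \<sigma> - a i * y)" by (simp add: g_def \<omega>_def y_def)
      ultimately show ?thesis by (simp add: K_def power_mult_distrib mult.assoc)
    qed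
    moreover have "0 \<le> K" by (simp add: K_def)
    ultimately show ?thesis by blast
  qed
  have \<theta>_abs: "\<bar>\<theta> x\<bar> \<le> \<Theta>" if "x \<in> {0..1}" for x using \<theta>(2)[OF that] by simp
  define A where "A = (\<lambda>\<sigma> x. - \<theta> x * zx x \<sigma> + (g \<sigma> 1 * x - g \<sigma> 0 * (1 - x)))"
  define B where "B = (\<lambda>\<sigma> x. lam x * z x \<sigma> + (g \<sigma> 0 + g \<sigma> 1))"
  have rep: "weak_rhs \<theta> lam a b (\<lambda>x. z x \<sigma>) (\<lambda>x. zx x \<sigma>) (\<lambda>i. u i \<sigma> + \<psi> i \<sigma>) \<phi> \<phi>'
      = (\<integral>x. A \<sigma> x * \<phi>' x \<partial>I01) + (\<integral>x. B \<sigma> x * \<phi> x \<partial>I01)" if "0 < \<sigma>" "H1 \<phi> \<phi>'" for \<sigma> \<phi> \<phi>'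
    using weak_rhs_eq_functional[OF \<theta>(1) lam_measurable lam_bound H[OF that(1)] that(2)]
    by (simp add: A_def B_def g_def)
  note coeff = weak_rhs_coefficient_bounds[OF \<theta>(1) \<theta>_abs lam_measurable lam_bound H]
  have AB: "L2 (A \<sigma>)" "L2 (B \<sigma>)" if "0 < \<sigma>" for \<sigma>
    using coeff(1,2)[OF _ _ that] unfolding A_def B_def by blast+
  have P_int: "(P has_integral (Y t - Y s) / 2) {s..t}" if st: "0 < s" "s \<le> t" for s t
  proof -
    obtain K0 K1 where K: "0 \<le> K0" "0 \<le> K1"
      and K0: "\<And>\<sigma>. \<sigma> \<in> {s..t} \<Longrightarrow> (g \<sigma> 0)\<^sup>2 \<le> K0 * (1 + N \<sigma>)"
      and K1: "\<And>\<sigma>. \<sigma> \<in> {s..t} \<Longrightarrow> (g \<sigma> 1)\<^sup>2 \<le> K1 * (1 + N \<sigma>)"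
      using g_bound[of 0 s t] g_bound[of 1 s t] st by auto
    \<comment> \<open>Each squared flux occurs three times in either coefficient bound, hence the
      factors 6; the final 1 accounts for the H1 norm itself.\<close>
    define L where "L = 3 * \<Theta>\<^sup>2 + 3 * \<Lambda>\<^sup>2 + 6 * K0 + 6 * K1 + 1"
    have pos: "\<sigma> \<in> {s..t} \<Longrightarrow> 0 < \<sigma>" for \<sigma> using st by auto
    have "((\<lambda>\<sigma>. (\<integral>x. A \<sigma> x * zx x \<sigma> \<partial>I01) + (\<integral>x. B \<sigma> x * z x \<sigma> \<partial>I01)) has_integral (Y t - Y s) / 2) {s..t}"
    proof (rule energy_identity[where N = "\<lambda>\<sigma>. L * (1 + N \<sigma>)"])
      show "(\<lambda>\<sigma>. L * (1 + N \<sigma>)) integrable_on {s..t}"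
        using Nint[OF st(1), of t, folded N_def]
        by (intro integrable_on_mult_right integrable_add[of "\<lambda>_. 1" _ N]) (auto simp: N_def)
      fix \<sigma> assume \<sigma>: "\<sigma> \<in> {s..t}"
      note cb = coeff(3,4)[OF _ _ pos[OF \<sigma>], where p = "g \<sigma> 1" and q = "g \<sigma> 0"]
      have c3: "(\<integral>x. (A \<sigma> x)\<^sup>2 \<partial>I01) \<le> 3 * (\<Theta>\<^sup>2 * (\<integral>x. (zx x \<sigma>)\<^sup>2 \<partial>I01) + (g \<sigma> 1)\<^sup>2 + (g \<sigma> 0)\<^sup>2)"
        "(\<integral>x. (B \<sigma> x)\<^sup>2 \<partial>I01) \<le> 3 * (\<Lambda>\<^sup>2 * Y \<sigma> + (g \<sigma> 1)\<^sup>2 + (g \<sigma> 0)\<^sup>2)"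
        using cb unfolding A_def B_def by blast+
      have n: "(\<integral>x. (zx x \<sigma>)\<^sup>2 \<partial>I01) \<le> 1 + N \<sigma>" "Y \<sigma> \<le> 1 + N \<sigma>"
        using sq0[of "\<lambda>x. z x \<sigma>"] sq0[of "\<lambda>x. zx x \<sigma>"] by (auto simp: N_def)
      have c4: "\<Theta>\<^sup>2 * (\<integral>x. (zx x \<sigma>)\<^sup>2 \<partial>I01) \<le> \<Theta>\<^sup>2 * (1 + N \<sigma>)" "\<Lambda>\<^sup>2 * Y \<sigma> \<le> \<Lambda>\<^sup>2 * (1 + N \<sigma>)"
        using n by (auto intro!: mult_left_mono)
      have "(\<integral>x. (A \<sigma> x)\<^sup>2 \<partial>I01) + (\<integral>x. (B \<sigma> x)\<^sup>2 \<partial>I01) + Y \<sigma> + (\<integral>x. (zx x \<sigma>)\<^sup>2 \<partial>I01)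
        \<le> 3 * (\<Theta>\<^sup>2 * (1 + N \<sigma>)) + 3 * (\<Lambda>\<^sup>2 * (1 + N \<sigma>)) + 6 * (K0 * (1 + N \<sigma>)) + 6 * (K1 * (1 + N \<sigma>)) + N \<sigma>"
        using c3 c4 K0[OF \<sigma>] K1[OF \<sigma>] by (simp add: N_def)
      also have "\<dots> \<le> L * (1 + N \<sigma>)" by (simp add: L_def algebra_simps)
      finally show "(\<integral>x. (A \<sigma> x)\<^sup>2 \<partial>I01) + (\<integral>x. (B \<sigma> x)\<^sup>2 \<partial>I01) + Y \<sigma> + (\<integral>x. (zx x \<sigma>)\<^sup>2 \<partial>I01) \<le> L * (1 + N \<sigma>)" .
    next
      fix \<phi> \<phi>' \<tau> assume \<phi>: "H1 \<phi> \<phi>'" and \<tau>: "\<tau> \<in> {s..t}"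
      show "((\<lambda>\<sigma>. (\<integral>x. A \<sigma> x * \<phi>' x \<partial>I01) + (\<integral>x. B \<sigma> x * \<phi> x \<partial>I01)) has_integral
        ((\<integral>x. z x \<tau> * \<phi> x \<partial>I01) - (\<integral>x. z x s * \<phi> x \<partial>I01))) {s..\<tau>}"
        using has_integral_eq[OF _ weak[OF \<phi> st(1), of \<tau>]] rep[OF _ \<phi>] st \<tau> by auto
    qed (use st AB H in auto)
    then show ?thesis
      by (rule has_integral_eq[rotated]) (use st rep H in \<open>auto simp: P_def\<close>)
  qed
  have P_le: "P t \<le> - c * N t + (\<Sum>i\<in>{0,1}. \<omega> i * (\<Phi> i - M i t) * \<bar>z (real i) t\<bar>)" if t: "0 < t" for t
  proof -
    have flux: "\<theta> (real i) * z (real i) t * ((u i t + \<psi> i t - a i * z (real i) t) / b i)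
      \<le> - (\<omega> i * (k i + a i) * (z (real i) t)\<^sup>2) + \<omega> i * (\<Phi> i - M i t) * \<bar>z (real i) t\<bar>" if i: "i \<in> {0,1}" for i
    proof -
      define y where "y = z (real i) t"
      obtain r where r: "r \<in> Sign y" "u i t = - k i * y - M i t * r"
        using u[OF i t] unfolding y_def by blast
      \<comment> \<open>Every admissible selection yields the same product; for \<open>y = 0\<close>
        both sides vanish.\<close>
      have ry: "r * y = \<bar>y\<bar>" using r(1) by (auto simp: Sign_def sgn_if abs_if split: if_splits)
      have \<omega>0: "0 \<le> \<omega> i" using \<omega>_pos i by auto
      have "\<psi> i t * y \<le> \<Phi> i * \<bar>y\<bar>"
        using mult_right_mono[OF \<psi>_bound[OF i, of t], of "\<bar>y\<bar>"] t abs_ge_self[of "\<psi> i t * y"]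
        by (simp add: abs_mult)
      have "\<theta> (real i) * y * ((u i t + \<psi> i t - a i * y) / b i) = \<omega> i * (u i t * y + \<psi> i t * y - a i * y\<^sup>2)"
      proof -
        have "u i t * y + \<psi> i t * y - a i * y\<^sup>2 = (u i t + \<psi> i t - a i * y) * y"
          by (simp add: power2_eq_square algebra_simps)
        then show ?thesis by (simp add: \<omega>_def mult_ac)
      qed
      also have "u i t * y = - k i * y\<^sup>2 - M i t * \<bar>y\<bar>"
        by (simp add: r(2) ry[symmetric] power2_eq_square algebra_simps)
      also have "\<omega> i * (- k i * y\<^sup>2 - M i t * \<bar>y\<bar> + \<psi> i t * y - a i * y\<^sup>2)
          \<le> \<omega> i * (- k i * y\<^sup>2 - M i t * \<bar>y\<bar> + \<Phi> i * \<bar>y\<bar> - a i * y\<^sup>2)"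
        using \<open>\<psi> i t * y \<le> \<Phi> i * \<bar>y\<bar>\<close> \<omega>0 by (intro mult_left_mono) auto
      also have "\<dots> = - (\<omega> i * (k i + a i) * y\<^sup>2) + \<omega> i * (\<Phi> i - M i t) * \<bar>y\<bar>"
        by (simp add: algebra_simps)
      finally show ?thesis by (simp add: y_def)
    qed
    have "0 \<le> \<omega> 1 * (k 1 + a 1) * (z 1 t)\<^sup>2" using \<omega>_pos k1 by simp
    then show ?thesis
      using coercive[OF H[OF t]] flux[of 0] flux[of 1]
      unfolding P_def weak_rhs_def N_def by (simp add: \<omega>_def)
  qed
  show ?thesis
  proof (rule that[of N P])
    show "Y t \<le> N t" for t using sq0 by (simp add: N_def)
  qed (use trace P_int P_le in auto)
qed

definition V :: "real \<Rightarrow> real" where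
  "V t = Y t / 2 + (\<Sum>i\<in>{0,1}. \<omega> i / \<gamma> i * (M i t - \<Phi> i)\<^sup>2 / 2)"

lemma Y_nonneg: "0 \<le> Y t"
  by (intro Bochner_Integration.integral_nonneg) auto

lemma Y_le_V: "Y t \<le> 2 * V t"
  using \<omega>_pos \<gamma>_pos by (simp add: V_def)

text \<open>\<open>P\<close> and \<open>N\<close> are exported together with \<open>Q\<close>
  because the case without leakage combines decay of \<open>V\<close> with the growth bound for the
  energy.\<close>

lemma lyapunov:
  obtains P Q N where
    "\<And>t. 0 < t \<Longrightarrow> Y t \<le> N t"
    "\<And>i t. i \<in> {0,1} \<Longrightarrow> 0 < t \<Longrightarrow> (z (real i) t)\<^sup>2 \<le> 2 * N t"
    "\<And>s t. 0 < s \<Longrightarrow> s \<le> t \<Longrightarrow> (P has_integral (Y t - Y s) / 2) {s..t}"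
    "\<And>t. 0 < t \<Longrightarrow> P t \<le> - c * N t + (\<Sum>i\<in>{0,1}. \<omega> i * (\<Phi> i - M i t) * \<bar>z (real i) t\<bar>)"
    "\<And>s t. 0 < s \<Longrightarrow> s \<le> t \<Longrightarrow> (Q has_integral V t - V s) {s..t}"
    "\<And>t. 0 < t \<Longrightarrow> Q t \<le> - c * N t - (\<Sum>i\<in>{0,1}. \<omega> i / \<gamma> i * \<alpha> i * M i t * (M i t - \<Phi> i))"
proof -
  obtain P N where
    1: "\<And>t. 0 < t \<Longrightarrow> Y t \<le> N t"
    "\<And>i t. i \<in> {0,1} \<Longrightarrow> 0 < t \<Longrightarrow> (z (real i) t)\<^sup>2 \<le> 2 * N t"
    and P: "\<And>s t. 0 < s \<Longrightarrow> s \<le> t \<Longrightarrow> (P has_integral (Y t - Y s) / 2) {s..t}"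
    and P_le: "\<And>t. 0 < t \<Longrightarrow> P t \<le> - c * N t + (\<Sum>i\<in>{0,1}. \<omega> i * (\<Phi> i - M i t) * \<bar>z (real i) t\<bar>)"
    by (rule dissipation) blast
  define Q where "Q = (\<lambda>t. P t + (\<Sum>i\<in>{0,1}. \<omega> i / \<gamma> i * ((M i t - \<Phi> i) * M' i t)))"
  have gain: "((\<lambda>t. (M i t - \<Phi> i) * M' i t) has_integral ((M i t - \<Phi> i)\<^sup>2 - (M i s - \<Phi> i)\<^sup>2) / 2) {s..t}"
    if i: "i \<in> {0,1}" and st: "0 < s" "s \<le> t" for i s t
  proof -
    have M': "M' i absolutely_integrable_on {s..t}"
      using gain_deriv_absolutely_integrable[OF i] st by simp
    have inc: "(M' i has_integral (M i x - \<Phi> i) - (M i s - \<Phi> i)) {s..x}" if "x \<in> {s..t}" for x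
      using gain_increment[OF i, of s x] st that by simp
    show ?thesis
      using has_integral_divide[OF product_of_indefinite_integrals(2)[OF st(2) M' M' inc inc], of 2]
      by (simp add: power2_eq_square mult.commute)
  qed
  show ?thesis
  proof (rule that[OF 1 P P_le, of Q])
    fix s t :: real assume st: "0 < s" "s \<le> t"
    have "(Q has_integral (Y t - Y s) / 2 +
        (\<Sum>i\<in>{0,1}. \<omega> i / \<gamma> i * (((M i t - \<Phi> i)\<^sup>2 - (M i s - \<Phi> i)\<^sup>2) / 2))) {s..t}"
      unfolding Q_def
      by (intro has_integral_add has_integral_sum has_integral_mult_right P gain st) auto
    moreover have "(Y t - Y s) / 2 + (\<Sum>i\<in>{0,1}. \<omega> i / \<gamma> i * (((M i t - \<Phi> i)\<^sup>2 - (M i s - \<Phi> i)\<^sup>2) / 2)) = V t - V s"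
      by (simp add: V_def algebra_simps add_divide_distrib diff_divide_distrib)
    ultimately show "(Q has_integral V t - V s) {s..t}" by simp
  next
    fix t :: real assume t: "0 < t"
    \<comment> \<open>The weight \<open>\<omega> i / \<gamma> i\<close> makes the adaptation term
      cancel the boundary excess in \<open>P\<close>; only the leakage term with
      \<open>\<alpha> i\<close> remains.\<close>
    have g: "\<omega> i / \<gamma> i * ((M i t - \<Phi> i) * M' i t)
      = - (\<omega> i / \<gamma> i * \<alpha> i * M i t * (M i t - \<Phi> i)) - \<omega> i * (\<Phi> i - M i t) * \<bar>z (real i) t\<bar>" if "\<gamma> i > 0" for i
      using that by (simp add: M'_def field_simps)
    show "Q t \<le> - c * N t - (\<Sum>i\<in>{0,1}. \<omega> i / \<gamma> i * \<alpha> i * M i t * (M i t - \<Phi> i))"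
      using P_le[OF t] g[OF \<gamma>_pos(1)] g[OF \<gamma>_pos(2)] by (simp add: Q_def)
  qed auto
qed

end

section \<open>The two adaptation modes\<close>

context closed_loop
begin

lemma V_nonneg: "0 \<le> V t"
  using Y_nonneg[of t] Y_le_V[of t] by linarith

text \<open>The right-hand side involves only data, not the solution, so the entry time derived from
  it serves all solutions with the same initial state. The two summands 1 come from the tolerances
  in \<open>bounded_start\<close>.\<close>

lemma initial_lyapunov_bound:
  obtains \<tau> where "0 < \<tau>" "\<tau> \<le> 1"
    "V \<tau> \<le> (\<integral>x. (z0 x)\<^sup>2 \<partial>I01) + 1 + (\<Sum>i\<in>{0,1}. \<omega> i / \<gamma> i * (\<bar>M0 i\<bar> + 1 + \<bar>\<Phi> i\<bar>)\<^sup>2 / 2)"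
proof -
  obtain \<tau> where \<tau>: "0 < \<tau>" "\<tau> \<le> 1" "Y \<tau> \<le> 2 * Y 0 + 2" "\<bar>M 0 \<tau> - M0 0\<bar> \<le> 1" "\<bar>M 1 \<tau> - M0 1\<bar> \<le> 1"
    by (rule bounded_start)
  have "(\<Sum>i\<in>{0,1}. \<omega> i / \<gamma> i * (M i \<tau> - \<Phi> i)\<^sup>2 / 2)
      \<le> (\<Sum>i\<in>{0,1}. \<omega> i / \<gamma> i * (\<bar>M0 i\<bar> + 1 + \<bar>\<Phi> i\<bar>)\<^sup>2 / 2)"
  proof (rule sum_mono)
    fix i :: nat assume i: "i \<in> {0,1}"
    then have "\<bar>M i \<tau> - M0 i\<bar> \<le> 1" using \<tau> by auto
    then have "\<bar>M i \<tau> - \<Phi> i\<bar> \<le> \<bar>M0 i\<bar> + 1 + \<bar>\<Phi> i\<bar>" by linarith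
    then have "(M i \<tau> - \<Phi> i)\<^sup>2 \<le> (\<bar>M0 i\<bar> + 1 + \<bar>\<Phi> i\<bar>)\<^sup>2"
      by (metis abs_ge_zero power2_abs power_mono)
    moreover have "0 \<le> \<omega> i / \<gamma> i" using i \<omega>_pos \<gamma>_pos by auto
    ultimately show "\<omega> i / \<gamma> i * (M i \<tau> - \<Phi> i)\<^sup>2 / 2 \<le> \<omega> i / \<gamma> i * (\<bar>M0 i\<bar> + 1 + \<bar>\<Phi> i\<bar>)\<^sup>2 / 2"
      by (intro divide_right_mono mult_left_mono) auto
  qed
  then show ?thesis
    using that[OF \<tau>(1,2)] \<tau>(3) by (simp add: V_def initial_energy)
qed

text \<open>The energy part \<open>Y / 2\<close> of \<open>V\<close> decays at rate
  \<open>2 * c\<close> and the gain part at the leakage rates, so \<open>d\<close> is their minimum.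
  Leakage pulls the gains to zero instead of to \<open>\<Phi>\<close>, which leaves the constant
  source \<open>D\<close>.\<close>

lemma bidirectional_bound:
  assumes \<alpha>: "0 < \<alpha> 0" "0 < \<alpha> 1"
  defines "d \<equiv> min (2 * c) (min (\<alpha> 0) (\<alpha> 1))"
    and "D \<equiv> \<Sum>i\<in>{0,1}. \<omega> i / \<gamma> i * \<alpha> i * (\<Phi> i)\<^sup>2 / 2"
    and "R \<equiv> (\<integral>x. (z0 x)\<^sup>2 \<partial>I01) + 1 + (\<Sum>i\<in>{0,1}. \<omega> i / \<gamma> i * (\<bar>M0 i\<bar> + 1 + \<bar>\<Phi> i\<bar>)\<^sup>2 / 2)"
  assumes t: "1 + R / d \<le> t"
  shows "L2_norm (\<lambda>x. z x t) \<le> sqrt (2 * (D / d + 1))"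
proof -
  obtain P Q N where N: "\<And>t. 0 < t \<Longrightarrow> Y t \<le> N t"
    and Q: "\<And>s t. 0 < s \<Longrightarrow> s \<le> t \<Longrightarrow> (Q has_integral V t - V s) {s..t}"
    and Q_le: "\<And>t. 0 < t \<Longrightarrow> Q t \<le> - c * N t - (\<Sum>i\<in>{0,1}. \<omega> i / \<gamma> i * \<alpha> i * M i t * (M i t - \<Phi> i))"
    by (rule lyapunov) blast
  have \<omega>\<gamma>: "0 < \<omega> i / \<gamma> i" "0 < \<alpha> i" if "i \<in> {0,1}" for i
    using \<omega>_pos \<gamma>_pos \<alpha> that by auto
  have d: "0 < d" "d \<le> 2 * c" "d \<le> \<alpha> 0" "d \<le> \<alpha> 1" using \<alpha> c_pos by (auto simp: d_def)
  have R0: "0 \<le> R" unfolding R_def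
    using \<omega>_pos \<gamma>_pos by (intro add_nonneg_nonneg sum_nonneg Bochner_Integration.integral_nonneg divide_nonneg_nonneg mult_nonneg_nonneg)
      (auto intro: less_imp_le)
  have D0: "0 \<le> D" unfolding D_def
    using \<omega>_pos \<gamma>_pos \<alpha> by (intro sum_nonneg divide_nonneg_nonneg mult_nonneg_nonneg) (auto intro: less_imp_le)
  have Q_d: "Q s \<le> D - d * V s" if s: "0 < s" for s
  proof -
    have gain: "- (\<omega> i / \<gamma> i * \<alpha> i * M i s * (M i s - \<Phi> i))
        \<le> \<omega> i / \<gamma> i * \<alpha> i * (\<Phi> i)\<^sup>2 / 2 - d * (\<omega> i / \<gamma> i * (M i s - \<Phi> i)\<^sup>2 / 2)" if i: "i \<in> {0,1}" for i
    proof -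
      define p where "p = \<omega> i / \<gamma> i"
      define e where "e = M i s - \<Phi> i"
      have p: "0 < p" using \<omega>\<gamma>[OF i] by (simp add: p_def)
      \<comment> \<open>The sum \<open>e + \<Phi> i\<close> is the gain; its square is what is
        discarded from the leakage term.\<close>
      have "0 \<le> (e + \<Phi> i)\<^sup>2" by simp
      then have "- (M i s * e) \<le> ((\<Phi> i)\<^sup>2 - e\<^sup>2) / 2"
        by (simp add: e_def power2_eq_square algebra_simps)
      then have "p * \<alpha> i * - (M i s * e) \<le> p * \<alpha> i * (((\<Phi> i)\<^sup>2 - e\<^sup>2) / 2)"
        using p \<omega>\<gamma>[OF i] by (intro mult_left_mono) auto
      moreover have "d * (p * e\<^sup>2) \<le> \<alpha> i * (p * e\<^sup>2)"
        using d i p by (intro mult_right_mono) auto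
      ultimately show ?thesis by (simp add: p_def[symmetric] e_def[symmetric] algebra_simps diff_divide_distrib)
    qed
    have "d * Y s \<le> 2 * c * N s"
      using d N[OF s] Y_nonneg[of s] c_pos by (intro mult_mono) auto
    then show ?thesis
      using Q_le[OF s] gain[of 0] gain[of 1] by (simp add: D_def V_def distrib_left)
  qed
  obtain \<tau> where \<tau>: "0 < \<tau>" "\<tau> \<le> 1" "V \<tau> \<le> R"
    unfolding R_def by (rule initial_lyapunov_bound)
  have "V t \<le> D / d + 1"
    by (rule ultimate_bound[OF d(1) D0 R0 V_nonneg Q Q_d \<tau> t])
  then have "Y t \<le> 2 * (D / d + 1)"
    using order_trans[OF Y_le_V[of t] mult_left_mono[of "V t" "D / d + 1" 2]] by simp
  then show ?thesis by (simp add: L2_norm_def)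
qed

text \<open>Without leakage the gains never decrease and stay nonnegative, so the boundary excess is
  at most \<open>\<Phi> i * \<bar>z\<bar>\<close> up to weights. Young's inequality absorbs this
  into the dissipation, which bounds the growth rate of the energy, while \<open>V\<close> pays for
  the time integral of the energy.\<close>

lemma monodirectional_convergence:
  assumes \<alpha>: "\<alpha> 0 = 0" "\<alpha> 1 = 0" and M0: "0 \<le> M0 0" "0 \<le> M0 1"
  shows "((\<lambda>t. L2_norm (\<lambda>x. z x t)) \<longlongrightarrow> 0) at_top"
proof -
  obtain P Q N where N: "\<And>t. 0 < t \<Longrightarrow> Y t \<le> N t"
    and trace: "\<And>i t. i \<in> {0,1} \<Longrightarrow> 0 < t \<Longrightarrow> (z (real i) t)\<^sup>2 \<le> 2 * N t"
    and P: "\<And>s t. 0 < s \<Longrightarrow> s \<le> t \<Longrightarrow> (P has_integral (Y t - Y s) / 2) {s..t}"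
    and P_le: "\<And>t. 0 < t \<Longrightarrow> P t \<le> - c * N t + (\<Sum>i\<in>{0,1}. \<omega> i * (\<Phi> i - M i t) * \<bar>z (real i) t\<bar>)"
    and Q: "\<And>s t. 0 < s \<Longrightarrow> s \<le> t \<Longrightarrow> (Q has_integral V t - V s) {s..t}"
    and Q_le: "\<And>t. 0 < t \<Longrightarrow> Q t \<le> - c * N t - (\<Sum>i\<in>{0,1}. \<omega> i / \<gamma> i * \<alpha> i * M i t * (M i t - \<Phi> i))"
    by (rule lyapunov) blast
  define W where "W t = Y t / 2" for t
  have \<omega>0: "0 \<le> \<omega> i" if "i \<in> {0,1}" for i using \<omega>_pos that by auto
  have M_nonneg: "0 \<le> M i t" if i: "i \<in> {0,1}" and t: "0 \<le> t" for i t
  proof -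
    have "\<alpha> i = 0" "0 < \<gamma> i" "0 \<le> M0 i" using i \<alpha> \<gamma>_pos M0 by auto
    then have "0 \<le> M i t - M i 0"
      using has_integral_nonneg[OF gain_has_integral[OF i t]] by (simp add: M'_def)
    then show ?thesis using \<open>0 \<le> M0 i\<close> gain_0[OF i] by simp
  qed
  \<comment> \<open>The sum is the remainder of Young's inequality at the two ends; the 1 makes
    \<open>C\<close> positive even when it vanishes.\<close>
  define C where "C = (\<Sum>i\<in>{0,1}. (\<omega> i * \<Phi> i)\<^sup>2 / c) + 1"
  have C: "0 < C" unfolding C_def using c_pos by (intro add_nonneg_pos sum_nonneg) auto
  have P_C: "P t \<le> C" if t: "0 < t" for t
  proof -
    \<comment> \<open>Each end may use half of the dissipation \<open>c * N t\<close>; with the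
      trace constant 2 this fixes the coefficient \<open>c / 4\<close> below.\<close>
    have young: "\<omega> i * (\<Phi> i - M i t) * \<bar>z (real i) t\<bar> \<le> c / 2 * N t + (\<omega> i * \<Phi> i)\<^sup>2 / c" if i: "i \<in> {0,1}" for i
    proof -
      define y where "y = \<bar>z (real i) t\<bar>"
      define x where "x = \<omega> i * \<Phi> i"
      have "\<omega> i * (\<Phi> i - M i t) * y \<le> x * y"
        unfolding x_def y_def using \<omega>0[OF i] M_nonneg[OF i, of t] t
        by (intro mult_right_mono mult_left_mono) auto
      also have "\<dots> \<le> c / 4 * y\<^sup>2 + x\<^sup>2 / c"
      proof -
        have "0 \<le> (c / 2 * y - x)\<^sup>2 / c" using c_pos by simp
        also have "\<dots> = c / 4 * y\<^sup>2 + x\<^sup>2 / c - x * y"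
          using c_pos by (simp add: power2_eq_square field_simps)
        finally show ?thesis by simp
      qed
      also have "c / 4 * y\<^sup>2 \<le> c / 4 * (2 * N t)"
        using trace[OF i t] c_pos by (intro mult_left_mono) (auto simp: y_def)
      finally show ?thesis by (simp add: x_def y_def)
    qed
    show ?thesis using P_le[OF t] young[of 0] young[of 1] by (simp add: C_def)
  qed
  have P_W: "(P has_integral W t - W s) {s..t}" if "0 < s" "s \<le> t" for s t
    using P[OF that] by (simp add: W_def diff_divide_distrib)
  have W_int: "W integrable_on {s..t}" if "0 < s" for s t
    by (rule integrable_continuous_real, rule has_integral_imp_continuous_on[of s t P])
      (use that P_W in auto)
  have "(W \<longlongrightarrow> 0) at_top"
  proof (rule tendsto_zero_of_finite_energy[OF _ C, of "2 * c" W V])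
    fix s t :: real assume st: "0 < s" "s \<le> t"
    show "W t - W s \<le> C * (t - s)"
      by (rule has_integral_le_const[OF P_W]) (use st P_C in auto)
    have "V t - V s \<le> - (2 * c) * integral {s..t} W"
    proof (rule has_integral_le[OF Q[OF st]])
      show "((\<lambda>\<sigma>. - (2 * c) * W \<sigma>) has_integral - (2 * c) * integral {s..t} W) {s..t}"
        using W_int[OF st(1), of t] by (intro has_integral_mult_right) (rule integrable_integral)
      fix \<sigma> assume "\<sigma> \<in> {s..t}"
      then have \<sigma>: "0 < \<sigma>" using st by auto
      have "c * Y \<sigma> \<le> c * N \<sigma>" using N[OF \<sigma>] c_pos by simp
      then show "Q \<sigma> \<le> - (2 * c) * W \<sigma>" using Q_le[OF \<sigma>] \<alpha> by (simp add: W_def)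
    qed
    then show "2 * c * integral {s..t} W \<le> V s - V t" by simp
  qed (use c_pos W_int Y_nonneg V_nonneg in \<open>auto simp: W_def\<close>)
  then have "((\<lambda>t. sqrt (2 * W t)) \<longlongrightarrow> sqrt (2 * 0)) at_top" by (intro tendsto_intros)
  then show ?thesis by (simp add: W_def L2_norm_def)
qed

end

text \<open>Passes to the worst case allowed by the bounds: the feedback strength
  \<open>h / b\<^sub>0\<close> is at least \<open>\<kappa> = h\<^sub>m / b\<^sub>M\<close>, since
  \<open>\<kappa>\<close> is positive. What remains is the inequality of
  \<open>coercivity_constant\<close>, fed by \<open>H1_poincare\<close>.\<close>

lemma coercive_boundary_form:
  fixes \<theta> lam :: "real \<Rightarrow> real" and \<theta>m \<Lambda> b\<^sub>0 b\<^sub>M h h\<^sub>m :: real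
  assumes \<theta>m: "0 < \<theta>m" and \<theta>: "continuous_on {0..1} \<theta>" "\<And>x. x \<in> {0..1} \<Longrightarrow> \<theta>m \<le> \<theta> x"
    and lam: "\<And>x. x \<in> {0..1} \<Longrightarrow> lam x \<le> \<Lambda>"
    and \<Lambda>: "0 \<le> \<Lambda>" "\<Lambda> < pi\<^sup>2 / 4 * \<theta>m"
    and b: "0 < b\<^sub>0" "b\<^sub>0 \<le> b\<^sub>M" and h: "h\<^sub>m \<le> h" "\<Lambda> * pi\<^sup>2 / (\<theta>m * pi\<^sup>2 - 4 * \<Lambda>) * b\<^sub>M < h\<^sub>m"
  obtains c where "0 < c"
    "\<And>w w'. H1 w w' \<Longrightarrow>
      - L2_inner (\<lambda>x. \<theta> x * w' x) w' + L2_inner (\<lambda>x. lam x * w x) w - \<theta> 0 / b\<^sub>0 * h * (w 0)\<^sup>2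
        \<le> - c * ((\<integral>x. (w x)\<^sup>2 \<partial>I01) + (\<integral>x. (w' x)\<^sup>2 \<partial>I01))"
proof -
  define \<kappa> where "\<kappa> = h\<^sub>m / b\<^sub>M"
  have k: "\<Lambda> * pi\<^sup>2 / (\<theta>m * pi\<^sup>2 - 4 * \<Lambda>) < \<kappa>" using b h by (simp add: \<kappa>_def pos_less_divide_eq)
  have "0 \<le> \<Lambda> * pi\<^sup>2 / (\<theta>m * pi\<^sup>2 - 4 * \<Lambda>)" using \<Lambda> by (intro divide_nonneg_pos) (auto simp: mult.commute)
  then have k0: "0 < \<kappa>" using k by linarith
  obtain c where c: "0 < c" and coer: "\<And>X Y q. 0 \<le> X \<Longrightarrow> 0 \<le> Y \<Longrightarrow> 0 \<le> q \<Longrightarrow>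
      (\<And>r. 1 < r \<Longrightarrow> Y \<le> r * (4 / pi\<^sup>2) * X + r / (r - 1) * q)
      \<Longrightarrow> - \<theta>m * X + \<Lambda> * Y - \<theta>m * \<kappa> * q \<le> - c * (X + Y)"
    by (rule coercivity_constant[OF \<theta>m \<Lambda> k]) blast
  show ?thesis
  proof (rule that[OF c])
    fix w w' assume w: "H1 w w'"
    define X where "X = (\<integral>x. (w' x)\<^sup>2 \<partial>I01)"
    define Y where "Y = (\<integral>x. (w x)\<^sup>2 \<partial>I01)"
    have X0: "0 \<le> X" and Y0: "0 \<le> Y"
      unfolding X_def Y_def by (intro Bochner_Integration.integral_nonneg; simp)+
    have "(\<integral>x. \<theta>m * (w' x)\<^sup>2 \<partial>I01) \<le> (\<integral>x. \<theta> x * w' x * w' x \<partial>I01)"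
    proof (rule integral_mono)
      show "integrable I01 (\<lambda>x. \<theta> x * w' x * w' x)"
        by (rule L2_mult_integrable[OF L2_continuous_mult[OF \<theta>(1)]]; rule H1_L2_deriv[OF w])
      fix x assume "x \<in> space I01"
      then show "\<theta>m * (w' x)\<^sup>2 \<le> \<theta> x * w' x * w' x"
        using \<theta>(2)[of x] by (simp add: power2_eq_square mult.assoc mult_right_mono)
    qed (use L2D(2)[OF H1_L2_deriv[OF w]] in auto)
    then have diffusion: "\<theta>m * X \<le> L2_inner (\<lambda>x. \<theta> x * w' x) w'"
      by (simp add: X_def L2_inner_def)
    have reaction: "L2_inner (\<lambda>x. lam x * w x) w \<le> \<Lambda> * Y"
    proof (cases "integrable I01 (\<lambda>x. lam x * w x * w x)")
      case True
      have "(\<integral>x. lam x * w x * w x \<partial>I01) \<le> (\<integral>x. \<Lambda> * (w x)\<^sup>2 \<partial>I01)"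
      proof (rule integral_mono[OF True])
        fix x assume "x \<in> space I01"
        then show "lam x * w x * w x \<le> \<Lambda> * (w x)\<^sup>2"
          using lam[of x] by (simp add: power2_eq_square mult.assoc mult_right_mono)
      qed (use L2D(2)[OF H1_L2[OF w]] in auto)
      then show ?thesis by (simp add: Y_def L2_inner_def)
    next
      \<comment> \<open>A Bochner integral that does not exist has the value 0, and the bound is
        nonnegative.\<close>
      case False
      then show ?thesis using \<Lambda> Y0 by (simp add: L2_inner_def not_integrable_integral_eq)
    qed
    have boundary: "\<theta>m * \<kappa> * (w 0)\<^sup>2 \<le> \<theta> 0 / b\<^sub>0 * h * (w 0)\<^sup>2"
    proof -
      have "\<kappa> * b\<^sub>0 \<le> \<kappa> * b\<^sub>M" using k0 b by simp
      also have "\<dots> = h\<^sub>m" using b by (simp add: \<kappa>_def)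
      finally have "\<kappa> \<le> h / b\<^sub>0" using h b by (simp add: pos_le_divide_eq)
      then have "\<theta>m * \<kappa> \<le> \<theta> 0 * (h / b\<^sub>0)"
        using \<theta>m \<theta>(2)[of 0] k0 by (intro mult_mono) auto
      then have "\<theta>m * \<kappa> * (w 0)\<^sup>2 \<le> \<theta> 0 * (h / b\<^sub>0) * (w 0)\<^sup>2" by (rule mult_right_mono) simp
      then show ?thesis by simp
    qed
    show "- L2_inner (\<lambda>x. \<theta> x * w' x) w' + L2_inner (\<lambda>x. lam x * w x) w - \<theta> 0 / b\<^sub>0 * h * (w 0)\<^sup>2
        \<le> - c * ((\<integral>x. (w x)\<^sup>2 \<partial>I01) + (\<integral>x. (w' x)\<^sup>2 \<partial>I01))"
      using coer[OF X0 Y0, of "(w 0)\<^sup>2"] H1_poincare[OF w, folded X_def Y_def] diffusion reaction boundary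
      unfolding X_def[symmetric] Y_def[symmetric] by (simp add: add.commute)
  qed
qed

theorem theorem1:
  fixes \<theta> lam :: "real \<Rightarrow> real"
    and \<theta>m \<theta>M lam_m lam_M lam_bar :: real
    and a b k \<alpha> \<gamma> M0 am aM bM \<Phi> :: "nat \<Rightarrow> real"
    and \<psi> :: "nat \<Rightarrow> real \<Rightarrow> real"
  assumes "C1_on {0..1} \<theta>"
    and "0 < \<theta>m"
    and "\<And>x. x \<in> {0..1} \<Longrightarrow> \<theta>m \<le> \<theta> x \<and> \<theta> x \<le> \<theta>M"
    and "\<And>x. x \<in> {0..1} \<Longrightarrow> lam_m \<le> lam x \<and> lam x \<le> lam_M"
    and "lam_M < pi\<^sup>2 / 4 * \<theta>m"
    and "\<And>i. i \<in> {0,1} \<Longrightarrow> am i \<le> a i \<and> a i \<le> aM i"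
    and "\<And>i. i \<in> {0,1} \<Longrightarrow> 0 < b i \<and> b i \<le> bM i"
    and "\<And>i t. i \<in> {0,1} \<Longrightarrow> t \<ge> 0 \<Longrightarrow> \<bar>\<psi> i t\<bar> \<le> \<Phi> i"
    and "\<And>i. i \<in> {0,1} \<Longrightarrow> M0 i \<ge> 0"
    and "\<And>i. i \<in> {0,1} \<Longrightarrow> \<gamma> i > 0"
    and "lam_bar = max 0 lam_M"
  shows
    "(\<alpha> 0 > 0 \<and> \<alpha> 1 > 0 \<and>
      k 0 > lam_bar * pi\<^sup>2 / (\<theta>m * pi\<^sup>2 - 4 * lam_bar) * bM 0 - am 0 \<and>
      k 1 \<ge> - am 1
      \<longrightarrow> (\<exists>B. \<forall>z0. L2 z0 \<longrightarrow> (\<exists>T\<ge>0. \<forall>z M.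
             closed_loop_solution \<theta> lam a b k \<alpha> \<gamma> M0 \<psi> z0 z M \<longrightarrow>
             (\<forall>t\<ge>T. L2_norm (\<lambda>x. z x t) \<le> B))))
     \<and>
     (\<alpha> 0 = 0 \<and> \<alpha> 1 = 0 \<and>
      (\<exists>\<psi>' \<Phi>d. \<forall>i\<in>{0,1}. \<forall>t\<ge>0.
         (\<psi> i has_real_derivative \<psi>' i t) (at t within {0..}) \<and> \<bar>\<psi>' i t\<bar> \<le> \<Phi>d i) \<and>
      k 0 \<ge> lam_bar * pi\<^sup>2 / (\<theta>m * pi\<^sup>2 - 4 * lam_bar) * bM 0 - am 0 + \<gamma> 0 \<and>
      k 1 \<ge> - am 1 + \<gamma> 1
      \<longrightarrow> (\<forall>z0 z M. L2 z0 \<longrightarrow> closed_loop_solution \<theta> lam a b k \<alpha> \<gamma> M0 \<psi> z0 z M \<longrightarrow>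
             ((\<lambda>t. L2_norm (\<lambda>x. z x t)) \<longlongrightarrow> 0) at_top))"
proof -
  define gain0 where "gain0 = lam_bar * pi\<^sup>2 / (\<theta>m * pi\<^sup>2 - 4 * lam_bar) * bM 0"
  have \<theta>: "continuous_on {0..1} \<theta>"
    using assms(1) unfolding C1_on_def continuous_on_eq_continuous_within
    by (meson has_field_derivative_imp_has_derivative has_derivative_continuous)
  have lam_bar: "0 \<le> lam_bar" "lam_bar < pi\<^sup>2 / 4 * \<theta>m"
    using assms(2,5,11) mult_pos_pos[of "pi\<^sup>2 / 4" \<theta>m] by (auto simp: max_def)
  have lam_le: "lam x \<le> lam_bar" if "x \<in> {0..1}" for x
    using assms(4)[OF that] assms(11) by auto
  have lam_abs: "\<bar>lam x\<bar> \<le> max \<bar>lam_m\<bar> \<bar>lam_M\<bar>" if "x \<in> {0..1}" for x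
    using assms(4)[OF that] by linarith
  \<comment> \<open>The constant \<open>c\<close> is chosen before the initial state and the
    solution, so the ultimate bound in the first part is common to all of them.\<close>
  have loop: "\<exists>c. \<forall>z0 z M. closed_loop_solution \<theta> lam a b k \<alpha> \<gamma> M0 \<psi> z0 z M \<longrightarrow>
      closed_loop \<theta> lam a b k \<alpha> \<gamma> M0 \<Phi> \<psi> z0 z M \<theta>M (max \<bar>lam_m\<bar> \<bar>lam_M\<bar>) c \<and> 0 < c"
    if k0: "gain0 < k 0 + am 0" and k1: "0 \<le> k 1 + am 1"
  proof -
    have a: "am 0 \<le> a 0" "am 1 \<le> a 1" using assms(6) by auto
    obtain c where c: "0 < c"
      "\<And>w w'. H1 w w' \<Longrightarrow>
        - L2_inner (\<lambda>x. \<theta> x * w' x) w' + L2_inner (\<lambda>x. lam x * w x) w - \<theta> 0 / b 0 * (k 0 + a 0) * (w 0)\<^sup>2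
          \<le> - c * ((\<integral>x. (w x)\<^sup>2 \<partial>I01) + (\<integral>x. (w' x)\<^sup>2 \<partial>I01))"
    proof (rule coercive_boundary_form[OF assms(2) \<theta> _ lam_le lam_bar])
      show "\<theta>m \<le> \<theta> x" if "x \<in> {0..1}" for x using assms(3)[OF that] by blast
      show "0 < b 0" "b 0 \<le> bM 0" using assms(7)[of 0] by auto
      show "k 0 + am 0 \<le> k 0 + a 0" using a by simp
      show "lam_bar * pi\<^sup>2 / (\<theta>m * pi\<^sup>2 - 4 * lam_bar) * bM 0 < k 0 + am 0" using k0 by (simp add: gain0_def)
    qed auto
    have "closed_loop \<theta> lam a b k \<alpha> \<gamma> M0 \<Phi> \<psi> z0 z M \<theta>M (max \<bar>lam_m\<bar> \<bar>lam_M\<bar>) c"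
      if "closed_loop_solution \<theta> lam a b k \<alpha> \<gamma> M0 \<psi> z0 z M" for z0 z M
    proof
      show "0 < \<theta> x \<and> \<theta> x \<le> \<theta>M" if "x \<in> {0..1}" for x using assms(2) assms(3)[OF that] by linarith
      show "0 < b 0" "0 < b 1" using assms(7) by auto
      show "0 < \<gamma> 0" "0 < \<gamma> 1" using assms(10) by auto
      show "0 \<le> k 1 + a 1" using k1 a by linarith
    qed (fact \<theta> lam_abs c assms(8) that)+
    then show ?thesis using c(1) by blast
  qed
  show ?thesis
  proof (intro conjI impI)
    assume *: "\<alpha> 0 > 0 \<and> \<alpha> 1 > 0 \<and>
      k 0 > lam_bar * pi\<^sup>2 / (\<theta>m * pi\<^sup>2 - 4 * lam_bar) * bM 0 - am 0 \<and> k 1 \<ge> - am 1"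
    then obtain c where c: "\<And>z0 z M. closed_loop_solution \<theta> lam a b k \<alpha> \<gamma> M0 \<psi> z0 z M \<Longrightarrow>
      closed_loop \<theta> lam a b k \<alpha> \<gamma> M0 \<Phi> \<psi> z0 z M \<theta>M (max \<bar>lam_m\<bar> \<bar>lam_M\<bar>) c \<and> 0 < c"
      using loop by (fastforce simp: gain0_def)
    define \<omega> where "\<omega> = closed_loop.\<omega> \<theta> b"
    define d where "d = min (2 * c) (min (\<alpha> 0) (\<alpha> 1))"
    define D where "D = (\<Sum>i\<in>{0,1}. \<omega> i / \<gamma> i * \<alpha> i * (\<Phi> i)\<^sup>2 / 2)"
    define R where "R z0 = (\<integral>x. (z0 x)\<^sup>2 \<partial>I01) + 1 + (\<Sum>i\<in>{0,1}. \<omega> i / \<gamma> i * (\<bar>M0 i\<bar> + 1 + \<bar>\<Phi> i\<bar>)\<^sup>2 / 2)" for z0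
    have "L2_norm (\<lambda>x. z x t) \<le> sqrt (2 * (D / d + 1))"
      if "closed_loop_solution \<theta> lam a b k \<alpha> \<gamma> M0 \<psi> z0 z M" "1 + R z0 / d \<le> t" for z0 z M t
      using closed_loop.bidirectional_bound[OF c[THEN conjunct1, OF that(1)]] * that(2)
      unfolding \<omega>_def d_def D_def R_def by blast
    \<comment> \<open>The maximum with 0 meets the demand that the entry time be
      nonnegative.\<close>
    then have "\<forall>t\<ge>max 0 (1 + R z0 / d). L2_norm (\<lambda>x. z x t) \<le> sqrt (2 * (D / d + 1))"
      if "closed_loop_solution \<theta> lam a b k \<alpha> \<gamma> M0 \<psi> z0 z M" for z0 z M
      using that by auto
    then show "\<exists>B. \<forall>z0. L2 z0 \<longrightarrow> (\<exists>T\<ge>0. \<forall>z M.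
             closed_loop_solution \<theta> lam a b k \<alpha> \<gamma> M0 \<psi> z0 z M \<longrightarrow>
             (\<forall>t\<ge>T. L2_norm (\<lambda>x. z x t) \<le> B))"
      by (meson max.cobounded1)
  next
    assume *: "\<alpha> 0 = 0 \<and> \<alpha> 1 = 0 \<and>
      (\<exists>\<psi>' \<Phi>d. \<forall>i\<in>{0,1}. \<forall>t\<ge>0.
         (\<psi> i has_real_derivative \<psi>' i t) (at t within {0..}) \<and> \<bar>\<psi>' i t\<bar> \<le> \<Phi>d i) \<and>
      k 0 \<ge> lam_bar * pi\<^sup>2 / (\<theta>m * pi\<^sup>2 - 4 * lam_bar) * bM 0 - am 0 + \<gamma> 0 \<and>
      k 1 \<ge> - am 1 + \<gamma> 1"
    \<comment> \<open>The summand \<open>\<gamma> 0\<close> turns the weak inequality for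
      \<open>k 0\<close> into the strict one that coercivity requires.\<close>
    have "gain0 < k 0 + am 0" "0 \<le> k 1 + am 1"
      using * assms(10)[of 0] assms(10)[of 1] by (auto simp: gain0_def)
    then obtain c where c: "\<And>z0 z M. closed_loop_solution \<theta> lam a b k \<alpha> \<gamma> M0 \<psi> z0 z M \<Longrightarrow>
      closed_loop \<theta> lam a b k \<alpha> \<gamma> M0 \<Phi> \<psi> z0 z M \<theta>M (max \<bar>lam_m\<bar> \<bar>lam_M\<bar>) c"
      using loop by blast
    then show "\<forall>z0 z M. L2 z0 \<longrightarrow> closed_loop_solution \<theta> lam a b k \<alpha> \<gamma> M0 \<psi> z0 z M \<longrightarrow>
             ((\<lambda>t. L2_norm (\<lambda>x. z x t)) \<longlongrightarrow> 0) at_top"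
      using closed_loop.monodirectional_convergence[OF c] * assms(9) by blast
  qed
qed

end
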